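(* Let $o\in\mathsf Q_{p,q}$ and let $g$ be an element of $G=\mathrm{PSL}(V)$. Then the following are equivalent: (1) $g$ belongs to $\mathscr B_{o,G}$, i.e. there exists $\mathcal C'\in\mathscr B_o$ such that $g\cdot\mathcal C'\in\mathscr B_o$. (2) $g$ belongs to $H^o\hat W\exp(\mathfrak b^+)H^o$. (3) The element $\sigma^o(g^{-1})g$ is diagonalizable with real eigenvalues. In this case, let $\tilde{\mathcal C}$ be an element of $\mathscr B_o$. Then $g\cdot\tilde{\mathcal C}$ belongs to $\mathscr B_o$ if and only if $\tilde{\mathcal C}$ diagonalizes $\sigma^o(g^{-1})g$.
   Context: Let $\mathbb K=\mathbb R$ or $\mathbb C$, let $p,q\geq 1$ be integers with $d=p+q\geq 3$, $V$ a $\mathbb K$-vector space of dimension $d$, $G=\mathrm{PSL}(V)$ with Lie algebra $\mathfrak g$. A form of signature $(p,q)$ on $V$ is a quadratic ($\mathbb K=\mathbb R$) or Hermitian ($\mathbb K=\mathbb C$) form of that signature; $\mathsf Q_{p,q}$ is the set of such forms up to positive real multiples. A basis of lines of $V$ is a set of $d$ lines spanning $V$; $\mathscr B_o$ is the set of $o$-orthogonal bases of lines (lines pairwise orthogonal for $o$), and $\mathscr B_{o,G}=\{g\in G:\exists\,\mathcal C'\in\mathscr B_o,\ g\cdot\mathcal C'\in\mathscr B_o\}$. For $o\in\mathsf Q_{p,q}$ with representative $\langle\cdot,\cdot\rangle_o$: $H^o\subset G$ is the group of projectivized linear isometries of $o$; ${}^{\star_o}T$ is the adjoint, $\langle Tu,v\rangle_o=\langle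 u,{}^{\star_o}Tv\rangle_o$; $\sigma^o(g)=({}^{\star_o}g)^{-1}$ is an involutive automorphism of $G$ with derivative $d\sigma^o$; $\mathfrak q^o=\{d\sigma^o=-1\}$. An element of $G$ is diagonalizable if it preserves each line of some basis of lines, which is then said to diagonalize it. Eigenvalues of $\sigma^o(g^{-1})g={}^{\star_o}g\,g$ are those of ${}^{\star_o}\hat g\,\hat g$ for a lift $\hat g\in\mathrm{SL}(V)$ of $g$ (independent of the lift). $\mathsf X_G$ is the set of Cartan involutions $\tau$ of $\mathfrak g$; $K^\tau$ is the stabilizer of $\tau$ in $G$, $\mathfrak p^\tau=\{\tau=-1\}$, and $\mathsf S^o=\{\tau\in\mathsf X_G:\tau d\sigma^o=d\sigma^o\tau\}$. Fix $\tau\in\mathsf S^o$ and a maximal subalgebra $\mathfrak b\subset\mathfrak p^\tau\cap\mathfrak q^o$; there is a basis of lines $\mathcal C$ of $V$, orthogonal for both $o$ and $\tau$ (viewed as an inner product class), such that $\mathfrak b$ is the set of elements of $\mathfrak g$ diagonal in $\mathcal C$ with real eigenvalues. $\hat W=N_{K^\tau}(\mathfrak b)$ is the normalizer of $\mathfrak b$ in $K^\tau$. Let $\mathfrak g^{\tau o}$ be the fixed subalgebra of $\tau d\sigma^o$ and fix a closed Weyl chamber $\mathfrak b^+\subset\mathfrak b$ of the set of restricted roots $\Sigma(\mathfrak g^{\tau o},\mathfrak b)$, i.e. the closure of a connected component of the complement in $\mathfrak b$ of the kernels of the roots in this set. *)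

theory Defs
  imports "HOL-Analysis.Analysis" "HOL-Algebra.Coset"
begin

text \<open>
  The ground field is \<open>\<real>\<close> or \<open>\<complex>\<close>. The class axiom says that a type of this class is either a copy of
  the reals with trivial conjugation, or a copy of the complex numbers with complex conjugation
  (\<open>i\<close> below being a square root of \<open>-1\<close>). The norm and inner product that come with the
  superclasses only serve to provide the usual topology on vectors and matrices.
\<close>

class real_or_complex = real_normed_field + euclidean_space +
  fixes kcnj :: "'a \<Rightarrow> 'a"
  assumes real_or_complex:
    "(\<forall>x. (\<exists>a. x = a *\<^sub>R 1) \<and> kcnj x = x) \<or>
     (\<exists>i. i * i = - 1 \<and> (\<forall>x. \<exists>a b. x = a *\<^sub>R 1 + b *\<^sub>R i) \<and>
          (\<forall>a b. kcnj (a *\<^sub>R 1 + b *\<^sub>R i) = a *\<^sub>R 1 - b *\<^sub>R i))"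

instantiation real :: real_or_complex
begin

definition kcnj_real :: "real \<Rightarrow> real" where "kcnj_real x = x"

instance
  by standard (auto simp: kcnj_real_def)

end

instantiation complex :: real_or_complex
begin

definition kcnj_complex :: "complex \<Rightarrow> complex" where "kcnj_complex = cnj"

instance
proof
  have "\<exists>a b. x = a *\<^sub>R 1 + b *\<^sub>R \<i>" for x :: complex
    by (intro exI[of _ "Re x"] exI[of _ "Im x"]) (simp add: complex_eq_iff)
  then show "(\<forall>x::complex. (\<exists>a. x = a *\<^sub>R 1) \<and> kcnj x = x) \<or>
    (\<exists>i::complex. i * i = - 1 \<and> (\<forall>x. \<exists>a b. x = a *\<^sub>R 1 + b *\<^sub>R i) \<and>
          (\<forall>a b. kcnj (a *\<^sub>R 1 + b *\<^sub>R i) = a *\<^sub>R 1 - b *\<^sub>R i))"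
    by (intro disjI2 exI[of _ \<i>]) (auto simp: kcnj_complex_def complex_eq_iff)
qed

end


section \<open>The group \<open>PSL(V)\<close> and its action on lines\<close>

text \<open>
  \<open>V\<close> is \<open>'k ^ 'n\<close>, and \<open>PSL(V)\<close> is the quotient of \<open>SL(V)\<close> by its centre, so that an element of
  \<open>PSL(V)\<close> is the set of all its lifts to \<open>SL(V)\<close>.
\<close>

definition SL :: "('k::real_or_complex ^ 'n ^ 'n) monoid" where
  "SL = \<lparr>carrier = {A. det A = 1}, mult = (**), one = mat 1\<rparr>"

definition SL_center :: "('k::real_or_complex ^ 'n ^ 'n) set" where
  "SL_center = {A. det A = 1 \<and> (\<exists>c. A = mat c)}"

definition PSL :: "('k::real_or_complex ^ 'n ^ 'n) set monoid" where
  "PSL = SL Mod SL_center"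

definition act_line ::
    "('k::real_or_complex ^ 'n ^ 'n) set \<Rightarrow> ('k ^ 'n) set \<Rightarrow> ('k ^ 'n) set" where
  "act_line g L = (\<Union>A\<in>g. (\<lambda>v. A *v v) ` L)"

definition act_lines ::
    "('k::real_or_complex ^ 'n ^ 'n) set \<Rightarrow> ('k ^ 'n) set set \<Rightarrow> ('k ^ 'n) set set" where
  "act_lines g \<C> = act_line g ` \<C>"

definition line_basis :: "('k::real_or_complex ^ 'n) set set \<Rightarrow> bool" where
  "line_basis \<C> \<longleftrightarrow> (\<forall>L\<in>\<C>. vec.subspace L \<and> vec.dim L = 1) \<and>
     finite \<C> \<and> card \<C> = CARD('n) \<and> vec.span (\<Union>\<C>) = UNIV"

definition diagonalizes ::
    "('k::real_or_complex ^ 'n) set set \<Rightarrow> ('k ^ 'n ^ 'n) set \<Rightarrow> bool" where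
  "diagonalizes \<C> g \<longleftrightarrow> line_basis \<C> \<and> (\<forall>L\<in>\<C>. act_line g L = L)"

definition diagonalizable :: "('k::real_or_complex ^ 'n ^ 'n) set \<Rightarrow> bool" where
  "diagonalizable g \<longleftrightarrow> (\<exists>\<C>. diagonalizes \<C> g)"

definition eigenvalue :: "'k::real_or_complex ^ 'n ^ 'n \<Rightarrow> 'k \<Rightarrow> bool" where
  "eigenvalue A c \<longleftrightarrow> (\<exists>v. v \<noteq> 0 \<and> A *v v = c *s v)"


section \<open>Forms of signature \<open>(p, q)\<close>\<close>

text \<open>
  Forms are given by their polarization; over the reals, \<^const>\<open>kcnj\<close> is the identity and these are
  the symmetric bilinear forms, that is, the quadratic forms.
\<close>

type_synonym ('k, 'n) form = "'k ^ 'n \<Rightarrow> 'k ^ 'n \<Rightarrow> 'k"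

definition hermitian_form :: "('k::real_or_complex, 'n::finite) form \<Rightarrow> bool" where
  "hermitian_form f \<longleftrightarrow>
     (\<forall>u v w. f (u + v) w = f u w + f v w) \<and>
     (\<forall>c u v. f (c *s u) v = c * f u v) \<and>
     (\<forall>u v. f v u = kcnj (f u v))"

definition has_signature :: "('k::real_or_complex, 'n::finite) form \<Rightarrow> nat \<Rightarrow> nat \<Rightarrow> bool" where
  "has_signature f p q \<longleftrightarrow>
     (\<exists>B. vec.independent B \<and> vec.span B = UNIV \<and>
          (\<forall>u\<in>B. \<forall>v\<in>B. u \<noteq> v \<longrightarrow> f u v = 0) \<and> (\<forall>u\<in>B. f u u = 1 \<or> f u u = -1) \<and>
          card {u\<in>B. f u u = 1} = p \<and> card {u\<in>B. f u u = -1} = q)"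

definition form_classes :: "nat \<Rightarrow> nat \<Rightarrow> ('k::real_or_complex, 'n::finite) form set set" where
  "form_classes p q =
     {f. hermitian_form f \<and> has_signature f p q} //
     {(f, f'). \<exists>c>0. f' = (\<lambda>u v. of_real c * f u v)}"

text \<open>
  In what follows \<open>\<omega>\<close> is a class of forms up to positive multiples. The notions below do not depend
  on the representative of the class, so they are stated for all representatives.
\<close>

definition orthogonal_for ::
    "('k::real_or_complex, 'n::finite) form set \<Rightarrow> 'k ^ 'n \<Rightarrow> 'k ^ 'n \<Rightarrow> bool" where
  "orthogonal_for \<omega> u v \<longleftrightarrow> (\<forall>f\<in>\<omega>. f u v = 0)"

definition orth_line_bases ::
    "('k::real_or_complex, 'n::finite) form set \<Rightarrow> ('k ^ 'n) set set set" where
  "orth_line_bases \<omega> =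
     {\<C>. line_basis \<C> \<and>
         (\<forall>L\<in>\<C>. \<forall>M\<in>\<C>. L \<noteq> M \<longrightarrow> (\<forall>u\<in>L. \<forall>v\<in>M. orthogonal_for \<omega> u v))}"

definition orth_line_bases_PSL ::
    "('k::real_or_complex, 'n::finite) form set \<Rightarrow> ('k ^ 'n ^ 'n) set set" where
  "orth_line_bases_PSL \<omega> =
     {g \<in> carrier PSL. \<exists>\<C>\<in>orth_line_bases \<omega>. act_lines g \<C> \<in> orth_line_bases \<omega>}"

definition isometry_of ::
    "('k::real_or_complex, 'n::finite) form set \<Rightarrow> 'k ^ 'n ^ 'n \<Rightarrow> bool" where
  "isometry_of \<omega> A \<longleftrightarrow> (\<forall>f\<in>\<omega>. \<forall>u v. f (A *v u) (A *v v) = f u v)"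

text \<open>
  An element of \<open>PSL(V)\<close> is the projectivization of a linear isometry if some nonzero multiple of
  a lift is an isometry.
\<close>

definition H_grp ::
    "('k::real_or_complex, 'n::finite) form set \<Rightarrow> ('k ^ 'n ^ 'n) set set" where
  "H_grp \<omega> = {g \<in> carrier PSL. \<exists>A\<in>g. \<exists>c. c \<noteq> 0 \<and> isometry_of \<omega> (mat c ** A)}"

definition adjoint_for ::
    "('k::real_or_complex, 'n::finite) form set \<Rightarrow> 'k ^ 'n ^ 'n \<Rightarrow> 'k ^ 'n ^ 'n" where
  "adjoint_for \<omega> T = (THE S. \<forall>f\<in>\<omega>. \<forall>u v. f (T *v u) v = f u (S *v v))"

definition \<sigma>_lift ::
    "('k::real_or_complex, 'n::finite) form set \<Rightarrow> 'k ^ 'n ^ 'n \<Rightarrow> 'k ^ 'n ^ 'n" where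
  "\<sigma>_lift \<omega> A = matrix_inv (adjoint_for \<omega> A)"

definition \<sigma>_grp ::
    "('k::real_or_complex, 'n::finite) form set \<Rightarrow> ('k ^ 'n ^ 'n) set \<Rightarrow> ('k ^ 'n ^ 'n) set" where
  "\<sigma>_grp \<omega> g = \<sigma>_lift \<omega> ` g"


section \<open>The Lie algebra and Cartan involutions\<close>

text \<open>
  The Lie algebra of \<open>PSL(V)\<close> is that of \<open>SL(V)\<close>. It is considered as a real Lie algebra also over
  the complex numbers. Maps between subsets of the Lie algebra are total functions on matrices of
  which only the values on the Lie algebra matter.
\<close>

definition sl :: "('k::real_or_complex ^ 'n ^ 'n) set" where
  "sl = {X. trace X = 0}"

definition lie :: "'k::real_or_complex ^ 'n ^ 'n \<Rightarrow> 'k ^ 'n ^ 'n \<Rightarrow> 'k ^ 'n ^ 'n" where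
  "lie X Y = X ** Y - Y ** X"

definition lie_subalgebra :: "('k::real_or_complex ^ 'n ^ 'n) set \<Rightarrow> bool" where
  "lie_subalgebra \<bb> \<longleftrightarrow> \<bb> \<subseteq> sl \<and> subspace \<bb> \<and> (\<forall>X\<in>\<bb>. \<forall>Y\<in>\<bb>. lie X Y \<in> \<bb>)"

definition matrix_exp :: "'k::real_or_complex ^ 'n ^ 'n \<Rightarrow> 'k ^ 'n ^ 'n" where
  "matrix_exp X = (\<Sum>k. (1 / fact k) *\<^sub>R ((\<lambda>M. X ** M) ^^ k) (mat 1))"

definition exp_PSL :: "'k::real_or_complex ^ 'n ^ 'n \<Rightarrow> ('k ^ 'n ^ 'n) set" where
  "exp_PSL X = SL_center #>\<^bsub>SL\<^esub> matrix_exp X"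

text \<open>The adjoint action of an element of \<open>PSL(V)\<close> can be computed with any of its lifts.\<close>

definition Ad ::
    "('k::real_or_complex ^ 'n ^ 'n) set \<Rightarrow> 'k ^ 'n ^ 'n \<Rightarrow> 'k ^ 'n ^ 'n" where
  "Ad g X = (THE Y. \<forall>A\<in>g. Y = A ** X ** matrix_inv A)"

definition d\<sigma> ::
    "('k::real_or_complex, 'n::finite) form set \<Rightarrow> 'k ^ 'n ^ 'n \<Rightarrow> 'k ^ 'n ^ 'n" where
  "d\<sigma> \<omega> = frechet_derivative (\<sigma>_lift \<omega>) (at (mat 1))"

text \<open>Trace of an endomorphism of a finite-dimensional real vector space \<open>S\<close>.\<close>

definition trace_on :: "'v::real_vector set \<Rightarrow> ('v \<Rightarrow> 'v) \<Rightarrow> real" where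
  "trace_on S F =
     (let B = (SOME B. independent B \<and> span B = S) in \<Sum>b\<in>B. representation B (F b) b)"

definition killing :: "'k::real_or_complex ^ 'n ^ 'n \<Rightarrow> 'k ^ 'n ^ 'n \<Rightarrow> real" where
  "killing X Y = trace_on sl (\<lambda>Z. lie X (lie Y Z))"

definition cartan_involutions ::
    "('k::real_or_complex ^ 'n ^ 'n \<Rightarrow> 'k ^ 'n ^ 'n) set" where
  "cartan_involutions =
     {\<tau>. (\<forall>X\<in>sl. \<tau> X \<in> sl \<and> \<tau> (\<tau> X) = X) \<and>
         (\<forall>X\<in>sl. \<forall>Y\<in>sl. \<tau> (X + Y) = \<tau> X + \<tau> Y) \<and>
         (\<forall>c::real. \<forall>X\<in>sl. \<tau> (c *\<^sub>R X) = c *\<^sub>R \<tau> X) \<and>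
         (\<forall>X\<in>sl. \<forall>Y\<in>sl. \<tau> (lie X Y) = lie (\<tau> X) (\<tau> Y)) \<and>
         (\<forall>X\<in>sl. X \<noteq> 0 \<longrightarrow> - killing X (\<tau> X) > 0)}"

text \<open>The group acts on Cartan involutions by \<open>g \<cdot> \<tau> = Ad g \<circ> \<tau> \<circ> Ad g\<^sup>-\<^sup>1\<close>.\<close>

definition K_grp ::
    "('k::real_or_complex ^ 'n ^ 'n \<Rightarrow> 'k ^ 'n ^ 'n) \<Rightarrow> ('k ^ 'n ^ 'n) set set" where
  "K_grp \<tau> = {g \<in> carrier PSL. \<forall>X\<in>sl. Ad g (\<tau> (Ad (inv\<^bsub>PSL\<^esub> g) X)) = \<tau> X}"

definition \<pp> ::
    "('k::real_or_complex ^ 'n ^ 'n \<Rightarrow> 'k ^ 'n ^ 'n) \<Rightarrow> ('k ^ 'n ^ 'n) set" where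
  "\<pp> \<tau> = {X \<in> sl. \<tau> X = - X}"

definition \<qq> ::
    "('k::real_or_complex, 'n::finite) form set \<Rightarrow> ('k ^ 'n ^ 'n) set" where
  "\<qq> \<omega> = {X \<in> sl. d\<sigma> \<omega> X = - X}"

definition S_inv ::
    "('k::real_or_complex, 'n::finite) form set \<Rightarrow> ('k ^ 'n ^ 'n \<Rightarrow> 'k ^ 'n ^ 'n) set" where
  "S_inv \<omega> = {\<tau> \<in> cartan_involutions. \<forall>X\<in>sl. \<tau> (d\<sigma> \<omega> X) = d\<sigma> \<omega> (\<tau> X)}"

definition maximal_subalgebra_in ::
    "('k::real_or_complex ^ 'n ^ 'n) set \<Rightarrow> ('k ^ 'n ^ 'n) set \<Rightarrow> bool" where
  "maximal_subalgebra_in S \<bb> \<longleftrightarrow> lie_subalgebra \<bb> \<and> \<bb> \<subseteq> S \<and>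
     (\<forall>\<bb>'. lie_subalgebra \<bb>' \<and> \<bb>' \<subseteq> S \<and> \<bb> \<subseteq> \<bb>' \<longrightarrow> \<bb>' = \<bb>)"

definition W_hat ::
    "('k::real_or_complex ^ 'n ^ 'n \<Rightarrow> 'k ^ 'n ^ 'n) \<Rightarrow> ('k ^ 'n ^ 'n) set \<Rightarrow>
     ('k ^ 'n ^ 'n) set set" where
  "W_hat \<tau> \<bb> = {k \<in> K_grp \<tau>. Ad k ` \<bb> = \<bb>}"

definition fixed_subalgebra ::
    "('k::real_or_complex ^ 'n ^ 'n \<Rightarrow> 'k ^ 'n ^ 'n) \<Rightarrow> ('k, 'n::finite) form set \<Rightarrow>
     ('k ^ 'n ^ 'n) set" where
  "fixed_subalgebra \<tau> \<omega> = {X \<in> sl. \<tau> (d\<sigma> \<omega> X) = X}"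

text \<open>Roots are linear forms on \<open>\<bb>\<close>, represented by functions that are \<^const>\<open>undefined\<close> off \<open>\<bb>\<close>.\<close>

definition restricted_roots ::
    "('k::real_or_complex ^ 'n ^ 'n) set \<Rightarrow> ('k ^ 'n ^ 'n) set \<Rightarrow> ('k ^ 'n ^ 'n \<Rightarrow> real) set" where
  "restricted_roots \<hh> \<bb> =
     {\<alpha> \<in> extensional \<bb>.
        (\<forall>Y\<in>\<bb>. \<forall>Z\<in>\<bb>. \<alpha> (Y + Z) = \<alpha> Y + \<alpha> Z) \<and> (\<forall>c. \<forall>Y\<in>\<bb>. \<alpha> (c *\<^sub>R Y) = c * \<alpha> Y) \<and>
        (\<exists>Y\<in>\<bb>. \<alpha> Y \<noteq> 0) \<and>
        (\<exists>X\<in>\<hh>. X \<noteq> 0 \<and> (\<forall>Y\<in>\<bb>. lie Y X = \<alpha> Y *\<^sub>R X))}"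

definition closed_weyl_chamber ::
    "('k::real_or_complex ^ 'n ^ 'n \<Rightarrow> real) set \<Rightarrow> ('k ^ 'n ^ 'n) set \<Rightarrow>
     ('k ^ 'n ^ 'n) set \<Rightarrow> bool" where
  "closed_weyl_chamber R \<bb> \<bb>p \<longleftrightarrow>
     (\<exists>C \<in> components (\<bb> - (\<Union>\<alpha>\<in>R. {Y\<in>\<bb>. \<alpha> Y = 0})). \<bb>p = closure C)"

end

theory Submission
  imports Defs
begin

text \<open>
  Let \<open>A\<close> be a lift of \<open>g\<close> and \<open>A\<^sup>\<star>\<close> its adjoint for the form. Everything rests on the identity
  \<open>o(A u, A v) = o(u, A\<^sup>\<star> A v)\<close>. Applied to an orthogonal basis, it says that the image of the basis
  under \<open>A\<close> is orthogonal if and only if \<open>A\<^sup>\<star> A\<close> sends each basis vector into its own line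
  (\<open>orthogonal_image_iff_eigenvectors\<close>); the eigenvalues are then real because \<open>A\<^sup>\<star> A\<close> is self-adjoint
  and basis vectors are anisotropic. As \<open>A\<^sup>\<star> A\<close> is a lift of \<open>\<sigma>(g\<^sup>-\<^sup>1) g\<close>, this gives the last assertion and
  one half of the equivalence with diagonalizability. For the other half, a self-adjoint operator that
  is diagonalizable over the reals has an orthogonal eigenbasis, also for an indefinite form
  (\<open>self_adjoint_orthogonal_eigenbasis\<close>).

  For the decomposition \<open>H W exp(\<bb>\<^sup>+) H\<close>, isometries move an orthogonal basis and its orthogonal image
  to one fixed orthogonal basis \<open>P\<close>, by the law of inertia. Then \<open>A\<close> becomes monomial in \<open>P\<close>, that is, a
  unitary monomial matrix times a positive diagonal one. If \<open>P\<close> is orthonormal for the inner product of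
  \<open>\<tau>\<close> and \<open>\<bb>\<close> is the real diagonal algebra of \<open>P\<close>, then the first factor lies in \<open>W\<close> and the second in
  \<open>exp \<bb>\<close>. The roots of the fixed algebra of \<open>\<tau> d\<sigma>\<close> are the differences of two coordinates of the same
  sign, so a permutation matrix that preserves signs moves the second factor into \<open>exp \<bb>\<^sup>+\<close>; such a
  permutation is an isometry and can be absorbed into \<open>W\<close> and \<open>H\<close>
  (\<open>chamber_meets_orbits\<close>, \<open>orth_line_bases_PSL_decompose\<close>). Conversely, elements that normalize \<open>\<bb>\<close> are
  monomial in \<open>P\<close> and thus preserve the orthogonality of \<open>P\<close> (\<open>decompose_orth_line_bases_PSL\<close>).

  It remains to find \<open>P\<close>, given \<open>\<tau>\<close> only as an abstract Cartan involution. The automorphisms of \<open>sl(V)\<close>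
  that commute with \<open>\<tau>\<close> preserve the norm \<open>- B(X, \<tau> X)\<close>, where \<open>B\<close> is the Killing form; hence the
  matrices that induce them form a group that is bounded up to scalars, and this group leaves an inner
  product on \<open>V\<close> invariant (\<open>bounded_linear_group_fixed_point\<close>). It contains the one-parameter groups
  of the fixed points of \<open>\<tau>\<close>, which are therefore skew, and comparing signs of \<open>B\<close> shows that \<open>\<tau>\<close> is
  minus the adjoint for this inner product (\<open>standard_form\<close>). As \<open>\<tau>\<close> commutes with \<open>d\<sigma>\<close>, the inner
  product can be scaled so that it agrees with \<open>o\<close> up to sign on two orthogonal subspaces; a common
  orthonormal eigenbasis of \<open>\<bb>\<close> adapted to them is the required \<open>P\<close> (\<open>adapted_basis\<close>).
\<close>

section \<open>Scalars, the Hermitian product and conjugate transposes\<close>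

text \<open>
  Allowing \<open>i = 0\<close> for the real numbers gives one argument for both ground fields.
\<close>

lemma scalar_decomposition:
  obtains i :: "'k::real_or_complex" where "i = 0 \<or> i * i = - 1"
    and "\<And>x. \<exists>a b. x = of_real a + of_real b * i"
    and "\<And>a b. kcnj (of_real a + of_real b * i) = of_real a - of_real b * i"
proof -
  consider "\<forall>x::'k. (\<exists>a. x = a *\<^sub>R 1) \<and> kcnj x = x"
    | i where "i * i = - 1" "\<forall>x::'k. \<exists>a b. x = a *\<^sub>R 1 + b *\<^sub>R i"
        "\<forall>a b. kcnj (a *\<^sub>R 1 + b *\<^sub>R i) = a *\<^sub>R 1 - b *\<^sub>R i"
    using real_or_complex by blast
  then show ?thesis
  proof cases
    case 1
    show ?thesis by (rule that[of 0]) (use 1 in \<open>auto simp: of_real_def\<close>)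
  next
    case 2
    show ?thesis by (rule that[of i]) (use 2 in \<open>auto simp: of_real_def\<close>)
  qed
qed

lemma kcnj_add [simp]: "kcnj (x + y) = kcnj x + kcnj (y :: 'k::real_or_complex)"
proof -
  obtain i :: 'k where i: "\<And>x. \<exists>a b. x = of_real a + of_real b * i"
    "\<And>a b. kcnj (of_real a + of_real b * i) = of_real a - of_real b * i"
    using scalar_decomposition by metis
  obtain a b c d where x: "x = of_real a + of_real b * i" and y: "y = of_real c + of_real d * i"
    using i(1) by metis
  have "x + y = of_real (a + c) + of_real (b + d) * i" by (simp add: x y algebra_simps)
  then have "kcnj (x + y) = of_real (a + c) - of_real (b + d) * i" by (simp only: i(2))
  then show ?thesis unfolding x y i(2) by (simp add: algebra_simps)
qed

lemma kcnj_mult [simp]: "kcnj (x * y) = kcnj x * kcnj (y :: 'k::real_or_complex)"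
proof -
  obtain i :: 'k where i: "i = 0 \<or> i * i = - 1" "\<And>x. \<exists>a b. x = of_real a + of_real b * i"
    "\<And>a b. kcnj (of_real a + of_real b * i) = of_real a - of_real b * i"
    using scalar_decomposition by metis
  obtain a b c d where x: "x = of_real a + of_real b * i" and y: "y = of_real c + of_real d * i"
    using i(2) by metis
  obtain s :: real where s: "i * i = of_real s"
    using i(1) by (metis mult_zero_left of_real_0 of_real_1 of_real_minus)
  have r: "(u + v * i) * (u' + v' * i) = (u * u' + v * v' * of_real s) + (u * v' + v * u') * i"
    for u v u' v' :: 'k
    unfolding s[symmetric] by (simp add: algebra_simps)
  have "x * y = of_real (a * c + b * d * s) + of_real (a * d + b * c) * i"
    unfolding x y r by simp
  then have "kcnj (x * y) = of_real (a * c + b * d * s) - of_real (a * d + b * c) * i"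
    by (simp only: i(3))
  moreover have "kcnj x * kcnj y = (of_real a + of_real (-b) * i) * (of_real c + of_real (-d) * i)"
    unfolding x y i(3) by simp
  moreover have "\<dots> = of_real (a * c + b * d * s) - of_real (a * d + b * c) * i"
    unfolding r by (simp add: algebra_simps)
  ultimately show ?thesis by simp
qed

lemma kcnj_of_real [simp]: "kcnj (of_real r :: 'k::real_or_complex) = of_real r"
proof -
  obtain i :: 'k where "\<And>a b. kcnj (of_real a + of_real b * i) = of_real a - of_real b * i"
    using scalar_decomposition by metis
  from this[of r 0] show ?thesis by simp
qed

lemma kcnj_kcnj [simp]: "kcnj (kcnj x) = (x :: 'k::real_or_complex)"
proof -
  obtain i :: 'k where i: "\<And>x. \<exists>a b. x = of_real a + of_real b * i"
    "\<And>a b. kcnj (of_real a + of_real b * i) = of_real a - of_real b * i"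
    using scalar_decomposition by metis
  obtain a b where x: "x = of_real a + of_real b * i" using i(1) by metis
  have "kcnj x = of_real a + of_real (- b) * i" unfolding x i(2) by simp
  then have "kcnj (kcnj x) = of_real a - of_real (- b) * i" by (simp only: i(2))
  then show ?thesis by (simp add: x)
qed

lemma kcnj_0 [simp]: "kcnj 0 = (0 :: 'k::real_or_complex)"
  and kcnj_1 [simp]: "kcnj 1 = (1 :: 'k::real_or_complex)"
  using kcnj_of_real[of 0] kcnj_of_real[of 1] by auto

lemma kcnj_minus [simp]: "kcnj (- x) = - kcnj (x :: 'k::real_or_complex)"
proof -
  have "kcnj (- 1 :: 'k) = - 1" using kcnj_of_real[of "-1"] by simp
  then show ?thesis using kcnj_mult[of "-1" x] by simp
qed

lemma kcnj_diff [simp]: "kcnj (x - y) = kcnj x - kcnj (y :: 'k::real_or_complex)"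
  using kcnj_add[of x "-y"] by simp

lemma kcnj_scaleR [simp]: "kcnj (r *\<^sub>R x) = r *\<^sub>R kcnj (x :: 'k::real_or_complex)"
  by (simp add: scaleR_conv_of_real)

lemma kcnj_sum [simp]: "kcnj (\<Sum>i\<in>A. f i) = (\<Sum>i\<in>A. kcnj (f i :: 'k::real_or_complex))"
  by (induction A rule: infinite_finite_induct) auto

lemma kcnj_prod [simp]: "kcnj (\<Prod>i\<in>A. f i) = (\<Prod>i\<in>A. kcnj (f i :: 'k::real_or_complex))"
  by (induction A rule: infinite_finite_induct) auto

lemma kcnj_of_int [simp]: "kcnj (of_int n :: 'k::real_or_complex) = of_int n"
  using kcnj_of_real[of "of_int n"] by simp

lemma kcnj_eq_0_iff [simp]: "kcnj x = 0 \<longleftrightarrow> x = (0 :: 'k::real_or_complex)"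
  by (metis kcnj_kcnj kcnj_0)

lemma kcnj_inverse [simp]: "kcnj (inverse x) = inverse (kcnj (x :: 'k::real_or_complex))"
proof (cases "x = 0")
  case False
  then have "kcnj x * kcnj (inverse x) = 1" by (simp flip: kcnj_mult)
  then show ?thesis by (metis inverse_unique)
qed auto

lemma kcnj_divide [simp]: "kcnj (x / y) = kcnj x / kcnj (y :: 'k::real_or_complex)"
  by (simp add: divide_inverse)

text \<open>
  The norm of the ground field is multiplicative and comes from an inner product; these two
  conditions force that inner product to be the standard one.
\<close>

lemma inner_eq_real_part_and_norm:
  fixes x y :: "'k::real_or_complex"
  shows "of_real (inner x y) = (x * kcnj y + kcnj x * y) / 2"
    and "x * kcnj x = of_real ((norm x)\<^sup>2)"
proof -
  obtain i :: 'k where i: "i = 0 \<or> i * i = - 1" "\<And>x. \<exists>a b. x = of_real a + of_real b * i"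
    "\<And>a b. kcnj (of_real a + of_real b * i) = of_real a - of_real b * i"
    using scalar_decomposition by metis
  have one: "inner (1::'k) 1 = 1" by (metis norm_one power_one power2_norm_eq_inner)
  have orth: "inner 1 i = 0"
  proof (cases "i = 0")
    case False
    then have ii: "i * i = - 1" using i(1) by auto
    have "norm (i * i) = 1" by (simp add: ii)
    then have "norm i = 1" by (simp add: norm_mult) (metis abs_norm_cancel abs_square_eq_1 power2_eq_square)
    moreover have "1 + i = i * (1 - i)" by (simp add: algebra_simps ii)
    ultimately have "norm (1 + i) = norm (1 - i)" by (simp add: norm_mult)
    then have "(norm (1 + i))\<^sup>2 = (norm (1 - i))\<^sup>2" by simp
    then show ?thesis by (simp add: power2_norm_eq_inner inner_simps inner_commute)
  qed auto
  obtain a b c d where x: "x = of_real a + of_real b * i" and y: "y = of_real c + of_real d * i"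
    using i(2) by metis
  obtain s :: real where s: "i * i = of_real s" "inner i i = - s"
  proof (cases "i = 0")
    case False
    then have ii: "i * i = - 1" using i(1) by auto
    have "norm (i * i) = 1" by (simp add: ii)
    then have "norm i = 1" by (simp add: norm_mult) (metis abs_norm_cancel abs_square_eq_1 power2_eq_square)
    then have "inner i i = 1" by (metis power2_norm_eq_inner power_one)
    then show ?thesis using that[of "-1"] ii by simp
  qed (use that[of 0] in auto)
  have r: "inner (of_real a + of_real b * i) (of_real c + of_real d * i) = a * c - b * d * s" for a b c d
    using one orth s(2)
    by (simp add: of_real_def inner_simps inner_commute algebra_simps)
  have q: "(u + v * i) * (u' - v' * i) = (u * u' - v * v' * of_real s) + (v * u' - u * v') * i"
    for u v u' v' :: 'k
    unfolding s(1)[symmetric] by (simp add: algebra_simps)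
  show "of_real (inner x y) = (x * kcnj y + kcnj x * y) / 2"
    unfolding mult.commute[of "kcnj x"] unfolding x y r i(3) q by (simp add: algebra_simps)
  show "x * kcnj x = of_real ((norm x)\<^sup>2)"
    unfolding power2_norm_eq_inner unfolding x r i(3) q by (simp add: algebra_simps)
qed

lemmas of_real_inner = inner_eq_real_part_and_norm(1)
lemmas mult_kcnj = inner_eq_real_part_and_norm(2)

text \<open>
  The real part, as the inner product of the ground field is the standard one.
\<close>

definition repart :: "'k::real_or_complex \<Rightarrow> real" where
  "repart x = inner x 1"

lemma of_real_repart: "of_real (repart x) = (x + kcnj x) / (2 :: 'k::real_or_complex)"
  unfolding repart_def of_real_inner by simp

lemma repart_add [simp]: "repart (x + y) = repart x + repart y"
  and repart_minus [simp]: "repart (- x) = - repart x"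
  and repart_diff [simp]: "repart (x - y) = repart x - repart y"
  and repart_scaleR [simp]: "repart (r *\<^sub>R x) = r * repart x"
  and repart_0 [simp]: "repart 0 = 0"
  by (auto simp: repart_def inner_simps)

lemma repart_sum: "repart (sum f A) = (\<Sum>x\<in>A. repart (f x))"
  by (induction A rule: infinite_finite_induct) auto

lemma repart_of_real [simp]: "repart (of_real r :: 'k::real_or_complex) = r"
  using of_real_repart[of "of_real r :: 'k"] by (simp del: of_real_add flip: of_real_add)

lemma repart_of_real_mult [simp]: "repart (of_real r * x) = r * repart x"
  by (metis repart_scaleR scaleR_conv_of_real)

lemma repart_kcnj [simp]: "repart (kcnj x) = repart (x :: 'k::real_or_complex)"
proof -
  have "of_real (repart (kcnj x)) = (of_real (repart x) :: 'k)"
    unfolding of_real_repart by (simp add: add.commute)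
  then show ?thesis by simp
qed

lemma inner_eq_repart: "inner x y = repart (x * kcnj (y :: 'k::real_or_complex))"
proof -
  have "of_real (inner x y) = (of_real (repart (x * kcnj y)) :: 'k)"
    unfolding of_real_repart of_real_inner by simp
  then show ?thesis by simp
qed

lemma inner_mult_left: "inner (c * x) x = repart c * (norm (x :: 'k::real_or_complex))\<^sup>2"
  unfolding inner_eq_repart mult.assoc mult_kcnj
  by (simp add: mult.commute[of c] del: of_real_power)

lemma real_iff_kcnj_eq: "x \<in> \<real> \<longleftrightarrow> kcnj x = (x :: 'k::real_or_complex)"
proof
  assume "kcnj x = x"
  then have "x = of_real (repart x)" by (simp add: of_real_repart)
  then show "x \<in> \<real>" by (metis Reals_of_real)
qed (auto elim!: Reals_cases)

lemma norm_kcnj [simp]: "norm (kcnj x) = norm (x :: 'k::real_or_complex)"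
proof -
  have "of_real ((norm (kcnj x))\<^sup>2) = (of_real ((norm x)\<^sup>2) :: 'k)"
    unfolding mult_kcnj[symmetric] by (simp add: mult.commute)
  then have "(norm (kcnj x))\<^sup>2 = (norm x)\<^sup>2" using of_real_eq_iff by blast
  then show ?thesis by simp
qed

definition hprod :: "'k::real_or_complex ^ 'n \<Rightarrow> 'k ^ 'n \<Rightarrow> 'k" where
  "hprod u v = (\<Sum>i\<in>UNIV. u $ i * kcnj (v $ i))"

definition ct :: "'k::real_or_complex ^ 'n ^ 'm \<Rightarrow> 'k ^ 'm ^ 'n" where
  "ct A = (\<chi> i j. kcnj (A $ j $ i))"

definition dg :: "('n \<Rightarrow> 'k) \<Rightarrow> 'k::real_or_complex ^ 'n ^ 'n" where
  "dg a = (\<chi> i j. if i = j then a i else 0)"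

abbreviation rdg :: "('n \<Rightarrow> real) \<Rightarrow> 'k::real_or_complex ^ 'n ^ 'n" where
  "rdg a \<equiv> dg (\<lambda>i. of_real (a i))"

lemma hprod_simps [simp]:
  "hprod (u + v) w = hprod u w + hprod v w" "hprod u (v + w) = hprod u v + hprod u w"
  "hprod (u - v) w = hprod u w - hprod v w" "hprod u (v - w) = hprod u v - hprod u w"
  "hprod (c *s u) w = c * hprod u w" "hprod u (c *s w) = kcnj c * hprod u w"
  "hprod 0 w = 0" "hprod u 0 = 0"
  by (auto simp: hprod_def sum.distrib sum_subtractf algebra_simps sum_distrib_left)

lemma hprod_commute: "hprod v u = kcnj (hprod u v)"
  by (simp add: hprod_def mult.commute)

lemma hprod_self: "hprod u u = of_real ((norm u)\<^sup>2)"
  by (simp add: hprod_def mult_kcnj norm_vec_def L2_set_def sum_nonneg)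

lemma hprod_self_eq_0 [simp]: "hprod u u = 0 \<longleftrightarrow> u = 0"
  by (simp add: hprod_self)

lemma inner_eq_repart_hprod: "inner u v = repart (hprod u v)"
  by (simp add: hprod_def inner_vec_def repart_sum inner_eq_repart)

lemma hprod_axis [simp]: "hprod u (axis i 1) = u $ i" "hprod (axis i 1) u = kcnj (u $ i)"
  by (simp_all add: hprod_def axis_def if_distrib if_distribR sum.delta cong: if_cong)

lemma hprod_eq_iff: "(\<forall>u. hprod u v = hprod u w) \<longleftrightarrow> v = w"
proof
  assume "\<forall>u. hprod u v = hprod u w"
  then have "hprod (v - w) (v - w) = 0" by simp
  then show "v = w" by (metis hprod_self_eq_0 right_minus_eq)
qed auto

lemma hprod_ct: "hprod (A *v u) v = hprod u (ct A *v v)"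
proof -
  have "hprod (A *v u) v = (\<Sum>i\<in>UNIV. \<Sum>j\<in>UNIV. A $ i $ j * u $ j * kcnj (v $ i))"
    by (simp add: hprod_def matrix_vector_mult_def sum_distrib_right)
  also have "\<dots> = (\<Sum>j\<in>UNIV. \<Sum>i\<in>UNIV. A $ i $ j * u $ j * kcnj (v $ i))"
    by (rule sum.swap)
  also have "\<dots> = hprod u (ct A *v v)"
    by (simp add: hprod_def matrix_vector_mult_def ct_def sum_distrib_left mult_ac)
  finally show ?thesis .
qed

lemma ct_ct [simp]: "ct (ct A) = A"
  by (simp add: ct_def)

lemma hprod_ct': "hprod u (A *v v) = hprod (ct A *v u) v"
  by (simp add: hprod_ct)

lemma ct_mult: "ct (A ** B) = ct B ** ct A"
  by (simp add: ct_def matrix_matrix_mult_def vec_eq_iff mult.commute)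

lemma ct_mat [simp]: "ct (mat c) = mat (kcnj c)"
  by (auto simp: ct_def mat_def vec_eq_iff)

lemma ct_add [simp]: "ct (A + B) = ct A + ct B"
  and ct_diff [simp]: "ct (A - B) = ct A - ct B"
  and ct_minus [simp]: "ct (- A) = - ct A"
  and ct_scaleR [simp]: "ct (r *\<^sub>R A) = r *\<^sub>R ct A"
  by (auto simp: ct_def vec_eq_iff)

lemma trace_ct [simp]: "trace (ct A) = kcnj (trace A)"
  by (simp add: trace_def ct_def)

lemma det_ct [simp]: "det (ct A) = kcnj (det A)"
proof -
  have "ct A = transpose (\<chi> i j. kcnj (A $ i $ j))" by (simp add: ct_def transpose_def)
  moreover have "det (\<chi> i j. kcnj (A $ i $ j)) = kcnj (det A)" by (simp add: det_def)
  ultimately show ?thesis by simp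
qed

lemma ct_dg [simp]: "ct (dg a) = dg (\<lambda>i. kcnj (a i))"
  by (auto simp: ct_def dg_def vec_eq_iff)

lemma dg_mult_nth [simp]: "(dg a ** A) $ i $ j = a i * A $ i $ j"
  and mult_dg_nth [simp]: "(A ** dg a) $ i $ j = A $ i $ j * a j"
  by (simp_all add: dg_def matrix_matrix_mult_def if_distrib if_distribR sum.delta sum.delta' cong: if_cong)

lemma dg_vec_nth [simp]: "(dg a *v v) $ i = a i * v $ i"
  by (simp add: dg_def matrix_vector_mult_def if_distrib if_distribR sum.delta sum.delta' cong: if_cong)

lemma dg_nth: "dg a $ i $ j = (if i = j then a i else 0)"
  by (simp add: dg_def)

lemma dg_mult: "dg a ** dg b = dg (\<lambda>i. a i * b i)"
  by (auto simp: vec_eq_iff dg_nth)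

lemma dg_eq_mat: "dg (\<lambda>_. c) = mat c"
  by (simp add: dg_def mat_def)

lemma det_dg: "det (dg a) = (\<Prod>i\<in>UNIV. a i)"
  by (subst det_diagonal) (auto simp: dg_def)

lemma trace_dg: "trace (dg a) = (\<Sum>i\<in>UNIV. a i)"
  by (simp add: trace_def dg_def)

lemma mat_mult_nth [simp]: "(mat c ** A) $ i $ j = c * A $ i $ j"
  and mult_mat_nth [simp]: "(A ** mat c) $ i $ j = A $ i $ j * (c::'k::real_or_complex)"
  by (simp_all add: mat_def matrix_matrix_mult_def if_distrib if_distribR sum.delta sum.delta' cong: if_cong)

lemma mat_commute: "mat c ** A = A ** mat (c::'k::real_or_complex)"
  by (simp add: vec_eq_iff)

lemma mat_mult_mat: "mat c ** mat d = mat (c * d :: 'k::real_or_complex)"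
  unfolding dg_eq_mat[symmetric] dg_mult ..

lemma mat_vec: "mat c *v v = c *s (v :: 'k::real_or_complex ^ 'n)"
  unfolding dg_eq_mat[symmetric] by (simp add: vec_eq_iff)

lemma det_mat: "det (mat c :: 'k::real_or_complex ^ 'n ^ 'n) = c ^ CARD('n)"
  unfolding dg_eq_mat[symmetric] det_dg by simp

lemma mat_vec_mult: "(mat c ** A) *v v = c *s (A *v (v :: 'k::real_or_complex ^ 'n))"
  by (simp flip: matrix_vector_mul_assoc add: mat_vec)

lemma matrix_vec_smult: "A *v (c *s v) = c *s (A *v (v :: 'k::real_or_complex ^ 'n))"
  by (rule vec.scale)

lemma inverse_pair_det: "A ** B = mat 1 \<Longrightarrow> det A * det B = (1 :: 'k::real_or_complex)"
  by (metis det_I det_mul)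

lemma matrix_inv_inverse:
  fixes A :: "'k::real_or_complex ^ 'n ^ 'n"
  assumes "invertible A"
  shows matrix_inv_right: "A ** matrix_inv A = mat 1" and matrix_inv_left: "matrix_inv A ** A = mat 1"
proof -
  have "\<exists>B. A ** B = mat 1 \<and> B ** A = mat 1" using assms by (simp add: invertible_def)
  then have "A ** matrix_inv A = mat 1 \<and> matrix_inv A ** A = mat 1"
    unfolding matrix_inv_def by (rule someI_ex)
  then show "A ** matrix_inv A = mat 1" "matrix_inv A ** A = mat 1" by auto
qed

lemma matrix_inv_eqI:
  fixes A B :: "'k::real_or_complex ^ 'n ^ 'n"
  assumes "A ** B = mat 1"
  shows "matrix_inv A = B"
proof -
  have "B ** A = mat 1" using assms by (rule matrix_left_right_inverse1)
  then have "invertible A" using assms invertible_def by blast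
  then show ?thesis
    by (metis assms matrix_inv_left matrix_mul_assoc matrix_mul_lid matrix_mul_rid)
qed

lemma det_1_invertible: "det A = (1 :: 'k::real_or_complex) \<Longrightarrow> invertible A"
  by (simp add: invertible_det_nz)

lemma matrix_sub_ldistrib: "A ** (B - C) = A ** B - A ** (C :: 'k::real_or_complex ^ _ ^ _)"
  by (simp add: vec_eq_iff matrix_matrix_mult_def sum_subtractf algebra_simps)

lemma matrix_sub_rdistrib: "(B - C) ** A = B ** A - C ** (A :: 'k::real_or_complex ^ _ ^ _)"
  by (simp add: vec_eq_iff matrix_matrix_mult_def sum_subtractf algebra_simps)

lemma matrix_minus_left: "(- B) ** A = - (B ** (A :: 'k::real_or_complex ^ _ ^ _))"
  by (simp add: vec_eq_iff matrix_matrix_mult_def sum_negf)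

lemma matrix_minus_right: "B ** (- A) = - (B ** (A :: 'k::real_or_complex ^ _ ^ _))"
  by (simp add: vec_eq_iff matrix_matrix_mult_def sum_negf)

lemma scaleR_left_mult: "(r *\<^sub>R A) ** B = r *\<^sub>R (A ** (B :: 'k::real_or_complex ^ _ ^ _))"
  by (simp add: vec_eq_iff matrix_matrix_mult_def scaleR_sum_right)

lemma scaleR_right_mult: "A ** (r *\<^sub>R B) = r *\<^sub>R (A ** (B :: 'k::real_or_complex ^ _ ^ _))"
  by (simp add: vec_eq_iff matrix_matrix_mult_def scaleR_sum_right)

lemma scaleR_eq_mat: "r *\<^sub>R A = mat (of_real r) ** (A :: 'k::real_or_complex ^ _ ^ _)"
  by (simp add: vec_eq_iff) (simp add: scaleR_conv_of_real)

section \<open>Cosets of the centre of \<open>SL(V)\<close>\<close>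

definition cls :: "'k::real_or_complex ^ 'n ^ 'n \<Rightarrow> ('k ^ 'n ^ 'n) set" where
  "cls A = SL_center #>\<^bsub>SL\<^esub> A"

lemma SL_simps [simp]:
  "carrier SL = {A. det A = 1}" "mult SL = (**)" "one SL = mat 1"
  by (auto simp: SL_def)

lemma group_SL: "group (SL :: ('k::real_or_complex ^ 'n ^ 'n) monoid)"
proof (rule groupI)
  fix A :: "'k ^ 'n ^ 'n"
  assume "A \<in> carrier SL"
  then have d: "det A = 1" by simp
  then have "matrix_inv A ** A = mat 1" by (simp add: det_1_invertible matrix_inv_left)
  moreover from this have "det (matrix_inv A) = 1" using d inverse_pair_det by fastforce
  ultimately show "\<exists>y\<in>carrier SL. y \<otimes>\<^bsub>SL\<^esub> A = \<one>\<^bsub>SL\<^esub>" by auto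
qed (auto simp: det_mul matrix_mul_assoc)

lemma inv_SL: "det A = 1 \<Longrightarrow> inv\<^bsub>SL\<^esub> A = matrix_inv (A :: 'k::real_or_complex ^ 'n ^ 'n)"
proof (rule group.inv_equality[OF group_SL])
  assume d: "det A = 1"
  then show "matrix_inv A \<otimes>\<^bsub>SL\<^esub> A = \<one>\<^bsub>SL\<^esub>" by (simp add: det_1_invertible matrix_inv_left)
  then show "matrix_inv A \<in> carrier SL" using d inverse_pair_det by fastforce
qed simp

lemma normal_SL_center: "normal SL_center (SL :: ('k::real_or_complex ^ 'n ^ 'n) monoid)"
proof (rule group.normalI[OF group_SL])
  show "subgroup SL_center (SL :: ('k ^ 'n ^ 'n) monoid)"
  proof (rule group.subgroupI[OF group_SL])
    show "SL_center \<subseteq> carrier (SL :: ('k ^ 'n ^ 'n) monoid)" by (auto simp: SL_center_def)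
    have "mat 1 \<in> (SL_center :: ('k ^ 'n ^ 'n) set)" by (auto simp: SL_center_def)
    then show "(SL_center :: ('k ^ 'n ^ 'n) set) \<noteq> {}" by blast
    fix a b :: "'k ^ 'n ^ 'n"
    assume "a \<in> SL_center"
    then obtain c where c: "a = mat c" "det a = 1" by (auto simp: SL_center_def)
    have "c \<noteq> 0" using c by (metis det_0 zero_neq_one)
    then have "a ** mat (inverse c) = mat 1" by (simp add: c mat_mult_mat)
    then have "matrix_inv a = mat (inverse c)" "det (mat (inverse c) :: 'k ^ 'n ^ 'n) = 1"
      using c(2) inverse_pair_det[of a "mat (inverse c)"] by (auto simp: matrix_inv_eqI)
    then show "inv\<^bsub>SL\<^esub> a \<in> SL_center" using c(2) by (auto simp: inv_SL SL_center_def)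
    assume "b \<in> SL_center"
    then show "a \<otimes>\<^bsub>SL\<^esub> b \<in> SL_center" using c by (auto simp: SL_center_def mat_mult_mat det_mul)
  qed
  show "\<forall>x\<in>carrier SL. SL_center #>\<^bsub>SL\<^esub> x = x <#\<^bsub>SL\<^esub> (SL_center :: ('k ^ 'n ^ 'n) set)"
    by (force simp: r_coset_def l_coset_def SL_center_def mat_commute)
qed

lemma cls_eq: "det A = 1 \<Longrightarrow> cls A = {mat c ** A | c. c ^ CARD('n) = 1}"
  for A :: "'k::real_or_complex ^ 'n ^ 'n"
proof
  assume "det A = 1"
  show "cls A \<subseteq> {mat c ** A | c. c ^ CARD('n) = 1}"
    by (auto simp: cls_def r_coset_def SL_center_def det_mat)
  show "{mat c ** A | c. c ^ CARD('n) = 1} \<subseteq> cls A"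
  proof
    fix B assume "B \<in> {mat c ** A | c. c ^ CARD('n) = 1}"
    then obtain c where "c ^ CARD('n) = 1" "B = mat c ** A" by blast
    then have "mat c \<in> (SL_center :: ('k ^ 'n ^ 'n) set)" "B = mat c \<otimes>\<^bsub>SL\<^esub> A"
      by (auto simp: SL_center_def det_mat)
    then show "B \<in> cls A" unfolding cls_def r_coset_def by blast
  qed
qed

lemma in_cls: "A \<in> cls (A :: 'k::real_or_complex ^ 'n ^ 'n)"
  by (auto simp: cls_def r_coset_def SL_center_def intro!: exI[of _ "mat 1"])

lemma carrier_PSL: "carrier PSL = cls ` {A :: 'k::real_or_complex ^ 'n ^ 'n. det A = 1}"
  by (simp add: PSL_def carrier_FactGroup cls_def[abs_def])

lemma mult_PSL: "det A = 1 \<Longrightarrow> det B = 1 \<Longrightarrow> cls A \<otimes>\<^bsub>PSL\<^esub> cls B = cls (A ** B)"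
  for A B :: "'k::real_or_complex ^ 'n ^ 'n"
  using normal.rcos_sum[OF normal_SL_center, of A B] by (simp add: PSL_def cls_def)

lemma inv_PSL: "det A = 1 \<Longrightarrow> inv\<^bsub>PSL\<^esub> cls A = cls (matrix_inv A)"
  for A :: "'k::real_or_complex ^ 'n ^ 'n"
  using normal.inv_FactGroup[OF normal_SL_center, of "cls A"] normal.rcos_inv[OF normal_SL_center, of A]
  by (simp add: PSL_def cls_def carrier_FactGroup inv_SL)

lemma det_matrix_inv: "det A = 1 \<Longrightarrow> det (matrix_inv A) = (1 :: 'k::real_or_complex)"
  using inverse_pair_det[of "matrix_inv A" A] by (simp add: det_1_invertible matrix_inv_left)

lemma det_in_cls: "det A = 1 \<Longrightarrow> B \<in> cls A \<Longrightarrow> det B = 1"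
  for A :: "'k::real_or_complex ^ 'n ^ 'n"
  by (auto simp: cls_eq det_mul det_mat)

lemma cls_eqI:
  fixes A :: "'k::real_or_complex ^ 'n ^ 'n"
  assumes "det A = 1" "B \<in> cls A"
  shows "cls B = cls A"
proof -
  have "B \<in> SL_center #>\<^bsub>SL\<^esub> A" "A \<in> carrier SL" using assms by (auto simp: cls_def)
  from group.repr_independence[OF group_SL this normal_imp_subgroup[OF normal_SL_center]]
  show ?thesis by (simp add: cls_def)
qed

lemma matrix_inv_mat_mult:
  fixes A :: "'k::real_or_complex ^ 'n ^ 'n"
  assumes "invertible A" "c \<noteq> 0"
  shows "matrix_inv (mat c ** A) = mat (inverse c) ** matrix_inv A"
proof (rule matrix_inv_eqI)
  have "mat c ** A ** (mat (inverse c) ** matrix_inv A) = (mat c ** mat (inverse c)) ** (A ** matrix_inv A)"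
    by (metis mat_commute matrix_mul_assoc)
  then show "mat c ** A ** (mat (inverse c) ** matrix_inv A) = mat 1"
    using assms by (simp add: mat_mult_mat matrix_inv_right)
qed

lemma conj_mat_mult:
  fixes A :: "'k::real_or_complex ^ 'n ^ 'n"
  assumes "invertible A" "c \<noteq> 0"
  shows "(mat c ** A) ** X ** matrix_inv (mat c ** A) = A ** X ** matrix_inv A"
proof -
  have "(mat c ** A) ** X ** matrix_inv (mat c ** A)
      = (mat c ** mat (inverse c)) ** (A ** X ** matrix_inv A)"
    unfolding matrix_inv_mat_mult[OF assms] by (metis mat_commute matrix_mul_assoc)
  then show ?thesis using assms by (simp add: mat_mult_mat)
qed

lemma root_of_unity_nonzero: "(c::'k::real_or_complex) ^ CARD('n::finite) = 1 \<Longrightarrow> c \<noteq> 0"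
  by (auto simp: power_0_left)

lemma Ad_cls:
  fixes A :: "'k::real_or_complex ^ 'n ^ 'n"
  assumes "det A = 1"
  shows "Ad (cls A) X = A ** X ** matrix_inv A"
  unfolding Ad_def
proof (rule the_equality)
  show "\<forall>B\<in>cls A. A ** X ** matrix_inv A = B ** X ** matrix_inv B"
  proof
    fix B assume "B \<in> cls A"
    then obtain c where "c ^ CARD('n) = 1" "B = mat c ** A" using assms by (auto simp: cls_eq)
    then show "A ** X ** matrix_inv A = B ** X ** matrix_inv B"
      using conj_mat_mult[OF det_1_invertible[OF assms] root_of_unity_nonzero[where 'n = 'n]] by simp
  qed
qed (use in_cls in blast)

text \<open>Lifts differ by scalars, which a subspace absorbs.\<close>

lemma act_line_cls:
  fixes A :: "'k::real_or_complex ^ 'n ^ 'n"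
  assumes d: "det A = 1" and L: "vec.subspace L"
  shows "act_line (cls A) L = (*v) A ` L"
proof
  show "(*v) A ` L \<subseteq> act_line (cls A) L" unfolding act_line_def using in_cls by blast
  show "act_line (cls A) L \<subseteq> (*v) A ` L"
  proof
    fix w assume "w \<in> act_line (cls A) L"
    then obtain c v where v: "v \<in> L" "w = (mat c ** A) *v v"
      by (auto simp: act_line_def cls_eq d)
    have "w = A *v (c *s v)" by (simp add: v mat_vec_mult matrix_vec_smult)
    moreover have "c *s v \<in> L" using L v(1) by (simp add: vec.subspace_scale)
    ultimately show "w \<in> (*v) A ` L" by blast
  qed
qed

section \<open>Bases of lines as columns of invertible matrices\<close>

definition lines :: "'k::real_or_complex ^ 'n ^ 'n \<Rightarrow> ('k ^ 'n) set set" where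
  "lines Q = range (\<lambda>j. vec.span {column j Q})"

lemma column_mult: "column j (A ** Q) = A *v column j Q"
  by (simp add: column_def matrix_matrix_mult_def matrix_vector_mult_def vec_eq_iff)

lemma column_eq_axis: "column j Q = Q *v axis j (1::'k::real_or_complex)"
  by (simp add: column_def matrix_vector_mult_def vec_eq_iff axis_def if_distrib cong: if_cong)

lemma column_nonzero: "invertible Q \<Longrightarrow> column j Q \<noteq> 0"
  for Q :: "'k::real_or_complex ^ 'n ^ 'n"
  unfolding column_eq_axis
  by (metis axis_eq_0_iff matrix_inv_left matrix_vector_mul_assoc matrix_vector_mul_lid
      matrix_vector_mult_0_right zero_neq_one)

lemma column_parallel:
  fixes Q :: "'k::real_or_complex ^ 'n ^ 'n"
  assumes Q: "invertible Q" and ij: "column i Q = c *s column j Q"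
  shows "i = j"
proof (rule ccontr)
  assume ne: "i \<noteq> j"
  have "Q *v axis i 1 = Q *v (c *s axis j 1)"
    using ij by (simp add: column_eq_axis matrix_vec_smult)
  then have "axis i 1 = c *s (axis j 1 :: 'k ^ 'n)"
    using Q by (metis matrix_inv_left matrix_vector_mul_assoc matrix_vector_mul_lid)
  then have "(axis i 1 :: 'k ^ 'n) $ i = (c *s axis j 1) $ i" by simp
  then show False using ne by (simp add: axis_def)
qed

lemma inj_lines:
  fixes Q :: "'k::real_or_complex ^ 'n ^ 'n"
  assumes Q: "invertible Q"
  shows "inj (\<lambda>j. vec.span {column j Q})"
proof (rule injI)
  fix i j assume "vec.span {column i Q} = vec.span {column j Q}"
  then have "column i Q \<in> vec.span {column j Q}" by (metis insertI1 vec.span_base)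
  then obtain c where "column i Q = c *s column j Q" by (auto simp: vec.span_singleton)
  then show "i = j" using column_parallel[OF Q] by blast
qed

lemma line_basis_lines:
  fixes Q :: "'k::real_or_complex ^ 'n ^ 'n"
  assumes Q: "invertible Q"
  shows "line_basis (lines Q)"
  unfolding line_basis_def
proof (intro conjI ballI)
  fix L assume "L \<in> lines Q"
  then obtain j where L: "L = vec.span {column j Q}" by (auto simp: lines_def)
  show "vec.subspace L" by (simp add: L)
  show "vec.dim L = 1"
    unfolding L vec.dim_span using column_nonzero[OF Q, of j]
    by (subst vec.dim_eq_card_independent) (auto simp: vec.independent_insert)
next
  show "finite (lines Q)" by (simp add: lines_def)
  show "card (lines Q) = CARD('n)" unfolding lines_def by (rule card_image[OF inj_lines[OF Q]])
  have "columns Q \<subseteq> \<Union> (lines Q)"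
    by (auto simp: columns_def lines_def intro: vec.span_base)
  then have "vec.span (columns Q) \<subseteq> vec.span (\<Union> (lines Q))" by (rule vec.span_mono)
  moreover have "vec.span (columns Q) = UNIV"
    using matrix_right_invertible_span_columns[of Q] matrix_inv_right[OF Q] by blast
  ultimately show "vec.span (\<Union> (lines Q)) = UNIV" by auto
qed

lemma line_basis_obtain:
  assumes "line_basis \<C>"
  obtains Q :: "'k::real_or_complex ^ 'n ^ 'n" where "invertible Q" "\<C> = lines Q"
proof -
  have C: "\<And>L. L \<in> \<C> \<Longrightarrow> vec.subspace L" "\<And>L. L \<in> \<C> \<Longrightarrow> vec.dim L = 1" "finite \<C>"
    "card \<C> = CARD('n)" "vec.span (\<Union>\<C>) = (UNIV :: ('k ^ 'n) set)"
    using assms by (auto simp: line_basis_def)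
  have "\<exists>h. bij_betw h (UNIV :: 'n set) \<C>"
    using C(3,4) by (intro finite_same_card_bij) auto
  then obtain h where h: "bij_betw h (UNIV :: 'n set) \<C>" by blast
  have "\<exists>v. L = vec.span {v}" if L: "L \<in> \<C>" for L
  proof -
    obtain B where B: "B \<subseteq> L" "vec.independent B" "L \<subseteq> vec.span B" "card B = vec.dim L"
      using vec.basis_exists[of L] by blast
    have "card B = 1" using B(4) C(2)[OF L] by simp
    then obtain v where v: "B = {v}" by (auto simp: card_1_singleton_iff)
    have "vec.span {v} \<subseteq> L" using B(1) C(1)[OF L] v by (metis vec.span_minimal)
    then show ?thesis using B(3) v by blast
  qed
  then obtain w where w: "\<And>L. L \<in> \<C> \<Longrightarrow> L = vec.span {w L}" by metis
  define Q :: "'k ^ 'n ^ 'n" where "Q = (\<chi> i j. w (h j) $ i)"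
  have col: "column j Q = w (h j)" for j by (simp add: Q_def column_def)
  have hC: "h j \<in> \<C>" for j using h by (auto simp: bij_betw_def)
  have hw: "h j = vec.span {w (h j)}" for j using w[OF hC] .
  have img: "\<C> = range h" using h by (simp add: bij_betw_def)
  have eq: "\<C> = lines Q" unfolding img lines_def col using hw by auto
  have "vec.span {column j Q} \<subseteq> vec.span (columns Q)" for j
    by (rule vec.span_mono) (auto simp: columns_def)
  then have "\<Union>\<C> \<subseteq> vec.span (columns Q)" unfolding eq lines_def by blast
  then have "vec.span (columns Q) = UNIV"
    using C(5) by (metis top.extremum_uniqueI vec.span_minimal vec.subspace_span)
  then obtain B where "Q ** B = mat 1" using matrix_right_invertible_span_columns[of Q] by blast
  then have "invertible Q" by (metis invertible_right_inverse)
  then show ?thesis using that eq by blast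
qed

lemma image_span_singleton: "(*v) A ` vec.span {v} = vec.span {A *v (v :: 'k::real_or_complex ^ 'n)}"
  by (auto simp: vec.span_singleton matrix_vec_smult image_iff)

lemma act_lines_lines:
  fixes A :: "'k::real_or_complex ^ 'n ^ 'n"
  assumes "det A = 1"
  shows "act_lines (cls A) (lines Q) = lines (A ** Q)"
proof -
  have "act_line (cls A) (vec.span {column j Q}) = vec.span {column j (A ** Q)}" for j
    by (simp add: act_line_cls assms image_span_singleton column_mult)
  then show ?thesis by (simp add: act_lines_def lines_def image_image)
qed

lemma diagonalizes_lines:
  fixes A :: "'k::real_or_complex ^ 'n ^ 'n"
  assumes d: "det A = 1" and Q: "invertible Q"
  shows "diagonalizes (lines Q) (cls A) \<longleftrightarrow> (\<forall>j. \<exists>c. A *v column j Q = c *s column j Q)"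
proof -
  have "vec.span {A *v column j Q} = vec.span {column j Q} \<longleftrightarrow> (\<exists>c. A *v column j Q = c *s column j Q)" for j
  proof
    assume "vec.span {A *v column j Q} = vec.span {column j Q}"
    then have "A *v column j Q \<in> vec.span {column j Q}" by (metis insertI1 vec.span_base)
    then show "\<exists>c. A *v column j Q = c *s column j Q" by (auto simp: vec.span_singleton)
  next
    assume "\<exists>c. A *v column j Q = c *s column j Q"
    then obtain c where c: "A *v column j Q = c *s column j Q" by blast
    have "c \<noteq> 0"
    proof
      assume "c = 0"
      then have "A *v column j Q = 0" by (simp add: c)
      then have "column j Q = 0"
        using d by (metis det_1_invertible matrix_inv_left matrix_vector_mul_assoc
            matrix_vector_mul_lid matrix_vector_mult_0_right)
      then show False using column_nonzero[OF Q] by blast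
    qed
    have "k *s column j Q = (k / c) *s (c *s column j Q)" for k
      using \<open>c \<noteq> 0\<close> by (simp add: vector_smult_assoc)
    then have "column j Q \<in> vec.span {A *v column j Q}"
      unfolding c by (metis insertI1 vec.span_base vec.span_scale vector_smult_lid)
    moreover have "A *v column j Q \<in> vec.span {column j Q}"
      unfolding c by (simp add: vec.span_base vec.span_scale)
    ultimately show "vec.span {A *v column j Q} = vec.span {column j Q}"
      by (simp add: vec.span_eq)
  qed
  then show ?thesis
    unfolding diagonalizes_def using line_basis_lines[OF Q]
    by (auto simp: lines_def act_line_cls d image_span_singleton)
qed

section \<open>Hermitian forms and their orthogonal bases\<close>

lemma hermitian_form_simps:
  fixes f :: "('k::real_or_complex, 'n::finite) form"
  assumes "hermitian_form f"
  shows "f (u + v) w = f u w + f v w" "f u (v + w) = f u v + f u w"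
    "f (c *s u) v = c * f u v" "f u (c *s v) = kcnj c * f u v"
    "f (u - v) w = f u w - f v w" "f u (v - w) = f u v - f u w"
    "f 0 w = 0" "f u 0 = 0"
proof -
  have a: "f (u + v) w = f u w + f v w" and s: "f (c *s u) v = c * f u v"
    and c: "f v u = kcnj (f u v)" for u v w and c :: 'k
    using assms unfolding hermitian_form_def by blast+
  show 1: "f (u + v) w = f u w + f v w" "f (c *s u) v = c * f u v" for u v w c by (fact a s)+
  show 2: "f u (v + w) = f u v + f u w" for u v w
  proof -
    have "f u (v + w) = kcnj (f (v + w) u)" by (rule c)
    then show ?thesis by (simp add: a c[symmetric])
  qed
  show 3: "f u (c *s v) = kcnj c * f u v" for c u v
  proof -
    have "f u (c *s v) = kcnj (f (c *s v) u)" by (rule c)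
    then show ?thesis by (simp add: s c[symmetric])
  qed
  have m: "u - v = u + (-1) *s v" for u v :: "'k ^ 'n" by (simp add: vec_eq_iff)
  show "f (u - v) w = f u w - f v w" unfolding m 1 by simp
  show "f u (v - w) = f u v - f u w" unfolding m 2 3 by simp
  show "f 0 w = 0" using 1(2)[of 0 0 w] by simp
  show "f u 0 = 0" using 3[of u 0 0] by simp
qed

lemma hermitian_form_commute: "hermitian_form f \<Longrightarrow> f v u = kcnj (f u v)"
  unfolding hermitian_form_def by blast

lemma hermitian_form_sum:
  fixes f :: "('k::real_or_complex, 'n::finite) form"
  assumes "hermitian_form f"
  shows "f (\<Sum>i\<in>A. g i) w = (\<Sum>i\<in>A. f (g i) w)" "f w (\<Sum>i\<in>A. g i) = (\<Sum>i\<in>A. f w (g i))"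
  by (induction A rule: infinite_finite_induct) (auto simp: hermitian_form_simps[OF assms])

lemma hermitian_form_self:
  fixes f :: "('k::real_or_complex, 'n::finite) form"
  assumes "hermitian_form f"
  shows "f v v = of_real (repart (f v v))"
  using real_iff_kcnj_eq[of "f v v"] hermitian_form_commute[OF assms, of v v]
  by (metis Reals_cases repart_of_real)

lemma form_diagonal_columns:
  fixes f :: "('k::real_or_complex, 'n::finite) form"
  assumes f: "hermitian_form f" and o: "\<And>i j. i \<noteq> j \<Longrightarrow> f (column i P) (column j P) = 0"
  shows "f (P *v u) (P *v v) = (\<Sum>i\<in>UNIV. f (column i P) (column i P) * u $ i * kcnj (v $ i))"
proof -
  have "f (P *v u) (P *v v) = (\<Sum>i\<in>UNIV. \<Sum>j\<in>UNIV. u $ i * kcnj (v $ j) * f (column i P) (column j P))"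
    unfolding matrix_mult_sum hermitian_form_sum[OF f] hermitian_form_simps[OF f]
    by (subst sum.swap) (simp add: sum_distrib_left mult_ac)
  also have "\<dots> = (\<Sum>i\<in>UNIV. \<Sum>j\<in>UNIV. if i = j then u $ i * kcnj (v $ i) * f (column i P) (column i P) else 0)"
    by (intro sum.cong refl) (auto simp: o)
  finally show ?thesis by (simp add: mult_ac)
qed

definition adapted :: "('k::real_or_complex, 'n::finite) form \<Rightarrow> 'k ^ 'n ^ 'n \<Rightarrow> ('n \<Rightarrow> real) \<Rightarrow> bool" where
  "adapted f P e \<longleftrightarrow> invertible P \<and> (\<forall>i. e i = 1 \<or> e i = - 1) \<and>
     (\<forall>u v. f (P *v u) (P *v v) = hprod (rdg e *v u) v)"

lemma adaptedI:
  fixes f :: "('k::real_or_complex, 'n::finite) form"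
  assumes "hermitian_form f" "invertible P" "\<And>i. e i = 1 \<or> e i = - 1"
    and "\<And>i j. i \<noteq> j \<Longrightarrow> f (column i P) (column j P) = 0"
    and "\<And>i. f (column i P) (column i P) = of_real (e i)"
  shows "adapted f P e"
  unfolding adapted_def using assms(2,3)
  by (simp add: form_diagonal_columns[OF assms(1,4)] assms(5) hprod_def)

lemma has_signature_adapted:
  fixes f :: "('k::real_or_complex, 'n::finite) form"
  assumes f: "hermitian_form f" and "has_signature f p q"
  obtains P e where "adapted f P e" "card {i. e i = 1} = p"
proof -
  obtain B where B: "vec.independent B" "vec.span B = UNIV"
    and o: "\<And>u v. u \<in> B \<Longrightarrow> v \<in> B \<Longrightarrow> u \<noteq> v \<Longrightarrow> f u v = 0"
    and s: "\<And>u. u \<in> B \<Longrightarrow> f u u = 1 \<or> f u u = - 1" and p: "card {u\<in>B. f u u = 1} = p"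
    using assms unfolding has_signature_def by blast
  have "finite B" using B(1) by (rule vec.finiteI_independent)
  moreover have "card B = CARD('n)"
    using vec.dim_eq_card_independent[OF B(1)] vec.dim_span[of B] B(2) by (simp add: card_cart_basis)
  ultimately obtain h where h: "bij_betw h (UNIV::'n set) B"
    by (metis finite_class.finite_UNIV finite_same_card_bij)
  define P :: "'k ^ 'n ^ 'n" where "P = (\<chi> i j. h j $ i)"
  define e where "e i = repart (f (h i) (h i))" for i
  have col: "column j P = h j" for j by (simp add: P_def column_def)
  have hB: "h j \<in> B" for j using h by (auto simp: bij_betw_def)
  have inj: "inj h" using h by (simp add: bij_betw_def)
  have "columns P = B" using h by (auto simp: columns_def col bij_betw_def)
  then have "invertible P"
    using matrix_right_invertible_span_columns[of P] B(2) by (metis invertible_right_inverse)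
  moreover have fe: "f (h i) (h i) = of_real (e i)" for i
    unfolding e_def by (rule hermitian_form_self[OF f])
  moreover have "e i = 1 \<or> e i = - 1" for i
    using s[OF hB[of i]] unfolding fe by (metis of_real_1 of_real_eq_iff of_real_minus)
  ultimately have "adapted f P e"
    by (intro adaptedI f) (auto simp: col o hB inj_eq[OF inj])
  moreover have "card {i. e i = 1} = card {u\<in>B. f u u = 1}"
  proof (rule bij_betw_same_card)
    show "bij_betw h {i. e i = 1} {u\<in>B. f u u = 1}"
      using h fe by (auto simp: bij_betw_def inj_on_def image_iff)
  qed
  ultimately show ?thesis using that p by simp
qed

lemma adapted_nondegenerate:
  fixes f :: "('k::real_or_complex, 'n::finite) form"
  assumes f: "adapted f P e" and z: "\<And>u. f u v = 0"
  shows "v = 0"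
proof -
  have P: "invertible P" and "\<And>i. e i = 1 \<or> e i = - 1"
    using f unfolding adapted_def by blast+
  then have e: "e i \<noteq> 0" for i by (metis zero_neq_one zero_neq_neg_one)
  define w where "w = matrix_inv P *v v"
  have v: "v = P *v w" unfolding w_def matrix_vector_mul_assoc matrix_inv_right[OF P] by simp
  have "hprod (rdg e *v axis i 1) w = 0" for i
    using z[of "P *v axis i 1"] f unfolding v adapted_def by simp
  moreover have "hprod (rdg e *v axis i 1) w = of_real (e i) * kcnj (w $ i)" for i
    by (simp add: hprod_def axis_def if_distrib if_distribR cong: if_cong)
  ultimately have "w = 0" using e by (simp add: vec_eq_iff)
  then show ?thesis by (simp add: v)
qed

text \<open>
  If \<open>B\<close> is an orthogonal family of anisotropic vectors, this is the projection to the orthogonal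
  complement of \<open>B\<close> along its span.
\<close>

definition orth_part :: "('k::real_or_complex, 'n::finite) form \<Rightarrow> ('k ^ 'n) set \<Rightarrow> 'k ^ 'n \<Rightarrow> 'k ^ 'n" where
  "orth_part f B w = w - (\<Sum>u\<in>B. (f w u / f u u) *s u)"

lemma orth_part_orthogonal:
  fixes f :: "('k::real_or_complex, 'n::finite) form"
  assumes f: "hermitian_form f" and B: "finite B" "\<And>u. u \<in> B \<Longrightarrow> f u u \<noteq> 0"
    "\<And>u v. u \<in> B \<Longrightarrow> v \<in> B \<Longrightarrow> u \<noteq> v \<Longrightarrow> f u v = 0" and x: "x \<in> B"
  shows "f (orth_part f B w) x = 0"
proof -
  have "(\<Sum>u\<in>B. f w u / f u u * f u x) = (\<Sum>u\<in>B. if u = x then f w x else 0)"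
    by (intro sum.cong refl) (use B x in auto)
  then show ?thesis
    unfolding orth_part_def using B(1) x
    by (simp add: hermitian_form_simps[OF f] hermitian_form_sum[OF f])
qed

lemma orth_part_diff_span: "w - orth_part f B w \<in> vec.span B"
proof -
  have "(\<Sum>u\<in>B. (f w u / f u u) *s u) \<in> vec.span B"
    by (intro vec.span_sum vec.span_scale vec.span_base)
  then show ?thesis by (simp add: orth_part_def)
qed

text \<open>
  The bases needed below differ by the kind of their vectors (arbitrary vectors, eigenvectors, common
  eigenvectors) and by the reason why an incomplete orthogonal family can be enlarged; the rest of the
  construction is shared. The vectors are anisotropic, so orthogonality makes them independent.
\<close>

lemma orthogonal_basis_greedy:
  fixes f :: "('k::real_or_complex, 'n::finite) form"
  assumes f: "hermitian_form f"
    and step: "\<And>B. finite B \<Longrightarrow> vec.span B \<noteq> UNIV \<Longrightarrow> (\<And>u. u \<in> B \<Longrightarrow> Pr u) \<Longrightarrow>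
      (\<And>u. u \<in> B \<Longrightarrow> f u u \<noteq> 0) \<Longrightarrow> (\<And>u v. u \<in> B \<Longrightarrow> v \<in> B \<Longrightarrow> u \<noteq> v \<Longrightarrow> f u v = 0) \<Longrightarrow>
      \<exists>v. Pr v \<and> f v v \<noteq> 0 \<and> (\<forall>u\<in>B. f v u = 0)"
  obtains Q :: "'k ^ 'n ^ 'n" where "invertible Q" "\<And>j. Pr (column j Q)"
    "\<And>j. f (column j Q) (column j Q) \<noteq> 0" "\<And>i j. i \<noteq> j \<Longrightarrow> f (column i Q) (column j Q) = 0"
proof -
  have "\<exists>B. finite B \<and> card B = n \<and> (\<forall>u\<in>B. Pr u \<and> f u u \<noteq> 0) \<and> (\<forall>u\<in>B. \<forall>v\<in>B. u \<noteq> v \<longrightarrow> f u v = 0)"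
    if "n \<le> CARD('n)" for n
    using that
  proof (induction n)
    case 0
    then show ?case by (intro exI[of _ "{}"]) auto
  next
    case (Suc n)
    then obtain B where B: "finite B" "card B = n" "\<forall>u\<in>B. Pr u \<and> f u u \<noteq> 0"
      "\<forall>u\<in>B. \<forall>v\<in>B. u \<noteq> v \<longrightarrow> f u v = 0" by auto
    have "vec.span B \<noteq> UNIV"
    proof
      assume "vec.span B = UNIV"
      then have "vec.dim (UNIV :: ('k ^ 'n) set) \<le> card B" using B(1) by (intro vec.dim_le_card) auto
      then show False using B(2) Suc.prems by (simp add: card_cart_basis)
    qed
    then obtain v where v: "Pr v" "f v v \<noteq> 0" "\<forall>u\<in>B. f v u = 0" using step[of B] B by blast
    have "v \<notin> B" using v by blast
    moreover have "f u v = 0" if "u \<in> B" for u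
      using hermitian_form_commute[OF f, of u v] v(3) that by simp
    ultimately show ?case
      using B v by (intro exI[of _ "insert v B"]) auto
  qed
  then obtain B where B: "finite B" "card B = CARD('n)" "\<forall>u\<in>B. Pr u \<and> f u u \<noteq> 0"
      "\<forall>u\<in>B. \<forall>v\<in>B. u \<noteq> v \<longrightarrow> f u v = 0" by blast
  then obtain h where h: "bij_betw h (UNIV::'n set) B"
    by (metis finite_class.finite_UNIV finite_same_card_bij)
  define Q :: "'k ^ 'n ^ 'n" where "Q = (\<chi> i j. h j $ i)"
  have col: "column j Q = h j" for j by (simp add: Q_def column_def)
  have hB: "h j \<in> B" for j using h by (auto simp: bij_betw_def)
  have inj: "inj h" using h by (simp add: bij_betw_def)
  have o: "f (column i Q) (column j Q) = 0" if "i \<noteq> j" for i j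
    using that B(4) hB inj by (auto simp: col inj_eq)
  have "x = 0" if x: "Q *v x = 0" for x
  proof -
    have "x $ j * f (column j Q) (column j Q) = 0" for j
    proof -
      have "0 = f (Q *v x) (Q *v axis j 1)" by (simp add: x hermitian_form_simps[OF f])
      also have "\<dots> = (\<Sum>i\<in>UNIV. f (column i Q) (column i Q) * x $ i * kcnj (axis j 1 $ i))"
        by (rule form_diagonal_columns[OF f o])
      also have "\<dots> = x $ j * f (column j Q) (column j Q)"
        by (simp add: axis_def if_distrib mult.commute cong: if_cong)
      finally show ?thesis by simp
    qed
    then show ?thesis using B(3) hB by (auto simp: vec_eq_iff col)
  qed
  then have "invertible Q"
    using matrix_left_invertible_ker[of Q] by (metis invertible_left_inverse)
  then show ?thesis using that o B(3) hB by (auto simp: col)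
qed

lemma positive_definite_orthonormal_basis:
  fixes h :: "('k::real_or_complex, 'n::finite) form"
  assumes h: "hermitian_form h" and pos: "\<And>v. v \<noteq> 0 \<Longrightarrow> repart (h v v) > 0"
  obtains P :: "'k ^ 'n ^ 'n" where "invertible P" "\<And>u v. h (P *v u) (P *v v) = hprod u v"
proof -
  obtain Q :: "'k ^ 'n ^ 'n" where Q: "invertible Q" "\<And>i j. i \<noteq> j \<Longrightarrow> h (column i Q) (column j Q) = 0"
  proof (rule orthogonal_basis_greedy[OF h, of "\<lambda>_. True"])
    fix B assume B: "finite B" "vec.span B \<noteq> UNIV" "\<And>u. u \<in> B \<Longrightarrow> h u u \<noteq> 0"
      "\<And>u v. u \<in> B \<Longrightarrow> v \<in> B \<Longrightarrow> u \<noteq> v \<Longrightarrow> h u v = 0"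
    obtain w where "w \<notin> vec.span B" using B(2) by blast
    then have "orth_part h B w \<noteq> 0" using orth_part_diff_span[of w h B] by auto
    then have "h (orth_part h B w) (orth_part h B w) \<noteq> 0" using pos by fastforce
    then show "\<exists>v. True \<and> h v v \<noteq> 0 \<and> (\<forall>u\<in>B. h v u = 0)"
      using orth_part_orthogonal[OF h B(1,3,4)] by blast
  qed blast
  define r where "r i = repart (h (column i Q) (column i Q))" for i
  have hr: "h (column i Q) (column i Q) = of_real (r i)" for i
    unfolding r_def by (rule hermitian_form_self[OF h])
  have r: "r i > 0" for i unfolding r_def by (rule pos[OF column_nonzero[OF Q(1)]])
  define D :: "'k ^ 'n ^ 'n" where "D = rdg (\<lambda>i. 1 / sqrt (r i))"
  have "det D \<noteq> 0" unfolding D_def det_dg using r by (auto simp: less_le)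
  then have "invertible (Q ** D)"
    using Q(1) by (simp add: invertible_det_nz det_mul)
  moreover have "h (Q ** D *v u) (Q ** D *v v) = hprod u v" for u v
  proof -
    have 1: "of_real (r i) * (of_real (1 / sqrt (r i)) * a) * (of_real (1 / sqrt (r i)) * b) = a * b" for i and a b :: 'k
    proof -
      have "r i * (1 / sqrt (r i)) * (1 / sqrt (r i)) = 1" using r[of i] by (simp add: field_simps)
      then have "(of_real (r i) * of_real (1 / sqrt (r i)) * of_real (1 / sqrt (r i)) :: 'k) = 1"
        by (metis of_real_1 of_real_mult)
      then show ?thesis by (metis (no_types, lifting) mult.assoc mult.commute mult_1)
    qed
    have "h (Q ** D *v u) (Q ** D *v v) = h (Q *v (D *v u)) (Q *v (D *v v))"
      by (simp add: matrix_vector_mul_assoc)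
    also have "\<dots> = (\<Sum>i\<in>UNIV. of_real (r i) * (of_real (1 / sqrt (r i)) * u $ i) * (of_real (1 / sqrt (r i)) * kcnj (v $ i)))"
      by (subst form_diagonal_columns[OF h], erule Q(2)) (simp add: hr D_def)
    also have "\<dots> = hprod u v" unfolding 1 hprod_def ..
    finally show ?thesis .
  qed
  ultimately show ?thesis using that by blast
qed

subsection \<open>The law of inertia\<close>

text \<open>
  A vector in the span of the positive vectors of the first basis and in the span of the negative
  vectors of the second one has \<open>o(v, v) \<ge> 0 \<ge> o(v, v)\<close>, hence vanishes. So the dimensions of these
  two subspaces add up to at most \<open>dim V\<close>.
\<close>

lemma inertia_le:
  fixes f :: "('k::real_or_complex, 'n::finite) form"
  assumes P: "adapted f P e" and P': "adapted f P' e'"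
  shows "card {i. e i = 1} \<le> card {i. e' i = 1}"
proof -
  define S N where "S = {i. e i = 1}" and "N = {i. e' i \<noteq> 1}"
  define U W where "U = (*v) P ` {x. \<forall>i. i \<notin> S \<longrightarrow> x $ i = 0}"
    and "W = (*v) P' ` {x. \<forall>i. i \<notin> N \<longrightarrow> x $ i = 0}"
  have dim: "vec.dim ((*v) R ` {x. \<forall>i. i \<notin> M \<longrightarrow> x $ i = 0}) = card M"
      "vec.subspace ((*v) R ` {x. \<forall>i. i \<notin> M \<longrightarrow> x $ i = 0})"
    if "invertible R" for R :: "'k ^ 'n ^ 'n" and M
  proof -
    have "inj ((*v) R)"
      using that matrix_left_invertible_injective by (metis invertible_left_inverse)
    then have "vec.dim ((*v) R ` {x. \<forall>i. i \<notin> M \<longrightarrow> x $ i = 0}) = vec.dim {x::'k^'n. \<forall>i. i \<notin> M \<longrightarrow> x $ i = 0}"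
      by (intro vec.dim_image_eq) (auto intro: inj_on_subset)
    then show "vec.dim ((*v) R ` {x. \<forall>i. i \<notin> M \<longrightarrow> x $ i = 0}) = card M"
      by (simp add: dim_substandard_cart)
    have "vec.subspace {x::'k^'n. \<forall>i. i \<notin> M \<longrightarrow> x $ i = 0}" by (auto simp: vec.subspace_def)
    then show "vec.subspace ((*v) R ` {x. \<forall>i. i \<notin> M \<longrightarrow> x $ i = 0})"
      by (rule vec.linear_subspace_image[OF matrix_vector_mul_linear_gen])
  qed
  have q: "f (R *v x) (R *v x) = of_real (\<Sum>i\<in>UNIV. ee i * (norm (x $ i))\<^sup>2)" if "adapted f R ee" for R ee x
    using that by (simp add: adapted_def hprod_def mult.assoc mult_kcnj del: of_real_power)
  have "U \<inter> W \<subseteq> {0}"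
  proof
    fix v assume "v \<in> U \<inter> W"
    then have "v \<in> U" "v \<in> W" by auto
    obtain x where x: "v = P *v x" "\<And>i. i \<notin> S \<Longrightarrow> x $ i = 0"
      using \<open>v \<in> U\<close> unfolding U_def by blast
    obtain y where y: "v = P' *v y" "\<And>i. i \<notin> N \<Longrightarrow> y $ i = 0"
      using \<open>v \<in> W\<close> unfolding W_def by blast
    have "(\<Sum>i\<in>UNIV. e i * (norm (x $ i))\<^sup>2) = (\<Sum>i\<in>UNIV. (norm (x $ i))\<^sup>2)"
      using x(2) by (intro sum.cong refl) (auto simp: S_def)
    moreover have "(\<Sum>i\<in>UNIV. e' i * (norm (y $ i))\<^sup>2) \<le> 0"
    proof (rule sum_nonpos)
      fix i show "e' i * (norm (y $ i))\<^sup>2 \<le> 0"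
      proof (cases "i \<in> N")
        case True
        then have "e' i = - 1" using P' by (auto simp: adapted_def N_def)
        then show ?thesis by simp
      qed (simp add: y(2))
    qed
    moreover have "(\<Sum>i\<in>UNIV. e i * (norm (x $ i))\<^sup>2) = (\<Sum>i\<in>UNIV. e' i * (norm (y $ i))\<^sup>2)"
      using q[OF P, of x] q[OF P', of y] x(1) y(1) by (metis of_real_eq_iff)
    ultimately have "(\<Sum>i\<in>UNIV. (norm (x $ i))\<^sup>2) \<le> 0" by simp
    then have "(\<Sum>i\<in>UNIV. (norm (x $ i))\<^sup>2) = 0" by (meson antisym sum_nonneg zero_le_power2)
    then have "x = 0" by (simp add: sum_nonneg_eq_0_iff vec_eq_iff)
    then show "v \<in> {0}" by (simp add: x(1))
  qed
  then have "vec.dim (U \<inter> W) = 0" by (metis vec.dim_eq_0)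
  moreover have inv: "invertible P" "invertible P'" using P P' by (auto simp: adapted_def)
  moreover have "vec.dim {x + y | x y. x \<in> U \<and> y \<in> W} \<le> CARD('n)"
    by (rule dim_subset_UNIV_cart_gen)
  moreover have "vec.dim {x + y | x y. x \<in> U \<and> y \<in> W} + vec.dim (U \<inter> W) = vec.dim U + vec.dim W"
    unfolding U_def W_def by (intro vec.dim_sums_Int dim(2) inv)
  moreover have "vec.dim U = card S" "vec.dim W = card N" unfolding U_def W_def by (intro dim(1) inv)+
  ultimately have "card S + card N \<le> CARD('n)" by linarith
  moreover have "card N + card {i. e' i = 1} = CARD('n)"
  proof -
    have "N \<union> {i. e' i = 1} = UNIV" "N \<inter> {i. e' i = 1} = {}" by (auto simp: N_def)
    then show ?thesis by (metis card_Un_disjoint finite_code)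
  qed
  ultimately show ?thesis by (simp add: S_def)
qed

lemma adapted_permutation:
  fixes f :: "('k::real_or_complex, 'n::finite) form"
  assumes P: "adapted f P e" and P': "adapted f P' e'"
  obtains \<pi> where "bij \<pi>" "\<And>i. e' (\<pi> i) = e i"
proof -
  have "card {i. e i = 1} = card {i. e' i = 1}"
    using inertia_le[OF P P'] inertia_le[OF P' P] by simp
  then obtain \<alpha> where \<alpha>: "bij_betw \<alpha> {i. e i = 1} {i. e' i = 1}"
    by (metis finite_code finite_same_card_bij)
  have "card (- {i. e i = 1}) = card (- {i. e' i = 1})"
    using \<open>card {i. e i = 1} = card {i. e' i = 1}\<close> by (simp add: Compl_eq_Diff_UNIV card_Diff_subset)
  then obtain \<beta> where \<beta>: "bij_betw \<beta> (- {i. e i = 1}) (- {i. e' i = 1})"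
    by (metis finite_code finite_same_card_bij)
  define \<pi> where "\<pi> i = (if i \<in> {i. e i = 1} then \<alpha> i else \<beta> i)" for i
  have "bij_betw \<pi> ({i. e i = 1} \<union> - {i. e i = 1}) ({i. e' i = 1} \<union> - {i. e' i = 1})"
    unfolding \<pi>_def by (rule bij_betw_disjoint_Un[OF \<alpha> \<beta>]) auto
  then have "bij \<pi>" by simp
  moreover have "e' (\<pi> i) = e i" for i
  proof (cases "e i = 1")
    case True
    then show ?thesis using \<alpha> by (auto simp: \<pi>_def bij_betw_def)
  next
    case False
    then have "\<pi> i \<in> - {i. e' i = 1}" using \<beta> by (auto simp: \<pi>_def bij_betw_def)
    moreover have "e i = - 1" "e' (\<pi> i) = 1 \<or> e' (\<pi> i) = - 1"
      using False P P' by (auto simp: adapted_def)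
    ultimately show ?thesis by simp
  qed
  ultimately show ?thesis using that by blast
qed

subsection \<open>The adjoint\<close>

text \<open>
  The adjoint of \<open>T\<close> for a form whose matrix in the basis \<open>P\<close> is the diagonal matrix of the signs \<open>e\<close>.
\<close>

definition fadj :: "'k::real_or_complex ^ 'n ^ 'n \<Rightarrow> ('n \<Rightarrow> real) \<Rightarrow> 'k ^ 'n ^ 'n \<Rightarrow> 'k ^ 'n ^ 'n" where
  "fadj P e T = P ** (rdg e ** ct (matrix_inv P ** T ** P) ** rdg e) ** matrix_inv P"

lemma sign_mult_sign: "(\<forall>i. e i = 1 \<or> e i = - 1) \<Longrightarrow> rdg e ** rdg e = (mat 1 :: 'k::real_or_complex ^ 'n ^ 'n)"
proof -
  assume "\<forall>i. e i = 1 \<or> e i = - 1"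
  then have "of_real (e i) * of_real (e i) = (1::'k)" for i
    by (metis mult_1 mult_minus_left of_real_1 of_real_mult verit_minus_simplify(4))
  then show ?thesis by (simp add: dg_mult dg_eq_mat)
qed

lemma fadj_adjoint:
  fixes f :: "('k::real_or_complex, 'n::finite) form"
  assumes f: "adapted f P e"
  shows "f (T *v u) v = f u (fadj P e T *v v)"
proof -
  have P: "invertible P" and e: "\<forall>i. e i = 1 \<or> e i = - 1"
    and F: "\<And>u v. f (P *v u) (P *v v) = hprod (rdg e *v u) v" using f by (auto simp: adapted_def)
  define x y where "x = matrix_inv P *v u" and "y = matrix_inv P *v v"
  define T' where "T' = matrix_inv P ** T ** P"
  have u: "u = P *v x" and v: "v = P *v y"
    unfolding x_def y_def matrix_vector_mul_assoc matrix_inv_right[OF P] by simp_all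
  have "P ** T' = T ** P"
    unfolding T'_def by (metis P matrix_inv_right matrix_mul_assoc matrix_mul_lid)
  then have T: "T *v u = P *v (T' *v x)" by (simp add: u matrix_vector_mul_assoc)
  have "fadj P e T *v v = P *v ((rdg e ** ct T' ** rdg e) *v y)"
    by (simp add: fadj_def T'_def y_def matrix_vector_mul_assoc matrix_mul_assoc)
  then have "f u (fadj P e T *v v) = hprod (rdg e *v x) ((rdg e ** ct T' ** rdg e) *v y)"
    by (simp add: u F)
  also have "\<dots> = hprod x ((rdg e ** rdg e) *v (ct T' *v (rdg e *v y)))"
    by (simp add: hprod_ct matrix_vector_mul_assoc matrix_mul_assoc)
  also have "\<dots> = hprod (rdg e *v (T' *v x)) y"
    unfolding sign_mult_sign[OF e] by (simp add: hprod_ct)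
  also have "\<dots> = f (T *v u) v" by (simp add: T v F)
  finally show ?thesis by simp
qed

lemma adapted_eqI:
  fixes f :: "('k::real_or_complex, 'n::finite) form"
  assumes f: "hermitian_form f" "adapted f P e" and eq: "\<And>u v. f u (A *v v) = f u (B *v v)"
  shows "A = B"
proof -
  have "A *v v - B *v v = 0" for v
    by (rule adapted_nondegenerate[OF f(2)]) (simp add: hermitian_form_simps[OF f(1)] eq)
  then show ?thesis by (simp add: matrix_eq)
qed

definition pos_multiples :: "('k::real_or_complex, 'n::finite) form \<Rightarrow> ('k, 'n) form set" where
  "pos_multiples f = {\<lambda>u v. of_real c * f u v | c. c > 0}"

lemma form_classes_obtain:
  assumes "\<omega> \<in> form_classes p q"
  obtains f :: "('k::real_or_complex, 'n::finite) form" where "hermitian_form f" "has_signature f p q"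
    "\<omega> = pos_multiples f"
proof -
  obtain f where f: "hermitian_form f" "has_signature f p q"
    "\<omega> = {(f, f'). \<exists>c>0. f' = (\<lambda>u v. of_real c * f u v)} `` {f}"
    using assms unfolding form_classes_def by (auto elim!: quotientE)
  have "\<omega> = pos_multiples f" unfolding f(3) pos_multiples_def by blast
  then show ?thesis using that f by blast
qed

lemma ball_pos_multiples:
  assumes "\<And>c. c > 0 \<Longrightarrow> Q (\<lambda>u v. of_real c * f u v) \<longleftrightarrow> Q f"
  shows "(\<forall>f'\<in>pos_multiples f. Q f') \<longleftrightarrow> Q f"
proof -
  have "(\<lambda>u v. of_real 1 * f u v) \<in> pos_multiples f"
    unfolding pos_multiples_def by (intro CollectI exI[of _ 1]) auto
  then show ?thesis using assms by (auto simp: pos_multiples_def)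
qed

lemma adjoint_for_eq:
  fixes f :: "('k::real_or_complex, 'n::finite) form"
  assumes f: "hermitian_form f" "adapted f P e"
  shows "adjoint_for (pos_multiples f) T = fadj P e T"
proof -
  have "(\<forall>f'\<in>pos_multiples f. \<forall>u v. f' (T *v u) v = f' u (S *v v)) \<longleftrightarrow> (\<forall>u v. f (T *v u) v = f u (S *v v))" for S
    by (rule ball_pos_multiples) simp
  note * = this
  show ?thesis
    unfolding adjoint_for_def *
  proof (rule the_equality)
    show "\<forall>u v. f (T *v u) v = f u (fadj P e T *v v)" using fadj_adjoint[OF f(2)] by blast
    fix S assume "\<forall>u v. f (T *v u) v = f u (S *v v)"
    then show "S = fadj P e T" using fadj_adjoint[OF f(2)] by (intro adapted_eqI[OF f]) metis
  qed
qed

lemma orthogonal_for_eq: "orthogonal_for (pos_multiples f) u v \<longleftrightarrow> f u v = 0"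
  unfolding orthogonal_for_def by (rule ball_pos_multiples) simp

lemma isometry_of_eq: "isometry_of (pos_multiples f) A \<longleftrightarrow> (\<forall>u v. f (A *v u) (A *v v) = f u v)"
  unfolding isometry_of_def by (rule ball_pos_multiples) simp

lemma fadj_mat_1:
  assumes "invertible P" "\<forall>i. e i = 1 \<or> e i = - 1"
  shows "fadj P e (mat 1) = (mat 1 :: 'k::real_or_complex ^ 'n ^ 'n)"
  unfolding fadj_def using assms by (simp add: matrix_inv_left matrix_inv_right sign_mult_sign)

lemma det_fadj:
  assumes P: "invertible P" and e: "\<forall>i. e i = 1 \<or> e i = - 1"
  shows "det (fadj P e T) = kcnj (det (T :: 'k::real_or_complex ^ 'n ^ 'n))"
proof -
  have 1: "det P * det (matrix_inv P) = 1" "det (matrix_inv P) * det P = 1"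
    "det (rdg e :: 'k ^ 'n ^ 'n) * det (rdg e :: 'k ^ 'n ^ 'n) = 1"
    using P e by (auto intro!: inverse_pair_det simp: matrix_inv_left matrix_inv_right sign_mult_sign)
  have "det (fadj P e T) = kcnj (det (matrix_inv P) * det P * det T) *
      (det P * det (matrix_inv P)) * (det (rdg e :: 'k ^ 'n ^ 'n) * det (rdg e :: 'k ^ 'n ^ 'n))"
    by (simp only: fadj_def det_mul det_ct kcnj_mult mult_ac)
  then show ?thesis unfolding 1 by simp
qed

lemma fadj_mult:
  fixes f :: "('k::real_or_complex, 'n::finite) form"
  assumes f: "hermitian_form f" "adapted f P e"
  shows "fadj P e (A ** B) = fadj P e B ** fadj P e A"
proof (rule adapted_eqI[OF f])
  fix u v
  have "f u (fadj P e (A ** B) *v v) = f ((A ** B) *v u) v"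
    by (rule fadj_adjoint[OF f(2), symmetric])
  also have "\<dots> = f (A *v (B *v u)) v" by (simp add: matrix_vector_mul_assoc)
  also have "\<dots> = f u (fadj P e B *v (fadj P e A *v v))" unfolding fadj_adjoint[OF f(2)] ..
  finally show "f u (fadj P e (A ** B) *v v) = f u ((fadj P e B ** fadj P e A) *v v)"
    by (simp add: matrix_vector_mul_assoc)
qed

lemma matrix_add_rdistrib: "(A + B) ** C = A ** C + B ** (C :: 'k::real_or_complex ^ _ ^ _)"
  by (simp add: vec_eq_iff matrix_matrix_mult_def sum.distrib algebra_simps)

lemma bounded_bilinear_matrix_mult:
  "bounded_bilinear ((**) :: 'k::real_or_complex ^ 'n ^ 'n \<Rightarrow> 'k ^ 'n ^ 'n \<Rightarrow> 'k ^ 'n ^ 'n)"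
  by (simp add: bilinear_def linear_iff matrix_add_ldistrib scaleR_left_mult scaleR_right_mult
      matrix_add_rdistrib flip: bilinear_conv_bounded_bilinear)

lemma bounded_bilinear_matrix_vector_mult:
  "bounded_bilinear ((*v) :: 'k::real_or_complex ^ 'n ^ 'n \<Rightarrow> 'k ^ 'n \<Rightarrow> 'k ^ 'n)"
  by (simp add: bilinear_def linear_iff matrix_vector_right_distrib matrix_vector_mult_add_rdistrib
      matrix_vector_mult_def vec_eq_iff scaleR_sum_right sum.distrib distrib_left distrib_right flip: bilinear_conv_bounded_bilinear)

lemma linear_ct: "linear (ct :: 'k::real_or_complex ^ 'n ^ 'n \<Rightarrow> _)"
  by (simp add: linear_iff)

lemma linear_matrix_mult: "linear (\<lambda>X. A ** X ** (B :: 'k::real_or_complex ^ 'n ^ 'n))"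
  by (simp add: linear_iff matrix_add_ldistrib scaleR_left_mult scaleR_right_mult matrix_add_rdistrib)

lemma linear_fadj: "linear (fadj P e :: 'k::real_or_complex ^ 'n ^ 'n \<Rightarrow> _)"
proof -
  have "fadj P e = (\<lambda>X. P ** X ** matrix_inv P) \<circ> (\<lambda>X. rdg e ** X ** rdg e) \<circ> ct \<circ> (\<lambda>X. matrix_inv P ** X ** P)"
    by (auto simp: fadj_def)
  then show ?thesis by (metis linear_compose linear_ct linear_matrix_mult)
qed

text \<open>The Neumann series to first order: \<open>(1 + H)\<^sup>-\<^sup>1 = 1 - H + H\<^sup>2 (1 + H)\<^sup>-\<^sup>1\<close>.\<close>

lemma has_derivative_matrix_inv_at_1:
  "(matrix_inv has_derivative (\<lambda>H. - H)) (at (mat 1 :: 'k::real_or_complex ^ 'n ^ 'n))"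
proof -
  obtain K where K: "K > 0" "\<And>(A :: 'k ^ 'n ^ 'n) (B :: 'k ^ 'n ^ 'n). norm (A ** B) \<le> norm A * norm B * K"
    using bounded_bilinear.pos_bounded[OF bounded_bilinear_matrix_mult[where 'k = 'k and 'n = 'n]] by blast
  obtain L where L: "L > 0" "\<And>(A :: 'k ^ 'n ^ 'n) x. norm (A *v x) \<le> norm A * norm x * L"
    using bounded_bilinear.pos_bounded[OF bounded_bilinear_matrix_vector_mult[where 'k = 'k and 'n = 'n]] by blast
  \<comment> \<open>\<open>K\<close> and \<open>L\<close> bound the products, so that for \<open>\<parallel>H\<parallel> < \<epsilon>\<close> the matrix \<open>1 + H\<close> is injective with
    an inverse of norm at most \<open>2 \<parallel>1\<parallel>\<close>\<close>
  define \<epsilon> where "\<epsilon> = 1 / (2 * (K + L))"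
  define C where "C = 2 * norm (mat 1 :: 'k ^ 'n ^ 'n) * K * K"
  show ?thesis
  proof (rule has_derivativeI_sandwich[where e = \<epsilon>])
    show "\<epsilon> > 0" using K L by (simp add: \<epsilon>_def)
    show "bounded_linear (\<lambda>H :: 'k ^ 'n ^ 'n. - H)" by (intro bounded_linear_minus bounded_linear_ident)
    show "((\<lambda>Y. C * norm (Y - mat 1)) \<longlongrightarrow> 0) (at (mat 1 :: 'k ^ 'n ^ 'n))"
      by (rule tendsto_mult_right_zero[OF tendsto_norm_zero[OF LIM_zero[OF tendsto_ident_at]]])
    fix Y :: "'k ^ 'n ^ 'n"
    assume "Y \<noteq> mat 1" "dist Y (mat 1) < \<epsilon>"
    define H where "H = Y - mat 1"
    have Y: "Y = mat 1 + H" by (simp add: H_def)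
    have nH: "norm H * (2 * (K + L)) < 1"
      using \<open>dist Y (mat 1) < \<epsilon>\<close> K L by (simp add: dist_norm H_def \<epsilon>_def field_simps)
    have nHK: "norm H * K \<le> 1 / 2" "norm H * L \<le> 1 / 2"
    proof -
      have "2 * (norm H * K) + 2 * (norm H * L) < 1" using nH by (simp add: algebra_simps)
      moreover have "0 \<le> norm H * K" "0 \<le> norm H * L" using K(1) L(1) by simp_all
      ultimately show "norm H * K \<le> 1 / 2" "norm H * L \<le> 1 / 2" by linarith+
    qed
    have "x = 0" if "Y *v x = 0" for x
    proof -
      have "x = - (H *v x)"
        using that by (simp add: Y matrix_vector_mult_add_rdistrib eq_neg_iff_add_eq_0)
      then have "norm x = norm (H *v x)" by (metis norm_minus_cancel)
      also have "\<dots> \<le> (norm H * L) * norm x" using L(2)[of H x] by (simp add: mult_ac)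
      also have "\<dots> \<le> 1 / 2 * norm x" by (rule mult_right_mono[OF nHK(2)]) simp
      finally show ?thesis by simp
    qed
    then have inv: "invertible Y"
      using matrix_left_invertible_ker[of Y] by (metis invertible_left_inverse)
    define M where "M = matrix_inv Y"
    have "(mat 1 + H) ** M = mat 1" unfolding M_def using matrix_inv_right[OF inv] by (simp add: Y)
    then have M: "M = mat 1 - H ** M" by (simp add: matrix_add_rdistrib eq_diff_eq)
    have "norm M \<le> norm (mat 1 :: 'k ^ 'n ^ 'n) + norm (H ** M)"
      by (subst M) (rule norm_triangle_ineq4)
    also have "norm (H ** M) \<le> (norm H * K) * norm M" using K(2)[of H M] by (simp add: mult_ac)
    also have "\<dots> \<le> 1 / 2 * norm M" by (rule mult_right_mono[OF nHK(1)]) simp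
    finally have nM: "norm M \<le> 2 * norm (mat 1 :: 'k ^ 'n ^ 'n)" by simp
    have "M - mat 1 + H = H ** (H ** M)"
    proof -
      have "M - mat 1 + H = H - H ** M" by (subst M) simp
      also have "\<dots> = H ** (mat 1 - M)" by (simp add: matrix_sub_ldistrib)
      also have "mat 1 - M = H ** M" using M by (simp add: algebra_simps)
      finally show ?thesis .
    qed
    then have "norm (M - mat 1 + H) \<le> norm H * (norm H * norm M * K) * K"
      using K(2)[of H "H ** M"] K(2)[of H M] K(1)
      by (smt (verit) mult_left_mono mult_right_mono norm_ge_zero)
    also have "\<dots> \<le> norm H * (norm H * (2 * norm (mat 1 :: 'k ^ 'n ^ 'n)) * K) * K"
      using nM K(1) by (intro mult_right_mono mult_left_mono) auto
    also have "\<dots> = C * norm H * norm H" by (simp add: C_def)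
    finally have "norm (M - mat 1 + H) / norm H \<le> C * norm H"
      using \<open>Y \<noteq> mat 1\<close> by (simp add: H_def divide_le_eq)
    moreover have "matrix_inv (mat 1) = (mat 1 :: 'k ^ 'n ^ 'n)" by (rule matrix_inv_eqI) simp
    ultimately show "norm (matrix_inv Y - matrix_inv (mat 1) - - (Y - mat 1)) / norm (Y - mat 1) \<le> C * norm (Y - mat 1)"
      by (simp add: M_def H_def)
  qed
qed

lemma d\<sigma>_eq:
  fixes f :: "('k::real_or_complex, 'n::finite) form"
  assumes f: "hermitian_form f" "adapted f P e"
  shows "d\<sigma> (pos_multiples f) X = - fadj P e X"
proof -
  have P: "invertible P" "\<forall>i. e i = 1 \<or> e i = - 1" using f(2) by (auto simp: adapted_def)
  have "\<sigma>_lift (pos_multiples f) = (\<lambda>X. matrix_inv (fadj P e X))"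
    by (simp add: \<sigma>_lift_def fun_eq_iff adjoint_for_eq[OF f])
  moreover have "((\<lambda>X. matrix_inv (fadj P e X)) has_derivative (\<lambda>H. - fadj P e H)) (at (mat 1))"
  proof -
    have 1: "(fadj P e has_derivative fadj P e) (at (mat 1))"
      by (intro linear_imp_has_derivative linear_fadj)
    have 2: "(matrix_inv has_derivative (\<lambda>H. - H)) (at (fadj P e (mat 1)))"
      unfolding fadj_mat_1[OF P] by (rule has_derivative_matrix_inv_at_1)
    show ?thesis by (rule has_derivative_compose[OF 1 2])
  qed
  ultimately show ?thesis unfolding d\<sigma>_def by (metis frechet_derivative_at)
qed

section \<open>Orthogonal eigenbases\<close>

lemma orth_part_simps:
  fixes f :: "('k::real_or_complex, 'n::finite) form"
  assumes f: "hermitian_form f"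
  shows "orth_part f B (c *s w) = c *s orth_part f B w"
  unfolding orth_part_def
  by (simp add: hermitian_form_simps[OF f] vec_eq_iff sum_distrib_left algebra_simps)

text \<open>
  If \<open>M\<close> is self-adjoint and diagonalizable over the reals, an orthogonal family \<open>B\<close> of anisotropic
  eigenvectors that does not span can be enlarged: the projections of an eigenbasis to the orthogonal
  complement of \<open>B\<close> are eigenvectors, and if all eigenvectors in that complement were isotropic,
  then by polarization the projections would be orthogonal to everything.
\<close>

lemma self_adjoint_orthogonal_eigenbasis:
  fixes f :: "('k::real_or_complex, 'n::finite) form" and Q M :: "'k ^ 'n ^ 'n"
  assumes f: "hermitian_form f" and P: "adapted f P e"
    and M: "\<And>u v. f (M *v u) v = f u (M *v v)"
    and Q: "invertible Q" "\<And>j. M *v column j Q = of_real (c j) *s column j Q"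
  obtains R :: "'k ^ 'n ^ 'n" where "invertible R" "\<And>j. \<exists>c::real. M *v column j R = of_real c *s column j R"
    "\<And>i j. i \<noteq> j \<Longrightarrow> f (column i R) (column j R) = 0"
proof (rule orthogonal_basis_greedy[OF f, of "\<lambda>v. \<exists>c::real. M *v v = of_real c *s v"])
  fix B assume B: "finite B" "vec.span B \<noteq> UNIV" "\<And>u. u \<in> B \<Longrightarrow> \<exists>c::real. M *v u = of_real c *s u"
    "\<And>u. u \<in> B \<Longrightarrow> f u u \<noteq> 0" "\<And>u v. u \<in> B \<Longrightarrow> v \<in> B \<Longrightarrow> u \<noteq> v \<Longrightarrow> f u v = 0"
  note fs = hermitian_form_simps[OF f]
  define w where "w j = orth_part f B (column j Q)" for j
  have wB: "f (w j) u = 0" if "u \<in> B" for j u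
    unfolding w_def by (rule orth_part_orthogonal[OF f B(1,4,5) that])
  have Mw: "M *v w j = of_real (c j) *s w j" for j
  proof -
    have "M *v w j = M *v column j Q - (\<Sum>u\<in>B. (f (column j Q) u / f u u) *s (M *v u))"
      by (simp add: w_def orth_part_def matrix_vector_mult_diff_distrib vec.sum matrix_vec_smult)
    also have "(\<Sum>u\<in>B. (f (column j Q) u / f u u) *s (M *v u)) = (\<Sum>u\<in>B. (f (M *v column j Q) u / f u u) *s u)"
    proof (rule sum.cong[OF refl])
      fix u assume "u \<in> B"
      then obtain a :: real where a: "M *v u = of_real a *s u" using B(3) by blast
      show "(f (column j Q) u / f u u) *s (M *v u) = (f (M *v column j Q) u / f u u) *s u"
        unfolding M a by (simp add: fs vec_eq_iff)
    qed
    also have "M *v column j Q - (\<Sum>u\<in>B. (f (M *v column j Q) u / f u u) *s u) = orth_part f B (M *v column j Q)"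
      by (simp add: orth_part_def)
    finally show ?thesis by (simp add: Q(2) orth_part_simps[OF f] w_def)
  qed
  show "\<exists>v. (\<exists>c::real. M *v v = of_real c *s v) \<and> f v v \<noteq> 0 \<and> (\<forall>u\<in>B. f v u = 0)"
  proof (rule ccontr)
    assume "\<not> ?thesis"
    then have iso: "f v v = 0" if "M *v v = of_real c *s v" "\<And>u. u \<in> B \<Longrightarrow> f v u = 0" for v and c :: real
      using that by blast
    have ww: "f (w i) (w j) = 0" for i j
    proof (cases "c i = c j")
      case True
      define t where "t = f (w i) (w j)"
      have "f (w i + t *s w j) (w i + t *s w j) = 0"
      proof (rule iso[of _ "c j"])
        show "M *v (w i + t *s w j) = of_real (c j) *s (w i + t *s w j)"
          by (simp add: matrix_vector_right_distrib matrix_vec_smult Mw True vec_eq_iff algebra_simps)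
      qed (simp add: fs wB)
      moreover have "f (w i) (w i) = 0" "f (w j) (w j) = 0" using iso[OF Mw wB] by auto
      ultimately have "kcnj t * t + t * f (w j) (w i) = 0" by (simp add: fs t_def) (simp add: add.commute)
      moreover have "f (w j) (w i) = kcnj t" unfolding t_def by (rule hermitian_form_commute[OF f])
      ultimately have "2 * (t * kcnj t) = 0" by (simp add: mult.commute)
      then show ?thesis by (simp add: t_def)
    next
      case False
      have "of_real (c i) * f (w i) (w j) = of_real (c j) * f (w i) (w j)"
        using M[of "w i" "w j"] by (simp add: Mw fs)
      then show ?thesis using False by simp
    qed
    have "f (w i) (column j Q) = 0" for i j
    proof -
      have "f (w i) x = 0" if "x \<in> vec.span B" for x
        using that by (induction rule: vec.span_induct_alt) (simp_all add: fs wB)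
      from this[OF orth_part_diff_span[of "column j Q" f B]]
      show ?thesis using ww by (simp add: fs w_def)
    qed
    then have wQ: "f (w i) (Q *v x) = 0" for i x
      by (simp add: matrix_mult_sum hermitian_form_sum[OF f] fs)
    have "f x (w i) = 0" for i x
    proof -
      have "x = Q *v (matrix_inv Q *v x)" by (simp add: matrix_vector_mul_assoc matrix_inv_right[OF Q(1)])
      then have "f (w i) x = 0" using wQ by metis
      then show ?thesis using hermitian_form_commute[OF f, of x "w i"] by simp
    qed
    then have "w i = 0" for i using adapted_nondegenerate[OF P] by blast
    then have "column i Q \<in> vec.span B" for i
      using orth_part_diff_span[of "column i Q" f B] by (simp add: w_def)
    then have "columns Q \<subseteq> vec.span B" by (auto simp: columns_def)
    then have "vec.span (columns Q) \<subseteq> vec.span B" by (rule vec.span_minimal) simp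
    moreover have "vec.span (columns Q) = UNIV"
      using matrix_right_invertible_span_columns[of Q] matrix_inv_right[OF Q(1)] by blast
    ultimately show False using B(2) by auto
  qed
qed (rule that)

subsection \<open>Simultaneous diagonalization of commuting Hermitian matrices\<close>

lemma of_real_smult: "of_real r *s v = r *\<^sub>R (v :: 'k::real_or_complex ^ 'n)"
  by (simp add: vec_eq_iff) (simp add: scaleR_conv_of_real)

lemma subspace_of_vec_subspace: "vec.subspace W \<Longrightarrow> subspace (W :: ('k::real_or_complex ^ 'n) set)"
  unfolding vec.subspace_def subspace_def by (metis of_real_smult)

lemma hermitian_form_hprod: "hermitian_form (hprod :: ('k::real_or_complex, 'n::finite) form)"
  unfolding hermitian_form_def using hprod_commute by auto

text \<open>
  A maximum \<open>c\<close> of \<open>\<langle>M v, v\<rangle>\<close> on the unit sphere of \<open>W\<close> is an eigenvalue: \<open>T = c - M\<close> is positive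
  semidefinite on \<open>W\<close> and \<open>\<langle>T v, v\<rangle> = 0\<close>, so \<open>T v = 0\<close>.
\<close>

lemma hermitian_matrix_real_eigenvector:
  fixes M :: "'k::real_or_complex ^ 'n ^ 'n"
  assumes M: "ct M = M" and W: "vec.subspace W" "W \<noteq> {0}" "\<And>v. v \<in> W \<Longrightarrow> M *v v \<in> W"
  obtains v and c :: real where "v \<in> W" "v \<noteq> 0" "M *v v = of_real c *s v"
proof -
  have sW: "subspace W" by (rule subspace_of_vec_subspace[OF W(1)])
  define S where "S = W \<inter> sphere 0 1"
  have "compact S" unfolding S_def by (intro closed_Int_compact closed_subspace[OF sW] compact_sphere)
  moreover have "S \<noteq> {}"
  proof -
    obtain v where v: "v \<in> W" "v \<noteq> 0" using W(1,2) vec.subspace_0 by blast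
    then have "(1 / norm v) *\<^sub>R v \<in> S" by (simp add: S_def subspace_scale[OF sW])
    then show ?thesis by blast
  qed
  moreover have "continuous_on S (\<lambda>v. inner (M *v v) v)"
    by (intro continuous_intros linear_continuous_on matrix_vector_mul_bounded_linear)
  ultimately obtain v where v: "v \<in> S" "\<And>y. y \<in> S \<Longrightarrow> inner (M *v y) y \<le> inner (M *v v) v"
    using continuous_attains_sup[of S "\<lambda>v. inner (M *v v) v"] by blast
  define c where "c = inner (M *v v) v"
  have vW: "v \<in> W" "norm v = 1" using v(1) by (auto simp: S_def)
  have lin: "linear ((*v) M)" by simp
  have sym: "inner (M *v x) y = inner x (M *v y)" for x y
    using hprod_ct[of M x y] by (simp add: inner_eq_repart_hprod M)
  have le: "inner (M *v y) y \<le> c * inner y y" if "y \<in> W" for y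
  proof (cases "y = 0")
    case False
    define z where "z = (1 / norm y) *\<^sub>R y"
    have "z \<in> S" using that False by (simp add: S_def z_def subspace_scale[OF sW])
    then have "inner (M *v z) z \<le> c" using v(2) by (simp add: c_def)
    moreover have "M *v z = (1 / norm y) *\<^sub>R (M *v y)" unfolding z_def by (rule linear_cmul[OF lin])
    ultimately have "inner (M *v y) y / (norm y * norm y) \<le> c" by (simp add: z_def)
    then show ?thesis
      using False by (simp add: divide_le_eq power2_eq_square flip: power2_norm_eq_inner)
  qed simp
  define T where "T y = c *\<^sub>R y - M *v y" for y
  have TW: "T y \<in> W" if "y \<in> W" for y
    unfolding T_def using that W(3) by (intro subspace_diff[OF sW] subspace_scale[OF sW])
  have Tpos: "inner (T y) y \<ge> 0" if "y \<in> W" for y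
    using le[OF that] by (simp add: T_def inner_diff_left)
  have Tsym: "inner (T x) y = inner x (T y)" for x y by (simp add: T_def inner_simps sym)
  have Tlin: "T (x + t *\<^sub>R y) = T x + t *\<^sub>R T y" for x y t
    by (simp add: T_def linear_add[OF lin] linear_cmul[OF lin] algebra_simps)
  define y where "y = T v"
  define a b where "a = inner y y" and "b = inner (T y) y"
  have "b \<ge> 0" unfolding b_def y_def by (intro Tpos TW vW)
  \<comment> \<open>\<open>2 t a + t\<^sup>2 b\<close> is negative for this \<open>t\<close> unless \<open>a = 0\<close>\<close>
  define t where "t = - a / (b + 1)"
  have "inner (T v) v = 0" using vW(2) by (simp add: T_def inner_diff_left c_def flip: power2_norm_eq_inner)
  then have eq: "inner (T (v + t *\<^sub>R y)) (v + t *\<^sub>R y) = 2 * t * a + t * t * b"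
    unfolding Tlin using Tsym[of y v] by (simp add: inner_simps a_def b_def y_def[symmetric] inner_commute)
  have "v + t *\<^sub>R y \<in> W" unfolding y_def by (intro subspace_add[OF sW] subspace_scale[OF sW] TW vW)
  from Tpos[OF this] have "0 \<le> 2 * t * a + t * t * b" unfolding eq .
  also have "2 * t * a + t * t * b = - (a * a * (b + 2)) / ((b + 1) * (b + 1))"
    using \<open>b \<ge> 0\<close> by (simp add: t_def divide_simps) (simp add: algebra_simps)
  finally have *: "0 \<le> - (a * a * (b + 2)) / ((b + 1) * (b + 1))" .
  have "a = 0"
  proof (rule ccontr)
    assume "a \<noteq> 0"
    then have "a * a > 0" by (metis not_square_less_zero linorder_neqE mult_eq_0_iff)
    then have "a * a * (b + 2) / ((b + 1) * (b + 1)) > 0"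
      using \<open>b \<ge> 0\<close> by (intro divide_pos_pos mult_pos_pos[of "a * a"] mult_pos_pos[of "b + 1"]) auto
    then show False using * by simp
  qed
  then have "M *v v = c *\<^sub>R v" by (simp add: a_def y_def T_def)
  moreover have "v \<noteq> 0" using vW(2) by auto
  ultimately show ?thesis using that[of v c] vW(1) by (simp add: of_real_smult)
qed

text \<open>
  A real eigenspace of one member of the family is invariant under all the others. So \<open>W\<close> can be cut
  down until every member acts on it by a scalar.
\<close>

lemma commuting_hermitian_common_eigenvector:
  fixes \<F> :: "('k::real_or_complex ^ 'n ^ 'n) set"
  assumes F: "\<And>M. M \<in> \<F> \<Longrightarrow> ct M = M" "\<And>M N. M \<in> \<F> \<Longrightarrow> N \<in> \<F> \<Longrightarrow> M ** N = N ** M"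
    and "vec.subspace W" "W \<noteq> {0}" "\<And>M v. M \<in> \<F> \<Longrightarrow> v \<in> W \<Longrightarrow> M *v v \<in> W"
  shows "\<exists>v\<in>W. v \<noteq> 0 \<and> (\<forall>M\<in>\<F>. \<exists>c::real. M *v v = of_real c *s v)"
  using assms(3-)
proof (induction "vec.dim W" arbitrary: W rule: less_induct)
  case (less W)
  show ?case
  proof (cases "\<forall>M\<in>\<F>. \<exists>c::real. \<forall>v\<in>W. M *v v = of_real c *s v")
    case True
    obtain v where "v \<in> W" "v \<noteq> 0" using less.prems(1,2) vec.subspace_0 by blast
    then show ?thesis using True by blast
  next
    case False
    then obtain M where M: "M \<in> \<F>" "\<And>c::real. \<exists>v\<in>W. M *v v \<noteq> of_real c *s v" by blast
    obtain v and c :: real where v: "v \<in> W" "v \<noteq> 0" "M *v v = of_real c *s v"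
      using hermitian_matrix_real_eigenvector[OF F(1)[OF M(1)] less.prems(1,2) less.prems(3)[OF M(1)]] by blast
    define W' where "W' = {v\<in>W. M *v v = of_real c *s v}"
    have sub: "vec.subspace W'"
      using less.prems(1) unfolding W'_def vec.subspace_def
      by (auto simp: matrix_vector_right_distrib matrix_vec_smult vec_eq_iff algebra_simps)
    have "W' \<noteq> W" using M(2)[of c] by (auto simp: W'_def)
    then have "W' \<subset> W" by (auto simp: W'_def)
    then have "vec.span W' \<subset> vec.span W"
      using sub less.prems(1) by (metis vec.span_eq_iff)
    then have "vec.dim W' < vec.dim W" by (rule vec.dim_psubset)
    moreover have "W' \<noteq> {0}" using v by (auto simp: W'_def)
    moreover have "N *v x \<in> W'" if "N \<in> \<F>" "x \<in> W'" for N x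
    proof -
      have "M *v (N *v x) = N *v (M *v x)" by (simp add: matrix_vector_mul_assoc F(2)[OF M(1) that(1)])
      then show ?thesis using that less.prems(3) by (auto simp: W'_def matrix_vec_smult)
    qed
    ultimately have "\<exists>v\<in>W'. v \<noteq> 0 \<and> (\<forall>M\<in>\<F>. \<exists>c::real. M *v v = of_real c *s v)"
      using less.hyps sub by blast
    then show ?thesis by (auto simp: W'_def)
  qed
qed

lemma ct_mult_self_nth: "(ct U ** U) $ i $ j = hprod (column j U) (column i U)"
  by (simp add: matrix_matrix_mult_def ct_def hprod_def column_def mult.commute)

lemma commuting_hermitian_diagonalization:
  fixes \<F> :: "('k::real_or_complex ^ 'n ^ 'n) set"
  assumes F: "\<And>M. M \<in> \<F> \<Longrightarrow> ct M = M" "\<And>M N. M \<in> \<F> \<Longrightarrow> N \<in> \<F> \<Longrightarrow> M ** N = N ** M"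
  obtains U :: "'k ^ 'n ^ 'n" where "ct U ** U = mat 1" "\<And>M. M \<in> \<F> \<Longrightarrow> \<exists>a. M ** U = U ** rdg a"
proof -
  obtain Q :: "'k ^ 'n ^ 'n" where Q: "invertible Q" "\<And>j. \<forall>M\<in>\<F>. \<exists>c::real. M *v column j Q = of_real c *s column j Q"
    "\<And>i j. i \<noteq> j \<Longrightarrow> hprod (column i Q) (column j Q) = 0"
  proof (rule orthogonal_basis_greedy[OF hermitian_form_hprod, of "\<lambda>v. \<forall>M\<in>\<F>. \<exists>c::real. M *v v = of_real c *s v"])
    fix B :: "('k ^ 'n) set"
    assume B: "finite B" "vec.span B \<noteq> UNIV" "\<And>u. u \<in> B \<Longrightarrow> \<forall>M\<in>\<F>. \<exists>c::real. M *v u = of_real c *s u"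
      "\<And>u. u \<in> B \<Longrightarrow> hprod u u \<noteq> 0" "\<And>u v. u \<in> B \<Longrightarrow> v \<in> B \<Longrightarrow> u \<noteq> v \<Longrightarrow> hprod u v = 0"
    define W where "W = {v. \<forall>u\<in>B. hprod v u = 0}"
    have "vec.subspace W" by (auto simp: W_def vec.subspace_def)
    moreover have "W \<noteq> {0}"
    proof -
      obtain w where w: "w \<notin> vec.span B" using B(2) by blast
      have "orth_part hprod B w \<in> W"
        using orth_part_orthogonal[OF hermitian_form_hprod B(1,4,5)] by (auto simp: W_def)
      moreover have "orth_part hprod B w \<noteq> 0" using w orth_part_diff_span[of w hprod B] by auto
      ultimately show ?thesis by blast
    qed
    moreover have "M *v v \<in> W" if M: "M \<in> \<F>" and v: "v \<in> W" for M v
    proof -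
      have "hprod (M *v v) u = 0" if u: "u \<in> B" for u
      proof -
        obtain c :: real where "M *v u = of_real c *s u" using B(3)[OF u] M by blast
        then show ?thesis using u v by (simp add: hprod_ct F(1)[OF M] W_def)
      qed
      then show ?thesis by (simp add: W_def)
    qed
    ultimately have "\<exists>v\<in>W. v \<noteq> 0 \<and> (\<forall>M\<in>\<F>. \<exists>c::real. M *v v = of_real c *s v)"
      using commuting_hermitian_common_eigenvector[of \<F> W] F by blast
    then show "\<exists>v. (\<forall>M\<in>\<F>. \<exists>c::real. M *v v = of_real c *s v) \<and> hprod v v \<noteq> 0 \<and> (\<forall>u\<in>B. hprod v u = 0)"
      by (auto simp: W_def)
  qed blast
  define U where "U = Q ** rdg (\<lambda>j. 1 / norm (column j Q))"
  have col: "column j U = of_real (1 / norm (column j Q)) *s column j Q" for j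
    by (simp add: U_def vec_eq_iff column_def mult.commute)
  have "(ct U ** U) $ i $ j = mat 1 $ i $ j" for i j
  proof (cases "i = j")
    case True
    have "norm (column j Q) \<noteq> 0" using column_nonzero[OF Q(1)] by simp
    then show ?thesis using True
      unfolding ct_mult_self_nth col hprod_simps by (simp add: hprod_self mat_def power2_eq_square)
  next
    case False
    then show ?thesis unfolding ct_mult_self_nth col by (simp add: Q(3) mat_def)
  qed
  then have "ct U ** U = mat 1" by (simp add: vec_eq_iff)
  moreover have "\<exists>a. M ** U = U ** rdg a" if M: "M \<in> \<F>" for M
  proof -
    have "\<forall>j. \<exists>c::real. M *v column j Q = of_real c *s column j Q" using Q(2) M by blast
    from choice[OF this] obtain a :: "'n \<Rightarrow> real"
      where a: "\<And>j. M *v column j Q = of_real (a j) *s column j Q" by blast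
    have "column j (M ** U) = column j (U ** rdg a)" for j
    proof -
      have "column j (M ** U) = of_real (a j) *s column j U"
        unfolding column_mult col matrix_vec_smult a by (simp add: vector_smult_assoc mult.commute)
      then show ?thesis by (simp add: vec_eq_iff column_def mult.commute)
    qed
    then have "M ** U = U ** rdg a" by (simp add: vec_eq_iff column_def)
    then show ?thesis by blast
  qed
  ultimately show ?thesis using that by blast
qed

section \<open>The Killing form\<close>

text \<open>
  Expanding the images of the standard basis in a basis of \<open>S\<close>, and the basis of \<open>S\<close> in the standard
  one, turns one trace into the other. In particular the arbitrary choice of a basis in the definition
  of the trace is harmless.
\<close>

lemma trace_on_eq_sum_Basis:
  fixes F :: "'a::euclidean_space \<Rightarrow> 'a"
  assumes F: "linear F" and S: "subspace S" "\<And>x. F x \<in> S"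
  shows "trace_on S F = (\<Sum>b\<in>Basis. inner (F b) b)"
proof -
  define B where "B = (SOME B. independent B \<and> span B = S)"
  have "\<exists>B. independent B \<and> span B = S" using basis_subspace_exists[OF S(1)] by metis
  then have "independent B \<and> span B = S" unfolding B_def by (rule someI_ex)
  then have B: "independent B" "span B = S" by auto
  then have fin: "finite B" by (simp add: independent_imp_finite)
  define r where "r x b = representation B (F x) b" for x b
  have FS: "F x \<in> span B" for x using S(2) B by simp
  have r: "F x = (\<Sum>b\<in>B. r x b *\<^sub>R b)" for x
    unfolding r_def by (rule sum_representation_eq[OF B(1) FS fin order_refl, symmetric])
  have lin: "r x b = (\<Sum>c\<in>Basis. inner x c * r c b)" for x b
  proof -
    have "F x = F (\<Sum>c\<in>Basis. inner x c *\<^sub>R c)" by (simp add: euclidean_representation)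
    also have "\<dots> = (\<Sum>c\<in>Basis. inner x c *\<^sub>R F c)" by (simp add: linear_sum[OF F] linear_cmul[OF F])
    finally have eq: "F x = (\<Sum>c\<in>Basis. inner x c *\<^sub>R F c)" .
    show ?thesis
      unfolding r_def eq using FS
      by (simp add: representation_sum[OF B(1)] representation_scale[OF B(1)] span_scale)
  qed
  have "(\<Sum>c\<in>Basis. inner (F c) c) = (\<Sum>c\<in>Basis. \<Sum>b\<in>B. r c b * inner b c)"
    by (subst r) (simp add: inner_sum_left)
  also have "\<dots> = (\<Sum>b\<in>B. \<Sum>c\<in>Basis. inner b c * r c b)"
    by (subst sum.swap) (simp add: mult.commute)
  also have "\<dots> = (\<Sum>b\<in>B. r b b)" by (simp flip: lin)
  also have "\<dots> = trace_on S F" unfolding trace_on_def Let_def B_def[symmetric] r_def ..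
  finally show ?thesis by simp
qed

lemma sum_inner_cyclic:
  fixes G H :: "'a::euclidean_space \<Rightarrow> 'a"
  assumes "linear G" "linear H"
  shows "(\<Sum>b\<in>Basis. inner (G (H b)) b) = (\<Sum>b\<in>Basis. inner (H (G b)) b)"
proof -
  have *: "inner (G (H b)) b = (\<Sum>c\<in>Basis. inner (H b) c * inner (G c) b)" if "linear G"
    for b and G H :: "'a \<Rightarrow> 'a"
  proof -
    have "G (H b) = G (\<Sum>c\<in>Basis. inner (H b) c *\<^sub>R c)" by (simp add: euclidean_representation)
    also have "\<dots> = (\<Sum>c\<in>Basis. inner (H b) c *\<^sub>R G c)" using that by (simp add: linear_sum linear_cmul)
    finally show ?thesis by (simp add: inner_sum_left)
  qed
  show ?thesis
    unfolding *[OF assms(1), of H] *[OF assms(2), of G]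
    by (subst sum.swap) (simp add: mult.commute)
qed

lemma linear_lie: "linear (lie X)"
  unfolding lie_def
  by (simp add: linear_iff matrix_add_ldistrib matrix_add_rdistrib scaleR_left_mult scaleR_right_mult algebra_simps)

lemma lie_in_sl: "lie X Y \<in> sl"
  by (simp add: lie_def sl_def trace_sub trace_mul_sym[of X])

lemma trace_scaleR: "trace (r *\<^sub>R A) = r *\<^sub>R trace (A :: 'k::real_or_complex ^ 'n ^ 'n)"
  by (simp add: trace_def scaleR_sum_right)

lemma trace_minus: "trace (- A) = - trace (A :: 'k::real_or_complex ^ 'n ^ 'n)"
  by (simp add: trace_def sum_negf)

lemma subspace_sl: "subspace sl"
  by (auto simp: subspace_def sl_def trace_add trace_scaleR trace_def[of 0])

lemma killing_eq_sum_Basis: "killing X Y = (\<Sum>Z\<in>Basis. inner (lie X (lie Y Z)) Z)"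
  unfolding killing_def
  by (rule trace_on_eq_sum_Basis[OF linear_compose[OF linear_lie linear_lie, unfolded o_def] subspace_sl lie_in_sl])

lemma sum_Basis_vec:
  "(\<Sum>Z\<in>Basis. F (Z :: 'a::euclidean_space ^ 'n)) = (\<Sum>i\<in>UNIV. \<Sum>u\<in>Basis. F (axis i u))"
proof -
  have "bij_betw (\<lambda>p. axis (fst p) (snd p)) (UNIV \<times> Basis) (Basis :: ('a ^ 'n) set)"
    by (auto simp: bij_betw_def inj_on_def Basis_vec_def axis_eq_axis nonzero_Basis image_iff)
  from sum.reindex_bij_betw[OF this, of F]
  show ?thesis by (simp add: sum.cartesian_product case_prod_unfold)
qed

text \<open>
  On matrix units, the trace of \<open>Z \<mapsto> A Z B\<close> is \<open>tr A tr B\<close>; over the complex numbers the real dimension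
  of the ground field contributes a factor and only the real part survives. In \<open>ad X ad Y\<close>, the two
  mixed terms contain the factor \<open>tr X = 0\<close>.
\<close>

lemma killing_eq_trace:
  fixes X Y :: "'k::real_or_complex ^ 'n ^ 'n"
  assumes "X \<in> sl"
  shows "killing X Y = 2 * real CARD('n) * real DIM('k) * repart (trace (X ** Y))"
proof -
  have *: "inner (lie X (lie Y (axis i (axis j u)))) (axis i (axis j u)) =
      repart ((X ** Y) $ i $ i - X $ i $ i * Y $ j $ j - Y $ i $ i * X $ j $ j + (Y ** X) $ j $ j)"
    if u: "u \<in> Basis" for i j and u :: 'k
  proof -
    define Z :: "'k ^ 'n ^ 'n" where "Z = axis i (axis j u)"
    have Z: "Z $ a $ b = (if a = i then if b = j then u else 0 else 0)" for a b
      by (simp add: Z_def axis_def)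
    have l: "(A ** Z) $ i $ j = A $ i $ i * u" for A :: "'k ^ 'n ^ 'n"
    proof -
      have "(A ** Z) $ i $ j = (\<Sum>k\<in>UNIV. if k = i then A $ i $ i * u else 0)"
        unfolding matrix_matrix_mult_def vec_lambda_beta by (intro sum.cong refl) (simp add: Z)
      then show ?thesis by simp
    qed
    have r: "(Z ** A) $ a $ b = (if a = i then u * A $ j $ b else 0)" for A :: "'k ^ 'n ^ 'n" and a b
    proof -
      have "(Z ** A) $ a $ b = (\<Sum>k\<in>UNIV. if k = j then if a = i then u * A $ j $ b else 0 else 0)"
        unfolding matrix_matrix_mult_def vec_lambda_beta by (intro sum.cong refl) (simp add: Z)
      then show ?thesis by simp
    qed
    have lr: "(A ** (Z ** B)) $ i $ j = A $ i $ i * u * B $ j $ j" for A B :: "'k ^ 'n ^ 'n"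
    proof -
      have "(A ** (Z ** B)) $ i $ j = (\<Sum>k\<in>UNIV. A $ i $ k * (Z ** B) $ k $ j)"
        by (simp add: matrix_matrix_mult_def)
      also have "\<dots> = (\<Sum>k\<in>UNIV. if k = i then A $ i $ i * u * B $ j $ j else 0)"
        by (intro sum.cong refl) (simp add: r)
      finally show ?thesis by simp
    qed
    have eq: "lie X (lie Y Z) = (X ** Y) ** Z - X ** (Z ** Y) - Y ** (Z ** X) + Z ** (Y ** X)"
      by (simp add: lie_def matrix_sub_ldistrib matrix_sub_rdistrib matrix_mul_assoc)
    have "lie X (lie Y Z) $ i $ j =
        ((X ** Y) $ i $ i - X $ i $ i * Y $ j $ j - Y $ i $ i * X $ j $ j + (Y ** X) $ j $ j) * u"
      unfolding eq by (simp add: l r lr) (simp add: algebra_simps)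
    then have "inner (lie X (lie Y Z)) Z =
        inner (((X ** Y) $ i $ i - X $ i $ i * Y $ j $ j - Y $ i $ i * X $ j $ j + (Y ** X) $ j $ j) * u) u"
      by (simp add: Z_def inner_axis)
    then show ?thesis using u by (simp add: inner_mult_left Z_def)
  qed
  have tX: "(\<Sum>i\<in>UNIV. X $ i $ i) = 0" using assms by (simp add: sl_def trace_def)
  have "killing X Y = (\<Sum>i\<in>UNIV. \<Sum>j\<in>UNIV. \<Sum>u\<in>(Basis::'k set).
      repart ((X ** Y) $ i $ i - X $ i $ i * Y $ j $ j - Y $ i $ i * X $ j $ j + (Y ** X) $ j $ j))"
    unfolding killing_eq_sum_Basis sum_Basis_vec by (intro sum.cong refl *)
  also have "\<dots> = real DIM('k) * repart (\<Sum>i\<in>UNIV. \<Sum>j\<in>UNIV.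
      ((X ** Y) $ i $ i - X $ i $ i * Y $ j $ j - Y $ i $ i * X $ j $ j + (Y ** X) $ j $ j))"
    by (simp only: repart_sum sum_distrib_left sum_constant)
  also have "(\<Sum>i\<in>UNIV. \<Sum>j\<in>UNIV. ((X ** Y) $ i $ i - X $ i $ i * Y $ j $ j - Y $ i $ i * X $ j $ j + (Y ** X) $ j $ j))
      = of_nat CARD('n) * trace (X ** Y) + of_nat CARD('n) * trace (Y ** X)"
    by (simp add: sum.distrib sum_subtractf trace_def tX sum_distrib_left[symmetric] sum_distrib_right[symmetric])
  also have "\<dots> = of_real (2 * real CARD('n)) * trace (X ** Y)"
    by (simp add: trace_mul_sym[of Y])
  finally show ?thesis by (simp only: repart_of_real_mult) simp
qed

definition traceless_part :: "'k::real_or_complex ^ 'n ^ 'n \<Rightarrow> 'k ^ 'n ^ 'n" where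
  "traceless_part X = X - mat (trace X / of_nat CARD('n))"

lemma trace_mat: "trace (mat c :: 'k::real_or_complex ^ 'n ^ 'n) = of_nat CARD('n) * c"
  by (simp add: trace_def mat_def)

lemma traceless_part_in_sl: "traceless_part X \<in> sl"
  by (simp add: traceless_part_def sl_def trace_sub trace_mat)

lemma traceless_part_sl: "X \<in> sl \<Longrightarrow> traceless_part X = X"
  by (simp add: traceless_part_def sl_def)

lemma linear_traceless_part: "linear (traceless_part :: 'k::real_or_complex ^ 'n ^ 'n \<Rightarrow> _)"
proof -
  have "mat (a + b) = mat a + (mat b :: 'k ^ 'n ^ 'n)" "mat (r *\<^sub>R a) = r *\<^sub>R (mat a :: 'k ^ 'n ^ 'n)" for a b :: 'k and r
    by (auto simp: mat_def vec_eq_iff)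
  then show ?thesis
    by (simp add: linear_iff traceless_part_def trace_add trace_scaleR add_divide_distrib algebra_simps
        divide_inverse)
qed

lemma lie_traceless_part: "lie Y (traceless_part Z) = lie Y Z"
  by (simp add: traceless_part_def lie_def matrix_sub_ldistrib matrix_sub_rdistrib mat_commute)

text \<open>
  Conjugation by \<open>\<tau>\<close> takes \<open>ad X ad Y\<close> to \<open>ad \<tau>X ad \<tau>Y\<close>. To use cyclicity of the trace on all matrices,
  \<open>\<tau>\<close> is extended by 0 to the scalars, which are killed by \<open>ad\<close> anyway.
\<close>

lemma killing_automorphism:
  fixes \<tau> :: "'k::real_or_complex ^ 'n ^ 'n \<Rightarrow> 'k ^ 'n ^ 'n"
  assumes \<tau>: "\<And>X. X \<in> sl \<Longrightarrow> \<tau> X \<in> sl" "\<And>X. X \<in> sl \<Longrightarrow> \<tau> (\<tau> X) = X"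
    "\<And>X Y. X \<in> sl \<Longrightarrow> Y \<in> sl \<Longrightarrow> \<tau> (X + Y) = \<tau> X + \<tau> Y"
    "\<And>c X. X \<in> sl \<Longrightarrow> \<tau> (c *\<^sub>R X) = c *\<^sub>R \<tau> X"
    "\<And>X Y. X \<in> sl \<Longrightarrow> Y \<in> sl \<Longrightarrow> \<tau> (lie X Y) = lie (\<tau> X) (\<tau> Y)"
    and X: "X \<in> sl" and Y: "Y \<in> sl"
  shows "killing (\<tau> X) (\<tau> Y) = killing X Y"
proof -
  define T where "T Z = \<tau> (traceless_part Z)" for Z
  define F where "F Z = lie X (lie Y Z)" for Z
  have lT: "linear T"
    unfolding T_def
    by (simp add: linear_iff linear_add[OF linear_traceless_part] linear_cmul[OF linear_traceless_part]
        \<tau>(3)[OF traceless_part_in_sl traceless_part_in_sl] \<tau>(4)[OF traceless_part_in_sl])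
  have lF: "linear F" unfolding F_def by (rule linear_compose[OF linear_lie linear_lie, unfolded o_def])
  have TT: "T (T Z) = traceless_part Z" for Z
    unfolding T_def
    by (simp add: traceless_part_sl \<tau>(1)[OF traceless_part_in_sl] \<tau>(2)[OF traceless_part_in_sl])
  have F: "lie (\<tau> X) (lie (\<tau> Y) Z) = T (F (T Z))" for Z
  proof -
    define W where "W = T Z"
    have W: "W \<in> sl" unfolding W_def T_def by (intro \<tau>(1) traceless_part_in_sl)
    have "lie (\<tau> Y) Z = lie (\<tau> Y) (\<tau> W)"
      unfolding W_def T_def by (simp add: lie_traceless_part \<tau>(2)[OF traceless_part_in_sl])
    also have "\<dots> = \<tau> (lie Y W)" by (rule \<tau>(5)[OF Y W, symmetric])
    finally have "lie (\<tau> X) (lie (\<tau> Y) Z) = \<tau> (lie X (lie Y W))" using \<tau>(5)[OF X lie_in_sl] by simp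
    then show ?thesis by (simp add: T_def F_def W_def traceless_part_sl lie_in_sl)
  qed
  have "killing (\<tau> X) (\<tau> Y) = (\<Sum>Z\<in>Basis. inner (T ((F \<circ> T) Z)) Z)"
    unfolding killing_eq_sum_Basis F by simp
  also have "\<dots> = (\<Sum>Z\<in>Basis. inner ((F \<circ> T) (T Z)) Z)"
    by (rule sum_inner_cyclic[OF lT linear_compose[OF lT lF]])
  also have "\<dots> = killing X Y"
    unfolding killing_eq_sum_Basis by (simp add: TT) (simp add: F_def lie_traceless_part)
  finally show ?thesis .
qed

section \<open>Fixed points of bounded linear groups\<close>

text \<open>
  The function \<open>N x = sup\<^sub>g \<parallel>g x\<parallel>\<close> is invariant under the group and, by the parallelogram identity,
  strictly convex; so it has exactly one minimum on \<open>D\<close>, and that minimum is fixed.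
\<close>

lemma bounded_linear_group_fixed_point:
  fixes G :: "('a::euclidean_space \<Rightarrow> 'a) set"
  assumes lin: "\<And>g. g \<in> G \<Longrightarrow> linear g" and id: "id \<in> G"
    and comp: "\<And>g h. g \<in> G \<Longrightarrow> h \<in> G \<Longrightarrow> g \<circ> h \<in> G"
    and inv: "\<And>g. g \<in> G \<Longrightarrow> \<exists>h\<in>G. h \<circ> g = id"
    and bound: "\<And>g x. g \<in> G \<Longrightarrow> norm (g x) \<le> C * norm x"
    and D: "closed D" "convex D" "D \<noteq> {}" "\<And>g x. g \<in> G \<Longrightarrow> x \<in> D \<Longrightarrow> g x \<in> D"
  shows "\<exists>x\<in>D. \<forall>g\<in>G. g x = x"
proof -
  \<comment> \<open>bounded by \<open>C \<parallel>x\<parallel>\<close>, hence a norm, and Lipschitz\<close>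
  define N where "N x = (SUP g\<in>G. norm (g x))" for x
  have bdd: "bdd_above ((\<lambda>g. norm (g x)) ` G)" for x
    using bound by (intro bdd_aboveI2) blast
  have gN: "norm (g x) \<le> N x" if "g \<in> G" for g x
    unfolding N_def by (rule cSUP_upper[OF that bdd])
  have N_le: "N x \<le> c" if "\<And>g. g \<in> G \<Longrightarrow> norm (g x) \<le> c" for x c
    unfolding N_def using id that by (intro cSUP_least) auto
  have xN: "norm x \<le> N x" for x using gN[OF id] by simp
  have NC: "N x \<le> C * norm x" for x by (rule N_le[OF bound])
  have N_inv: "N (h x) \<le> N x" if h: "h \<in> G" for h x
    by (rule N_le) (use gN[OF comp[OF _ h]] in simp)
  have N_add: "N x \<le> N y + C * norm (x - y)" for x y
  proof (rule N_le)
    fix g assume g: "g \<in> G"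
    have "g x = g y + g (x - y)" using lin[OF g] by (simp add: linear_diff)
    then have "norm (g x) \<le> norm (g y) + norm (g (x - y))" by (metis norm_triangle_ineq)
    then show "norm (g x) \<le> N y + C * norm (x - y)" using gN[OF g, of y] bound[OF g, of "x - y"] by linarith
  qed
  have lip: "dist (N x) (N y) \<le> C * dist x y" for x y
    using N_add[of x y] N_add[of y x] by (auto simp: dist_norm norm_minus_commute abs_le_iff)
  have "continuous_on UNIV N"
  proof (rule lipschitz_on_continuous_on)
    show "(max C 0)-lipschitz_on UNIV N"
      unfolding lipschitz_on_def by (auto intro!: order_trans[OF lip] mult_right_mono)
  qed
  then have cont: "continuous_on S N" for S by (rule continuous_on_subset) simp
  obtain x0 where x0: "x0 \<in> D" using D(3) by blast
  have "compact (D \<inter> cball 0 (N x0))" by (intro closed_Int_compact D(1) compact_cball)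
  moreover have "x0 \<in> D \<inter> cball 0 (N x0)" using x0 xN by simp
  ultimately obtain x where x: "x \<in> D \<inter> cball 0 (N x0)" "\<And>y. y \<in> D \<inter> cball 0 (N x0) \<Longrightarrow> N x \<le> N y"
    using continuous_attains_inf[of "D \<inter> cball 0 (N x0)" N] cont by blast
  have min: "N x \<le> N y" if "y \<in> D" for y
  proof (cases "norm y \<le> N x0")
    case False
    then show ?thesis using x(2)[of x0] x0 xN[of x0] xN[of y] by simp
  qed (use x(2) that in simp)
  have "g x = x" if g: "g \<in> G" for g
  proof (rule ccontr)
    assume ne: "g x \<noteq> x"
    define y where "y = g x"
    have y: "y \<in> D" "N y \<le> N x" using D(4)[OF g] x(1) N_inv[OF g] by (auto simp: y_def)
    define z where "z = (1/2) *\<^sub>R x + (1/2) *\<^sub>R y"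
    have zD: "z \<in> D" unfolding z_def using D(2) x(1) y(1) by (intro convexD) auto
    define \<delta> where "\<delta> = norm (x - y)"
    have \<delta>: "\<delta> > 0" using ne by (simp add: \<delta>_def y_def)
    have C: "C > 0"
    proof -
      have "\<delta> \<le> C * \<delta>" using bound[OF id, of "x - y"] by (simp add: \<delta>_def)
      then show ?thesis using \<delta> by (metis not_less order.strict_trans2 zero_less_mult_pos2)
    qed
    have "(norm (h z))\<^sup>2 \<le> (N x)\<^sup>2 - (\<delta> / (2 * C))\<^sup>2" if h: "h \<in> G" for h
    proof -
      obtain k where k: "k \<in> G" "k \<circ> h = id" using inv[OF h] by blast
      have "k (h (x - y)) = x - y" using k(2) by (metis comp_apply id_apply)
      then have "\<delta> \<le> C * norm (h (x - y))" using bound[OF k(1), of "h (x - y)"] by (simp add: \<delta>_def)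
      then have "\<delta> / C \<le> norm (h x - h y)" using C lin[OF h] by (simp add: linear_diff divide_le_eq mult.commute)
      then have 1: "(\<delta> / C)\<^sup>2 \<le> (norm (h x - h y))\<^sup>2" using C \<delta> by (intro power_mono) auto
      have hz: "h z = (1/2) *\<^sub>R (h x + h y)"
        using lin[OF h] by (simp add: z_def linear_add linear_cmul scaleR_add_right)
      have "(norm (h x + h y))\<^sup>2 + (norm (h x - h y))\<^sup>2 = 2 * (norm (h x))\<^sup>2 + 2 * (norm (h y))\<^sup>2"
        by (simp add: power2_norm_eq_inner inner_simps inner_commute)
      moreover have "(norm (h x))\<^sup>2 \<le> (N x)\<^sup>2" "(norm (h y))\<^sup>2 \<le> (N x)\<^sup>2"
        using gN[OF h, of x] gN[OF h, of y] y(2) by (auto intro!: power_mono)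
      moreover have "(norm (h z))\<^sup>2 = (norm (h x + h y))\<^sup>2 / 4"
        by (simp add: hz power_divide)
      moreover have "(\<delta> / (2 * C))\<^sup>2 = (\<delta> / C)\<^sup>2 / 4" by (simp add: power_divide power_mult_distrib)
      ultimately show ?thesis using 1 by simp
    qed
    then have "norm (h z) \<le> sqrt ((N x)\<^sup>2 - (\<delta> / (2 * C))\<^sup>2)" if "h \<in> G" for h
      using that by (metis real_le_rsqrt)
    then have "N z \<le> sqrt ((N x)\<^sup>2 - (\<delta> / (2 * C))\<^sup>2)" by (rule N_le)
    also have "\<dots> < sqrt ((N x)\<^sup>2)" using \<delta> C by (simp del: real_sqrt_abs)
    also have "\<dots> = N x" using xN[of x] by (simp add: order_trans[OF norm_ge_zero])
    finally show False using min[OF zD] by simp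
  qed
  then show ?thesis using x(1) by blast
qed

section \<open>The matrix exponential\<close>

definition mpow :: "'k::real_or_complex ^ 'n ^ 'n \<Rightarrow> nat \<Rightarrow> 'k ^ 'n ^ 'n" where
  "mpow X k = ((\<lambda>M. X ** M) ^^ k) (mat 1)"

lemma mpow_0 [simp]: "mpow X 0 = mat 1" and mpow_Suc: "mpow X (Suc k) = X ** mpow X k"
  by (simp_all add: mpow_def)

lemma mpow_commute: "X ** mpow X k = mpow X k ** X"
  by (induction k) (auto simp: mpow_Suc matrix_mul_assoc)

lemma mpow_scaleR: "mpow (t *\<^sub>R X) k = t ^ k *\<^sub>R mpow X k"
  by (induction k) (auto simp: mpow_Suc scaleR_left_mult scaleR_right_mult)

lemma summable_matrix_exp_entry:
  fixes X :: "'k::real_or_complex ^ 'n ^ 'n"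
  shows "summable (\<lambda>k. (1 / fact k) *\<^sub>R mpow X k $ i $ j * y ^ k)"
    and "summable (\<lambda>k. (1 / fact k) *\<^sub>R mpow X k)"
proof -
  obtain K where K: "K > 0" "\<And>(A :: 'k ^ 'n ^ 'n) (B :: 'k ^ 'n ^ 'n). norm (A ** B) \<le> norm A * norm B * K"
    using bounded_bilinear.pos_bounded[OF bounded_bilinear_matrix_mult[where 'k = 'k and 'n = 'n]] by blast
  have n: "norm (mpow X k) \<le> norm (mat 1 :: 'k ^ 'n ^ 'n) * (K * norm X) ^ k" for k
  proof (induction k)
    case (Suc k)
    have "norm (mpow X (Suc k)) \<le> (K * norm X) * norm (mpow X k)"
      using K(2)[of X "mpow X k"] by (simp add: mpow_Suc mult_ac)
    also have "\<dots> \<le> (K * norm X) * (norm (mat 1 :: 'k ^ 'n ^ 'n) * (K * norm X) ^ k)"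
      using K(1) by (intro mult_left_mono Suc) auto
    finally show ?case by (simp add: mult_ac)
  qed simp
  have e: "summable (\<lambda>k. norm (mat 1 :: 'k ^ 'n ^ 'n) * ((1 / fact k) * a ^ k))" for a :: real
    using summable_exp[of a] by (intro summable_mult) (simp add: inverse_eq_divide)
  show "summable (\<lambda>k. (1 / fact k) *\<^sub>R mpow X k)"
  proof (rule summable_comparison_test'[OF e[of "K * norm X"], of 0])
    fix k show "norm ((1 / fact k) *\<^sub>R mpow X k) \<le> norm (mat 1 :: 'k ^ 'n ^ 'n) * (1 / fact k * (K * norm X) ^ k)"
      using n[of k] by (simp add: divide_right_mono)
  qed
  show "summable (\<lambda>k. (1 / fact k) *\<^sub>R mpow X k $ i $ j * y ^ k)"
  proof (rule summable_comparison_test'[OF e[of "K * norm X * norm y"], of 0])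
    fix k
    have "norm (mpow X k $ i $ j) \<le> norm (mpow X k $ i)" by (rule Finite_Cartesian_Product.norm_nth_le)
    also have "\<dots> \<le> norm (mpow X k)" by (rule Finite_Cartesian_Product.norm_nth_le)
    also note n[of k]
    finally have "norm (mpow X k $ i $ j) * norm y ^ k / fact k
        \<le> norm (mat 1 :: 'k ^ 'n ^ 'n) * (K * norm X) ^ k * norm y ^ k / fact k"
      by (intro divide_right_mono mult_right_mono) auto
    then show "norm ((1 / fact k) *\<^sub>R mpow X k $ i $ j * y ^ k)
        \<le> norm (mat 1 :: 'k ^ 'n ^ 'n) * (1 / fact k * (K * norm X * norm y) ^ k)"
      by (simp add: norm_mult norm_power power_mult_distrib mult_ac)
  qed
qed

lemma matrix_exp_eq: "matrix_exp X = (\<Sum>k. (1 / fact k) *\<^sub>R mpow X k)"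
  by (simp add: matrix_exp_def mpow_def)

lemma suminf_vec_nth:
  fixes F :: "nat \<Rightarrow> 'a::real_normed_vector ^ 'n"
  assumes "summable F"
  shows "suminf F $ i = (\<Sum>k. F k $ i)"
  by (rule bounded_linear.suminf[OF bounded_linear_vec_nth assms])

lemma matrix_exp_nth: "matrix_exp X $ i $ j = (\<Sum>k. (1 / fact k) *\<^sub>R mpow X k $ i $ j)"
proof -
  have 1: "summable (\<lambda>k. (1 / fact k) *\<^sub>R mpow X k)" by (rule summable_matrix_exp_entry)
  then have "summable (\<lambda>k. ((1 / fact k) *\<^sub>R mpow X k) $ i)"
    by (rule bounded_linear.summable[OF bounded_linear_vec_nth])
  then show ?thesis unfolding matrix_exp_eq suminf_vec_nth[OF 1] by (subst suminf_vec_nth) auto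
qed

lemma matrix_exp_0: "matrix_exp 0 = (mat 1 :: 'k::real_or_complex ^ 'n ^ 'n)"
proof -
  have "mpow 0 k = (if k = 0 then mat 1 else 0 :: 'k ^ 'n ^ 'n)" for k
    by (cases k) (auto simp: mpow_Suc)
  then have "(\<lambda>k. (1 / fact k) *\<^sub>R mpow 0 k) = (\<lambda>k. if k = 0 then mat 1 else 0 :: 'k ^ 'n ^ 'n)" by auto
  then show ?thesis unfolding matrix_exp_eq using suminf_finite[of "{0}" "\<lambda>k. if k = 0 then mat 1 else 0 :: 'k ^ 'n ^ 'n"]
    by simp
qed

lemma matrix_exp_commute: "X ** matrix_exp (t *\<^sub>R X) = matrix_exp (t *\<^sub>R X) ** X"
proof -
  have s: "summable (\<lambda>k. (1 / fact k) *\<^sub>R mpow (t *\<^sub>R X) k)" by (rule summable_matrix_exp_entry)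
  have "X ** matrix_exp (t *\<^sub>R X) = (\<Sum>k. X ** ((1 / fact k) *\<^sub>R mpow (t *\<^sub>R X) k))"
    unfolding matrix_exp_eq
    by (rule bounded_linear.suminf[OF bounded_bilinear.bounded_linear_right[OF bounded_bilinear_matrix_mult] s])
  also have "\<dots> = (\<Sum>k. ((1 / fact k) *\<^sub>R mpow (t *\<^sub>R X) k) ** X)"
    by (simp add: mpow_scaleR scaleR_left_mult scaleR_right_mult mpow_commute)
  also have "\<dots> = matrix_exp (t *\<^sub>R X) ** X"
    unfolding matrix_exp_eq
    by (rule bounded_linear.suminf[OF bounded_bilinear.bounded_linear_left[OF bounded_bilinear_matrix_mult] s, symmetric])
  finally show ?thesis .
qed

lemma has_vector_derivative_vecI:
  fixes F :: "real \<Rightarrow> 'a::euclidean_space ^ 'n"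
  assumes "\<And>i. ((\<lambda>t. F t $ i) has_vector_derivative D $ i) (at t)"
  shows "(F has_vector_derivative D) (at t)"
proof -
  have lin: "bounded_linear (\<lambda>x :: 'a. axis i x :: 'a ^ 'n)" for i
    by (intro linear_conv_bounded_linear[THEN iffD1]) (auto simp: linear_iff axis_def vec_eq_iff)
  have eq: "(\<Sum>i\<in>UNIV. axis i (x $ i)) = x" for x :: "'a ^ 'n"
    by (simp add: vec_eq_iff axis_def if_distrib if_distribR cong: if_cong)
  have "((\<lambda>t. \<Sum>i\<in>UNIV. axis i (F t $ i)) has_vector_derivative (\<Sum>i\<in>UNIV. axis i (D $ i))) (at t)"
    by (intro has_vector_derivative_sum bounded_linear.has_vector_derivative[OF lin] assms)
  then show ?thesis unfolding eq .
qed

text \<open>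
  The entries are power series in \<open>t\<close> and can be differentiated term by term.
\<close>

lemma has_vector_derivative_matrix_exp:
  fixes X :: "'k::real_or_complex ^ 'n ^ 'n"
  shows "((\<lambda>t. matrix_exp (t *\<^sub>R X)) has_vector_derivative X ** matrix_exp (t *\<^sub>R X)) (at t)"
proof (intro has_vector_derivative_vecI)
  fix i j
  define c where "c l k = (1 / fact k) *\<^sub>R mpow X k $ l $ j" for l k
  have E: "matrix_exp (s *\<^sub>R X) $ l $ j = (\<Sum>k. c l k * of_real s ^ k)" for s l
    unfolding matrix_exp_nth mpow_scaleR c_def
    by (intro suminf_cong) (simp add: scaleR_conv_of_real[where 'a = 'k] mult_ac)
  have sum: "summable (\<lambda>k. c l k * y ^ k)" for l y
    unfolding c_def by (rule summable_matrix_exp_entry)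
  have "diffs (c i) k = (\<Sum>l\<in>UNIV. X $ i $ l * c l k)" for k
  proof -
    have "diffs (c i) k = (real (Suc k) * (1 / fact (Suc k))) *\<^sub>R mpow X (Suc k) $ i $ j"
      by (simp add: diffs_def c_def scaleR_conv_of_real[where 'a = 'k] del: of_nat_Suc fact_Suc)
    also have "real (Suc k) * (1 / fact (Suc k)) = 1 / fact k" by simp
    also have "(1 / fact k) *\<^sub>R mpow X (Suc k) $ i $ j = (\<Sum>l\<in>UNIV. X $ i $ l * c l k)"
      by (simp add: mpow_Suc matrix_matrix_mult_def c_def scaleR_sum_right)
    finally show ?thesis .
  qed
  then have D: "(\<Sum>k. diffs (c i) k * z ^ k) = (\<Sum>l\<in>UNIV. X $ i $ l * (\<Sum>k. c l k * z ^ k))" for z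
    by (simp add: sum_distrib_right mult.assoc suminf_sum summable_mult sum suminf_mult)
  have "((\<lambda>z. \<Sum>k. c i k * z ^ k) has_field_derivative (\<Sum>l\<in>UNIV. X $ i $ l * (\<Sum>k. c l k * of_real t ^ k)))
      (at (of_real t))"
    using termdiffs_strong_converges_everywhere[of "c i" "of_real t", OF sum] unfolding D .
  moreover have "((of_real :: real \<Rightarrow> 'k) has_vector_derivative 1) (at t)"
    using bounded_linear.has_vector_derivative[OF bounded_linear_of_real has_vector_derivative_id] by simp
  ultimately have "((\<lambda>z. \<Sum>k. c i k * z ^ k) \<circ> of_real has_vector_derivative
      1 * (\<Sum>l\<in>UNIV. X $ i $ l * (\<Sum>k. c l k * of_real t ^ k))) (at t)"
    by (intro field_vector_diff_chain_at)
  then show "((\<lambda>t. matrix_exp (t *\<^sub>R X) $ i $ j) has_vector_derivative (X ** matrix_exp (t *\<^sub>R X)) $ i $ j) (at t)"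
    by (simp add: o_def E matrix_matrix_mult_def)
qed

lemma matrix_exp_minus: "matrix_exp (t *\<^sub>R X) ** matrix_exp ((- t) *\<^sub>R X) = mat 1"
proof -
  have d: "((\<lambda>t. matrix_exp ((- t) *\<^sub>R X)) has_vector_derivative - (X ** matrix_exp ((- t) *\<^sub>R X))) (at t)" for t
    using has_vector_derivative_matrix_exp[of "- X" t]
    by (simp add: matrix_minus_left)
  have "((\<lambda>t. matrix_exp (t *\<^sub>R X) ** matrix_exp ((- t) *\<^sub>R X)) has_vector_derivative
      matrix_exp (t *\<^sub>R X) ** - (X ** matrix_exp ((- t) *\<^sub>R X)) +
      (X ** matrix_exp (t *\<^sub>R X)) ** matrix_exp ((- t) *\<^sub>R X)) (at t within UNIV)" for t
    by (rule bounded_bilinear.has_vector_derivative[OF bounded_bilinear_matrix_mult has_vector_derivative_matrix_exp d])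
  moreover have "matrix_exp (t *\<^sub>R X) ** - (X ** matrix_exp ((- t) *\<^sub>R X)) +
      (X ** matrix_exp (t *\<^sub>R X)) ** matrix_exp ((- t) *\<^sub>R X) = 0" for t
    by (simp add: matrix_minus_right matrix_mul_assoc matrix_exp_commute)
  ultimately have *: "((\<lambda>t. matrix_exp (t *\<^sub>R X) ** matrix_exp ((- t) *\<^sub>R X)) has_vector_derivative 0) (at t within UNIV)" for t
    by simp
  obtain c where "\<And>t. t \<in> UNIV \<Longrightarrow> matrix_exp (t *\<^sub>R X) ** matrix_exp ((- t) *\<^sub>R X) = c"
    by (rule has_vector_derivative_zero_constant[OF convex_UNIV *]) blast
  then have c: "matrix_exp (t *\<^sub>R X) ** matrix_exp ((- t) *\<^sub>R X) = c" for t by simp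
  from c[of 0] have "c = mat 1" by (simp add: matrix_exp_0)
  then show ?thesis using c by simp
qed

section \<open>Conjugation\<close>

definition cb :: "'k::real_or_complex ^ 'n ^ 'n \<Rightarrow> 'k ^ 'n ^ 'n \<Rightarrow> 'k ^ 'n ^ 'n" where
  "cb P X = P ** X ** matrix_inv P"

lemma invertible_matrix_inv: "invertible P \<Longrightarrow> invertible (matrix_inv P)"
  and matrix_inv_matrix_inv [simp]: "invertible P \<Longrightarrow> matrix_inv (matrix_inv P) = P"
  for P :: "'k::real_or_complex ^ 'n ^ 'n"
  by (auto simp: invertible_def intro!: matrix_inv_eqI matrix_inv_left) (metis invertible_def matrix_inv_left matrix_inv_right)

lemma matrix_inv_mult:
  fixes A B :: "'k::real_or_complex ^ 'n ^ 'n"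
  assumes "invertible A" "invertible B"
  shows "matrix_inv (A ** B) = matrix_inv B ** matrix_inv A"
proof (rule matrix_inv_eqI)
  have "A ** B ** (matrix_inv B ** matrix_inv A) = A ** (B ** matrix_inv B) ** matrix_inv A"
    by (simp add: matrix_mul_assoc)
  then show "A ** B ** (matrix_inv B ** matrix_inv A) = mat 1"
    by (simp add: matrix_inv_right assms)
qed

lemma cb_simps:
  "cb P (X + Y) = cb P X + cb P Y" "cb P (X - Y) = cb P X - cb P Y" "cb P (- X) = - cb P X"
  "cb P (r *\<^sub>R X) = r *\<^sub>R cb P X" "cb P 0 = 0"
  by (simp_all add: cb_def matrix_add_ldistrib matrix_add_rdistrib matrix_sub_ldistrib matrix_sub_rdistrib
      matrix_minus_left matrix_minus_right scaleR_left_mult scaleR_right_mult)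

lemma linear_cb: "linear (cb P)"
  by (simp add: linear_iff cb_simps)

lemma cb_mult: "invertible P \<Longrightarrow> cb P (X ** Y) = cb P X ** cb P Y"
proof -
  assume P: "invertible P"
  have "cb P X ** cb P Y = P ** X ** (matrix_inv P ** P) ** Y ** matrix_inv P"
    by (simp add: cb_def matrix_mul_assoc)
  then show ?thesis by (simp add: matrix_inv_left[OF P] cb_def matrix_mul_assoc)
qed

lemma cb_mat [simp]: "invertible P \<Longrightarrow> cb P (mat c) = mat c"
proof -
  assume "invertible P"
  have "cb P (mat c) = mat c ** (P ** matrix_inv P)" unfolding cb_def by (metis mat_commute matrix_mul_assoc)
  then show ?thesis by (simp add: matrix_inv_right[OF \<open>invertible P\<close>])
qed

lemma cb_cb: "invertible A \<Longrightarrow> invertible B \<Longrightarrow> cb A (cb B X) = cb (A ** B) X"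
  by (simp add: cb_def matrix_inv_mult matrix_mul_assoc)

lemma matrix_inv_mat_1 [simp]: "matrix_inv (mat 1 :: 'k::real_or_complex ^ 'n ^ 'n) = mat 1"
  by (rule matrix_inv_eqI) simp

lemma cb_mat_1 [simp]: "cb (mat 1) X = X"
  by (simp add: cb_def)

lemma cb_inv [simp]:
  assumes "invertible P"
  shows "cb P (cb (matrix_inv P) X) = X" "cb (matrix_inv P) (cb P X) = X"
  using assms by (simp_all add: cb_cb invertible_matrix_inv matrix_inv_left matrix_inv_right)

lemma trace_cb [simp]: "invertible P \<Longrightarrow> trace (cb P X) = trace X"
  unfolding cb_def by (subst trace_mul_sym) (simp add: matrix_mul_assoc matrix_inv_left)

lemma cb_in_sl: "invertible P \<Longrightarrow> cb P X \<in> sl \<longleftrightarrow> X \<in> sl"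
  by (simp add: sl_def)

lemma norm_det_1_invertible: "norm (det A) = 1 \<Longrightarrow> invertible (A :: 'k::real_or_complex ^ 'n ^ 'n)"
  by (auto simp: invertible_det_nz)

section \<open>Cartan involutions of \<open>sl(V)\<close> come from inner products\<close>

lemma norm_det_le:
  fixes M :: "'k::real_or_complex ^ 'n ^ 'n"
  assumes "\<And>i j. norm (M $ i $ j) \<le> x"
  shows "norm (det M) \<le> fact CARD('n) * x ^ CARD('n)"
proof -
  have "norm (det M) \<le> (\<Sum>p\<in>{p. p permutes (UNIV :: 'n set)}. norm (of_int (sign p) * (\<Prod>i\<in>UNIV. M $ i $ p i)))"
    unfolding det_def by (rule norm_sum)
  also have "\<dots> \<le> (\<Sum>p\<in>{p. p permutes (UNIV :: 'n set)}. x ^ CARD('n))"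
  proof (rule sum_mono)
    fix p :: "'n \<Rightarrow> 'n"
    have "norm (of_int (sign p) :: 'k) = 1" by (simp add: sign_def)
    then have "norm (of_int (sign p) * (\<Prod>i\<in>UNIV. M $ i $ p i)) = (\<Prod>i\<in>UNIV. norm (M $ i $ p i))"
      by (simp add: norm_mult flip: prod_norm)
    also have "\<dots> \<le> (\<Prod>i\<in>(UNIV :: 'n set). x)" by (intro prod_mono) (auto simp: assms)
    finally show "norm (of_int (sign p) * (\<Prod>i\<in>UNIV. M $ i $ p i)) \<le> x ^ CARD('n)" by simp
  qed
  also have "\<dots> = fact CARD('n) * x ^ CARD('n)" by (simp add: card_permutations[OF refl])
  finally show ?thesis .
qed

lemma norm_matrix_le:
  fixes M :: "'a::real_normed_vector ^ 'n ^ 'm" and x :: real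
  assumes "\<And>i j. norm (M $ i $ j) \<le> x"
  shows "norm M \<le> CARD('m) * (CARD('n) * x)"
proof -
  have "norm (M $ i) \<le> CARD('n) * x" for i
  proof -
    have "norm (M $ i) \<le> (\<Sum>j\<in>UNIV. norm (M $ i $ j))" unfolding norm_vec_def by (rule L2_set_le_sum) simp
    also have "\<dots> \<le> (\<Sum>j\<in>(UNIV::'n set). x)" by (rule sum_mono) (rule assms)
    finally show ?thesis by simp
  qed
  moreover have "norm M \<le> (\<Sum>i\<in>UNIV. norm (M $ i))" unfolding norm_vec_def[of M] by (rule L2_set_le_sum) simp
  ultimately have "norm M \<le> (\<Sum>i\<in>(UNIV::'m set). CARD('n) * x)" by (meson order_trans sum_mono)
  then show ?thesis by simp
qed

text \<open>
  Scalars act trivially on \<open>sl(V)\<close>. The condition on the determinant, which every invertible matrix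
  satisfies after division by a positive number, removes them up to a bounded factor.
\<close>

definition centralizer_grp :: "('k::real_or_complex ^ 'n ^ 'n \<Rightarrow> 'k ^ 'n ^ 'n) \<Rightarrow> ('k ^ 'n ^ 'n) set" where
  "centralizer_grp \<tau> = {A. norm (det A) = 1 \<and> (\<forall>X\<in>sl. cb A (\<tau> X) = \<tau> (cb A X))}"

lemma centralizer_grp_mult:
  assumes "A \<in> centralizer_grp \<tau>" "B \<in> centralizer_grp \<tau>"
  shows "A ** B \<in> centralizer_grp (\<tau> :: 'k::real_or_complex ^ 'n ^ 'n \<Rightarrow> _)"
proof -
  have inv: "invertible A" "invertible B" using assms by (auto simp: centralizer_grp_def norm_det_1_invertible)
  have "cb (A ** B) (\<tau> X) = \<tau> (cb (A ** B) X)" if "X \<in> sl" for X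
    using assms that inv by (simp add: centralizer_grp_def cb_in_sl flip: cb_cb)
  then show ?thesis using assms by (simp add: centralizer_grp_def det_mul norm_mult)
qed

locale cartan =
  fixes \<tau> :: "'k::real_or_complex ^ 'n ^ 'n \<Rightarrow> 'k ^ 'n ^ 'n"
  assumes cartan: "\<tau> \<in> cartan_involutions"
begin

lemma \<tau>_sl: "X \<in> sl \<Longrightarrow> \<tau> X \<in> sl"
  and \<tau>_\<tau>: "X \<in> sl \<Longrightarrow> \<tau> (\<tau> X) = X"
  and \<tau>_add: "X \<in> sl \<Longrightarrow> Y \<in> sl \<Longrightarrow> \<tau> (X + Y) = \<tau> X + \<tau> Y"
  and \<tau>_scaleR: "X \<in> sl \<Longrightarrow> \<tau> (c *\<^sub>R X) = c *\<^sub>R \<tau> X"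
  and \<tau>_lie: "X \<in> sl \<Longrightarrow> Y \<in> sl \<Longrightarrow> \<tau> (lie X Y) = lie (\<tau> X) (\<tau> Y)"
  and \<tau>_pos: "X \<in> sl \<Longrightarrow> X \<noteq> 0 \<Longrightarrow> - killing X (\<tau> X) > 0"
  using cartan by (auto simp: cartan_involutions_def)

lemma sl_closed: "X \<in> sl \<Longrightarrow> Y \<in> sl \<Longrightarrow> X + Y \<in> sl" "X \<in> sl \<Longrightarrow> Y \<in> sl \<Longrightarrow> X - Y \<in> sl"
  "X \<in> sl \<Longrightarrow> c *\<^sub>R X \<in> sl" "X \<in> sl \<Longrightarrow> - X \<in> sl"
  for X Y :: "'k ^ 'n ^ 'n"
  using subspace_sl by (auto intro: subspace_add subspace_diff subspace_scale subspace_neg)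

lemma \<tau>_minus: "X \<in> sl \<Longrightarrow> \<tau> (- X) = - \<tau> X"
  using \<tau>_scaleR[of X "-1"] by simp

lemma \<tau>_diff: "X \<in> sl \<Longrightarrow> Y \<in> sl \<Longrightarrow> \<tau> (X - Y) = \<tau> X - \<tau> Y"
  using \<tau>_add[of X "- Y"] by (simp add: \<tau>_minus sl_closed)

lemma killing_\<tau>: "X \<in> sl \<Longrightarrow> Y \<in> sl \<Longrightarrow> killing (\<tau> X) (\<tau> Y) = killing X Y"
  by (rule killing_automorphism[OF \<tau>_sl \<tau>_\<tau> \<tau>_add \<tau>_scaleR \<tau>_lie])

lemma linear_\<tau>_traceless_part: "linear (\<lambda>X. \<tau> (traceless_part X))"
  by (simp add: linear_iff linear_add[OF linear_traceless_part] linear_cmul[OF linear_traceless_part]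
      \<tau>_add[OF traceless_part_in_sl traceless_part_in_sl] \<tau>_scaleR[OF traceless_part_in_sl])

abbreviation "\<Gamma> \<equiv> centralizer_grp \<tau>"

lemma \<Gamma>_inv: "A \<in> \<Gamma> \<Longrightarrow> matrix_inv A \<in> \<Gamma>"
proof -
  assume A: "A \<in> \<Gamma>"
  then have inv: "invertible A" by (auto simp: centralizer_grp_def norm_det_1_invertible)
  have "cb (matrix_inv A) (\<tau> X) = \<tau> (cb (matrix_inv A) X)" if X: "X \<in> sl" for X
  proof -
    define Y where "Y = cb (matrix_inv A) X"
    have Y: "Y \<in> sl" "X = cb A Y" using X inv by (auto simp: Y_def cb_in_sl invertible_matrix_inv)
    then have "\<tau> X = cb A (\<tau> Y)" using A by (simp add: centralizer_grp_def)
    then show ?thesis using inv by (simp add: Y_def)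
  qed
  moreover have "norm (det A) * norm (det (matrix_inv A)) = 1"
    using inverse_pair_det[OF matrix_inv_right[OF inv]] by (metis norm_mult norm_one)
  ultimately show ?thesis using A by (simp add: centralizer_grp_def)
qed

lemma \<Gamma>_mat_1: "mat 1 \<in> \<Gamma>"
  by (simp add: centralizer_grp_def)

text \<open>
  Conjugation by elements of \<open>\<Gamma>\<close> commutes with \<open>\<tau>\<close> and preserves the trace, hence the quadratic form
  \<open>- B(X, \<tau> X)\<close>; the latter is positive definite, so it is comparable with the square of the norm.
\<close>

lemma \<Gamma>_conj_bounded: "\<exists>C. \<forall>A\<in>\<Gamma>. \<forall>X\<in>sl. norm (cb A X) \<le> C * norm X"
proof -
  define q where "q X = - killing X (\<tau> X)" for X
  define \<kappa> where "\<kappa> = 2 * real CARD('n) * real DIM('k)"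
  have q: "q X = - \<kappa> * repart (trace (X ** \<tau> (traceless_part X)))" if "X \<in> sl" for X
    unfolding q_def killing_eq_trace[OF that] by (simp add: \<kappa>_def traceless_part_sl that)
  have ltr: "linear (\<lambda>X :: 'k ^ 'n ^ 'n. repart (trace X))"
    by (simp add: linear_iff trace_add trace_scaleR)
  have cont: "continuous_on S q" if "S \<subseteq> sl" for S
  proof -
    have "continuous_on UNIV (\<lambda>X. X ** \<tau> (traceless_part X))"
      by (intro bounded_bilinear.continuous_on[OF bounded_bilinear_matrix_mult] continuous_on_id
          linear_continuous_on linear_\<tau>_traceless_part linear_linear[THEN iffD2] linear_conv_bounded_linear[THEN iffD1])
    then have "continuous_on UNIV (\<lambda>X. repart (trace (X ** \<tau> (traceless_part X))))"
      by (rule linear_continuous_on_compose[OF _ ltr])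
    then have "continuous_on UNIV (\<lambda>X. - \<kappa> * repart (trace (X ** \<tau> (traceless_part X))))"
      by (intro continuous_intros)
    then have "continuous_on S (\<lambda>X. - \<kappa> * repart (trace (X ** \<tau> (traceless_part X))))"
      by (rule continuous_on_subset) simp
    then show ?thesis by (rule continuous_on_eq) (use that q in auto)
  qed
  have scale: "q (r *\<^sub>R X) = r\<^sup>2 * q X" if "X \<in> sl" for r X
    using that by (simp add: q_def killing_eq_trace sl_closed \<tau>_scaleR scaleR_left_mult scaleR_right_mult
        trace_scaleR power2_eq_square)
  define S :: "('k ^ 'n ^ 'n) set" where "S = sl \<inter> sphere 0 1"
  have "compact S" unfolding S_def by (intro closed_Int_compact closed_subspace subspace_sl compact_sphere)
  have "\<exists>m M. 0 < m \<and> (\<forall>X\<in>S. m \<le> q X \<and> q X \<le> M)"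
  proof (cases "S = {}")
    case False
    have "S \<subseteq> sl" by (auto simp: S_def)
    note c = cont[OF this]
    obtain Y where Y: "Y \<in> S" "\<And>X. X \<in> S \<Longrightarrow> q Y \<le> q X"
      using continuous_attains_inf[OF \<open>compact S\<close> False c] by blast
    obtain Z where Z: "Z \<in> S" "\<And>X. X \<in> S \<Longrightarrow> q X \<le> q Z"
      using continuous_attains_sup[OF \<open>compact S\<close> False c] by blast
    have "Y \<in> sl" "Y \<noteq> 0" using Y(1) by (auto simp: S_def)
    then have "q Y > 0" unfolding q_def by (rule \<tau>_pos)
    then show ?thesis using Y Z by blast
  qed (auto intro: exI[of _ 1])
  then obtain m M where m: "0 < m" "\<And>X. X \<in> S \<Longrightarrow> m \<le> q X" "\<And>X. X \<in> S \<Longrightarrow> q X \<le> M" by blast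
  have le: "m * (norm X)\<^sup>2 \<le> q X \<and> q X \<le> M * (norm X)\<^sup>2" if X: "X \<in> sl" for X
  proof (cases "X = 0")
    case True
    then show ?thesis using scale[of X 0] X by simp
  next
    case False
    define Y where "Y = (1 / norm X) *\<^sub>R X"
    have "Y \<in> S" using X False by (simp add: S_def Y_def sl_closed)
    moreover have "q X = (norm X)\<^sup>2 * q Y"
      unfolding Y_def scale[OF X] using False by (simp add: field_simps)
    ultimately show ?thesis using m(2,3)[of Y] by (auto simp: mult.commute[of "(norm X)\<^sup>2"] intro!: mult_right_mono)
  qed
  have "norm (cb A X) \<le> sqrt (M / m) * norm X" if A: "A \<in> \<Gamma>" and X: "X \<in> sl" for A X
  proof -
    have inv: "invertible A" using A by (auto simp: centralizer_grp_def norm_det_1_invertible)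
    have sl: "cb A X \<in> sl" using X by (simp add: cb_in_sl inv)
    have "\<tau> (cb A X) = cb A (\<tau> X)" using A X by (simp add: centralizer_grp_def)
    then have "q (cb A X) = q X"
      unfolding q_def killing_eq_trace[OF sl] killing_eq_trace[OF X] by (simp add: inv flip: cb_mult)
    then have "m * (norm (cb A X))\<^sup>2 \<le> M * (norm X)\<^sup>2" using le[OF sl] le[OF X] by simp
    then have "(norm (cb A X))\<^sup>2 \<le> M / m * (norm X)\<^sup>2" using m(1) by (simp add: field_simps)
    then have "norm (cb A X) \<le> sqrt (M / m * (norm X)\<^sup>2)" by (rule real_le_rsqrt)
    then show ?thesis unfolding real_sqrt_mult by simp
  qed
  then show ?thesis by blast
qed

text \<open>
  Conjugating matrix units shows that the products of an entry of \<open>A\<close> with an entry of \<open>A\<^sup>-\<^sup>1\<close> are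
  bounded, and the determinant bounds some entry of \<open>A\<^sup>-\<^sup>1\<close> from below.
\<close>

lemma \<Gamma>_bounded: "\<exists>C>0. \<forall>A\<in>\<Gamma>. norm A \<le> C"
proof -
  obtain C where C: "\<And>A X. A \<in> \<Gamma> \<Longrightarrow> X \<in> sl \<Longrightarrow> norm (cb A X) \<le> C * norm X"
    using \<Gamma>_conj_bounded by blast
  define E :: "'n \<Rightarrow> 'n \<Rightarrow> 'k ^ 'n ^ 'n" where "E j k = axis j (axis k 1)" for j k
  define b where "b j k = C * norm (traceless_part (E j k)) + norm (E j k - traceless_part (E j k))" for j k
  define B where "B = Max (range (\<lambda>(j, k). b j k))"
  have bB: "b j k \<le> B" for j k
    unfolding B_def by (intro Max_ge) (auto intro: image_eqI[of _ _ "(j, k)"])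
  have prod: "norm (A $ i $ j) * norm (matrix_inv A $ k $ l) \<le> B" if A: "A \<in> \<Gamma>" for A i j k l
  proof -
    have inv: "invertible A" using A by (auto simp: centralizer_grp_def norm_det_1_invertible)
    have E: "(A ** E j k) $ a $ c = (if c = k then A $ a $ j else 0)" for a c
    proof -
      have "(A ** E j k) $ a $ c = (\<Sum>x\<in>UNIV. if x = j then if c = k then A $ a $ j else 0 else 0)"
        unfolding matrix_matrix_mult_def vec_lambda_beta by (intro sum.cong refl) (simp add: E_def axis_def)
      then show ?thesis by simp
    qed
    have "cb A (E j k) $ i $ l = (\<Sum>x\<in>UNIV. (A ** E j k) $ i $ x * matrix_inv A $ x $ l)"
      by (simp add: cb_def matrix_matrix_mult_def)
    also have "\<dots> = (\<Sum>x\<in>UNIV. if x = k then A $ i $ j * matrix_inv A $ k $ l else 0)"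
      by (intro sum.cong refl) (simp add: E)
    finally have "norm (A $ i $ j) * norm (matrix_inv A $ k $ l) = norm (cb A (E j k) $ i $ l)"
      by (simp add: norm_mult)
    also have "\<dots> \<le> norm (cb A (E j k) $ i)" by (rule Finite_Cartesian_Product.norm_nth_le)
    also have "\<dots> \<le> norm (cb A (E j k))" by (rule Finite_Cartesian_Product.norm_nth_le)
    also have "cb A (E j k) = cb A (traceless_part (E j k)) + cb A (E j k - traceless_part (E j k))"
      by (simp flip: cb_simps)
    also have "cb A (E j k - traceless_part (E j k)) = E j k - traceless_part (E j k)"
      by (simp add: traceless_part_def inv)
    also have "norm (cb A (traceless_part (E j k)) + (E j k - traceless_part (E j k))) \<le> b j k"
      unfolding b_def using C[OF A traceless_part_in_sl] by (meson add_right_mono norm_triangle_ineq order_trans)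
    also have "\<dots> \<le> B" by (rule bB)
    finally show ?thesis .
  qed
  \<comment> \<open>if all entries of \<open>A\<^sup>-\<^sup>1\<close> were at most \<open>\<delta>\<close>, its determinant would be at most \<open>1/2\<close>\<close>
  define \<delta> :: real where "\<delta> = 1 / (2 * fact CARD('n))"
  have "(1::real) \<le> fact CARD('n)" by (rule fact_ge_1)
  then have "(1::real) \<le> 2 * fact CARD('n)" by linarith
  then have \<delta>: "\<delta> > 0" "\<delta> \<le> 1" by (simp_all add: \<delta>_def divide_le_eq)
  have entry: "\<exists>k l. norm (matrix_inv A $ k $ l) > \<delta>" if A: "A \<in> \<Gamma>" for A
  proof (rule ccontr)
    assume "\<not> ?thesis"
    then have "norm (matrix_inv A $ k $ l) \<le> \<delta>" for k l by (meson not_less)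
    then have "norm (det (matrix_inv A)) \<le> fact CARD('n) * \<delta> ^ CARD('n)" by (rule norm_det_le)
    also have "\<dots> \<le> fact CARD('n) * \<delta> ^ 1"
      using \<delta> by (intro mult_left_mono power_decreasing) (auto simp: Suc_leI)
    also have "\<dots> = 1 / 2" by (simp add: \<delta>_def)
    finally show False using \<Gamma>_inv[OF A] by (simp add: centralizer_grp_def)
  qed
  have "norm A \<le> CARD('n) * (CARD('n) * (\<bar>B\<bar> / \<delta>))" if A: "A \<in> \<Gamma>" for A
  proof (rule norm_matrix_le)
    fix i j
    obtain k l where kl: "norm (matrix_inv A $ k $ l) > \<delta>" using entry[OF A] by blast
    have "norm (A $ i $ j) * \<delta> \<le> norm (A $ i $ j) * norm (matrix_inv A $ k $ l)"
      using kl by (intro mult_left_mono) auto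
    also have "\<dots> \<le> \<bar>B\<bar>" using prod[OF A, of i j k l] by simp
    finally show "norm (A $ i $ j) \<le> \<bar>B\<bar> / \<delta>" using \<delta> by (simp add: field_simps)
  qed
  then have "\<forall>A\<in>\<Gamma>. norm A \<le> max 1 (CARD('n) * (CARD('n) * (\<bar>B\<bar> / \<delta>)))" by (meson max.coboundedI2)
  then show ?thesis by (intro exI[of _ "max 1 (CARD('n) * (CARD('n) * (\<bar>B\<bar> / \<delta>)))"]) simp
qed

text \<open>
  The group \<open>\<Gamma>\<close> acts on Hermitian matrices by pulling back the corresponding forms. The forms whose
  whole orbit is bounded below by \<open>\<epsilon> \<parallel>v\<parallel>\<^sup>2\<close> are a closed convex invariant set, to which the fixed point
  theorem applies; the lower bound makes the fixed form positive definite.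
\<close>

lemma \<Gamma>_invariant_form:
  obtains H where "ct H = H" "\<And>v. v \<noteq> 0 \<Longrightarrow> repart (hprod (H *v v) v) > 0"
    "\<And>A. A \<in> \<Gamma> \<Longrightarrow> ct A ** H ** A = H"
proof -
  obtain C where C: "C > 0" "\<And>A. A \<in> \<Gamma> \<Longrightarrow> norm A \<le> C" using \<Gamma>_bounded by blast
  obtain K where K: "K > 0" "\<And>(A :: 'k ^ 'n ^ 'n) (B :: 'k ^ 'n ^ 'n). norm (A ** B) \<le> norm A * norm B * K"
    using bounded_bilinear.pos_bounded[OF bounded_bilinear_matrix_mult[where 'k = 'k and 'n = 'n]] by blast
  obtain L where L: "L > 0" "\<And>(A :: 'k ^ 'n ^ 'n) x. norm (A *v x) \<le> norm A * norm x * L"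
    using bounded_bilinear.pos_bounded[OF bounded_bilinear_matrix_vector_mult[where 'k = 'k and 'n = 'n]] by blast
  obtain c where c: "c > 0" "\<And>A :: 'k ^ 'n ^ 'n. norm (ct A) \<le> c * norm A"
    using linear_bounded_pos[OF linear_ct[where 'k = 'k and 'n = 'n]] by blast
  \<comment> \<open>small enough for the standard inner product to satisfy the lower bound, as \<open>v = A\<^sup>-\<^sup>1 (A v)\<close>\<close>
  define \<epsilon> where "\<epsilon> = 1 / (C * L)\<^sup>2"
  define act where "act A H = ct A ** H ** A" for A H :: "'k ^ 'n ^ 'n"
  have act_act: "act A (act B H) = act (B ** A) H" for A B H
    by (simp add: act_def ct_mult matrix_mul_assoc)
  define D where "D = {H. ct H = H} \<inter> (\<Inter>A\<in>\<Gamma>. \<Inter>v. {H. \<epsilon> * (norm v)\<^sup>2 \<le> repart (hprod (act A H *v v) v)})"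
  have lin: "linear (\<lambda>H. repart (hprod (act A H *v v) v))" for A v
    by (simp add: linear_iff act_def matrix_add_ldistrib matrix_add_rdistrib matrix_vector_mult_add_rdistrib
        scaleR_left_mult scaleR_right_mult) (simp add: scaleR_eq_mat mat_vec_mult)
  have "\<exists>H\<in>D. \<forall>g\<in>act ` \<Gamma>. g H = H"
  proof (rule bounded_linear_group_fixed_point)
    show "linear g" if g: "g \<in> act ` \<Gamma>" for g
    proof -
      obtain A where "g = act A" using g by blast
      moreover have "act A = (\<lambda>H. ct A ** H ** A)" by (simp add: act_def fun_eq_iff)
      ultimately show ?thesis by (simp add: linear_matrix_mult)
    qed
    show "id \<in> act ` \<Gamma>"
      using \<Gamma>_mat_1 by (intro image_eqI[of _ _ "mat 1"]) (auto simp: act_def fun_eq_iff)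
    show "g \<circ> h \<in> act ` \<Gamma>" if gh: "g \<in> act ` \<Gamma>" "h \<in> act ` \<Gamma>" for g h
    proof -
      obtain A B where "g = act A" "h = act B" "A \<in> \<Gamma>" "B \<in> \<Gamma>" using gh by blast
      then show ?thesis
        by (intro image_eqI[of _ _ "B ** A"] centralizer_grp_mult) (auto simp: act_act fun_eq_iff)
    qed
    show "\<exists>h\<in>act ` \<Gamma>. h \<circ> g = id" if g: "g \<in> act ` \<Gamma>" for g
    proof -
      obtain A where A: "g = act A" "A \<in> \<Gamma>" using g by blast
      then have "invertible A" by (auto simp: centralizer_grp_def norm_det_1_invertible)
      then have "act (matrix_inv A) \<circ> g = id"
        by (simp add: A act_act fun_eq_iff matrix_inv_right) (simp add: act_def)
      then show ?thesis using \<Gamma>_inv[OF A(2)] by blast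
    qed
    show "norm (g H) \<le> (c * C * K * C * K) * norm H" if g: "g \<in> act ` \<Gamma>" for g H
    proof -
      obtain A where A: "g = act A" "A \<in> \<Gamma>" using g by blast
      have nA: "norm A \<le> C" by (rule C(2)[OF A(2)])
      have "norm (ct A ** H) \<le> norm (ct A) * norm H * K" by (rule K(2))
      also have "\<dots> \<le> (c * C) * norm H * K"
        using c(2)[of A] nA c(1) K(1) by (intro mult_right_mono) (auto intro: order_trans mult_left_mono)
      finally have 1: "norm (ct A ** H) \<le> c * C * norm H * K" .
      have "norm (g H) \<le> norm (ct A ** H) * norm A * K" unfolding A(1) act_def by (rule K(2))
      also have "\<dots> \<le> (c * C * norm H * K) * C * K"
        using 1 nA C(1) K(1) c(1) by (intro mult_right_mono mult_mono) auto
      finally show ?thesis by (simp add: mult_ac)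
    qed
    show "closed D"
    proof -
      have "closed {H :: 'k ^ 'n ^ 'n. ct H = H}"
        by (intro closed_Collect_eq linear_continuous_on continuous_on_id
            linear_conv_bounded_linear[THEN iffD1] linear_ct)
      moreover have "closed {H. \<epsilon> * (norm v)\<^sup>2 \<le> repart (hprod (act A H *v v) v)}" for A v
        by (intro closed_Collect_le continuous_on_const linear_continuous_on
            linear_conv_bounded_linear[THEN iffD1] lin)
      ultimately show ?thesis unfolding D_def by blast
    qed
    show "convex D"
    proof -
      have "convex {H :: 'k ^ 'n ^ 'n. ct H = H}" by (auto simp: convex_def)
      moreover have "convex {H. \<epsilon> * (norm v)\<^sup>2 \<le> repart (hprod (act A H *v v) v)}" for A v
      proof -
        have "convex ((\<lambda>H. repart (hprod (act A H *v v) v)) -` {\<epsilon> * (norm v)\<^sup>2..})"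
          by (intro convex_linear_vimage lin) simp
        then show ?thesis by (simp add: vimage_def)
      qed
      ultimately show ?thesis unfolding D_def by (intro convex_Int convex_INT) auto
    qed
    show "D \<noteq> {}"
    proof -
      have "\<epsilon> * (norm v)\<^sup>2 \<le> repart (hprod (act A (mat 1) *v v) v)" if A: "A \<in> \<Gamma>" for A v
      proof -
        have inv: "invertible A" using A by (auto simp: centralizer_grp_def norm_det_1_invertible)
        have "v = matrix_inv A *v (A *v v)" by (simp add: matrix_vector_mul_assoc matrix_inv_left[OF inv])
        then have "norm v \<le> norm (matrix_inv A) * norm (A *v v) * L" by (metis L(2))
        also have "\<dots> \<le> C * norm (A *v v) * L"
          using C(2)[OF \<Gamma>_inv[OF A]] L(1) by (intro mult_right_mono) auto
        finally have "(norm v)\<^sup>2 \<le> (C * L * norm (A *v v))\<^sup>2"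
          by (intro power_mono) (auto simp: mult_ac)
        then have "\<epsilon> * (norm v)\<^sup>2 \<le> (norm (A *v v))\<^sup>2"
          using C(1) L(1) by (simp add: \<epsilon>_def field_simps power_mult_distrib)
        also have "\<dots> = repart (hprod (act A (mat 1) *v v) v)"
        proof -
          have "hprod (act A (mat 1) *v v) v = hprod (ct A *v (A *v v)) v"
            by (simp add: act_def matrix_vector_mul_assoc)
          also have "\<dots> = hprod (A *v v) (A *v v)" by (simp add: hprod_ct)
          finally show ?thesis by (simp add: hprod_self del: of_real_power)
        qed
        finally show ?thesis .
      qed
      then have "mat 1 \<in> D" by (simp add: D_def)
      then show ?thesis by blast
    qed
    show "g H \<in> D" if g: "g \<in> act ` \<Gamma>" and H: "H \<in> D" for g H
    proof -
      obtain B where B: "g = act B" "B \<in> \<Gamma>" using g by blast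
      have "ct (act B H) = act B H" using H by (simp add: D_def act_def ct_mult matrix_mul_assoc)
      moreover have "\<epsilon> * (norm v)\<^sup>2 \<le> repart (hprod (act A (act B H) *v v) v)" if "A \<in> \<Gamma>" for A v
        using H centralizer_grp_mult[OF B(2) that] unfolding act_act D_def by blast
      ultimately show ?thesis by (simp add: D_def B(1))
    qed
  qed
  then obtain H where H: "H \<in> D" "\<And>A. A \<in> \<Gamma> \<Longrightarrow> act A H = H" by blast
  have "repart (hprod (H *v v) v) > 0" if "v \<noteq> 0" for v
  proof -
    have "0 < \<epsilon> * (norm v)\<^sup>2" using that C(1) L(1) by (simp add: \<epsilon>_def)
    also have "\<dots> \<le> repart (hprod (act (mat 1) H *v v) v)" using H(1) \<Gamma>_mat_1 unfolding D_def by blast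
    finally show ?thesis by (simp add: act_def)
  qed
  then show ?thesis using that[of H] H by (simp add: D_def act_def)
qed

text \<open>
  As \<open>\<tau> X = X\<close>, both sides are solutions of \<open>Z' = [X, Z]\<close> with the same initial value: conjugating the
  right hand side back by \<open>exp(t X)\<close> gives a curve with derivative 0.
\<close>

lemma exp_commutes_with_\<tau>:
  assumes X: "X \<in> sl" "\<tau> X = X" and Y: "Y \<in> sl"
  shows "cb (matrix_exp (t *\<^sub>R X)) (\<tau> Y) = \<tau> (cb (matrix_exp (t *\<^sub>R X)) Y)"
proof -
  define E where "E t = matrix_exp (t *\<^sub>R X)" for t :: real
  define T where "T Z = \<tau> (traceless_part Z)" for Z
  have EE: "E t ** E (- t) = mat 1" for t unfolding E_def by (rule matrix_exp_minus)
  have EE': "E (- t) ** E t = mat 1" for t using EE[of "- t"] by simp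
  have invE: "invertible (E t)" "matrix_inv (E t) = E (- t)" for t
    using EE EE' matrix_inv_eqI by (auto simp: invertible_def)
  have cbE: "cb (E t) Z = E t ** Z ** E (- t)" for t Z by (simp add: cb_def invE)
  have dE: "(E has_vector_derivative X ** E t) (at t)" for t
    unfolding E_def[abs_def] by (rule has_vector_derivative_matrix_exp)
  have dE': "((\<lambda>t. E (- t)) has_vector_derivative - (X ** E (- t))) (at t)" for t
    using has_vector_derivative_matrix_exp[of "- X" t] by (simp add: E_def matrix_minus_left)
  have com: "X ** E t = E t ** X" for t unfolding E_def by (rule matrix_exp_commute)
  note mult = bounded_bilinear.has_vector_derivative[OF bounded_bilinear_matrix_mult]
  have TX: "T (X ** Z - Z ** X) = X ** T Z - T Z ** X" for Z
  proof -
    have "T (lie X Z) = \<tau> (lie X (traceless_part Z))" by (simp add: T_def traceless_part_sl lie_in_sl lie_traceless_part)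
    also have "\<dots> = lie X (T Z)" by (simp add: \<tau>_lie X traceless_part_in_sl T_def)
    finally show ?thesis by (simp add: lie_def)
  qed
  have "bounded_linear T"
    unfolding T_def[abs_def] using linear_\<tau>_traceless_part linear_conv_bounded_linear by blast
  have "((\<lambda>t. E (- t) ** T (E t ** Y ** E (- t)) ** E t) has_vector_derivative 0) (at t within UNIV)" for t
  proof -
    define Z where "Z = E t ** Y ** E (- t)"
    have dZ: "((\<lambda>t. E t ** Y ** E (- t)) has_vector_derivative X ** Z - Z ** X) (at t)"
    proof -
      have "((\<lambda>t. E t ** Y) has_vector_derivative (X ** E t) ** Y) (at t)"
        by (rule bounded_linear.has_vector_derivative[OF bounded_bilinear.bounded_linear_left[OF bounded_bilinear_matrix_mult] dE])
      from mult[OF this dE']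
      have "((\<lambda>t. E t ** Y ** E (- t)) has_vector_derivative
        E t ** Y ** - (X ** E (- t)) + (X ** E t) ** Y ** E (- t)) (at t)" .
      moreover have "E t ** Y ** - (X ** E (- t)) + (X ** E t) ** Y ** E (- t) = X ** Z - Z ** X"
        unfolding Z_def com[of "- t"] by (simp add: matrix_minus_right matrix_mul_assoc)
      ultimately show ?thesis by simp
    qed
    have dT: "((\<lambda>t. T (E t ** Y ** E (- t))) has_vector_derivative X ** T Z - T Z ** X) (at t)"
      using bounded_linear.has_vector_derivative[OF \<open>bounded_linear T\<close> dZ] by (simp add: TX)
    have "((\<lambda>t. E (- t) ** T (E t ** Y ** E (- t)) ** E t) has_vector_derivative
      (E (- t) ** T Z) ** (X ** E t) + (E (- t) ** (X ** T Z - T Z ** X) + - (X ** E (- t)) ** T Z) ** E t) (at t)"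
      unfolding Z_def by (rule mult[OF mult[OF dE' dT[unfolded Z_def]] dE])
    moreover have "(E (- t) ** T Z) ** (X ** E t) + (E (- t) ** (X ** T Z - T Z ** X) + - (X ** E (- t)) ** T Z) ** E t = 0"
      unfolding com[of "- t"]
      by (simp add: matrix_add_rdistrib matrix_sub_ldistrib matrix_sub_rdistrib matrix_minus_left matrix_mul_assoc)
    ultimately show ?thesis by simp
  qed
  then obtain c where c: "\<And>t. t \<in> UNIV \<Longrightarrow> E (- t) ** T (E t ** Y ** E (- t)) ** E t = c"
    using has_vector_derivative_zero_constant[OF convex_UNIV] by blast
  have E0: "E 0 = mat 1" by (simp add: E_def matrix_exp_0)
  have "E (- t) ** T (E t ** Y ** E (- t)) ** E t = \<tau> Y"
    using c[of t] c[of 0] by (simp add: E0 T_def traceless_part_sl Y)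
  then have "cb (E t) (\<tau> Y) = (E t ** E (- t)) ** T (E t ** Y ** E (- t)) ** (E t ** E (- t))"
    unfolding cbE by (metis matrix_mul_assoc)
  also have "\<dots> = T (E t ** Y ** E (- t))" by (simp add: EE)
  also have "\<dots> = \<tau> (cb (E t) Y)"
    using Y by (simp add: T_def cb_in_sl invE traceless_part_sl flip: cbE)
  finally show ?thesis by (simp add: E_def)
qed

text \<open>
  Up to positive factors, \<open>exp(t X)\<close> lies in \<open>\<Gamma>\<close>, so the invariant form only changes by a factor \<open>\<mu> t\<close> along
  this curve. Differentiating at 0 gives the claim.
\<close>

lemma fixed_points_skew:
  assumes H: "ct H = H" "\<And>v. v \<noteq> 0 \<Longrightarrow> repart (hprod (H *v v) v) > 0"
      "\<And>A. A \<in> \<Gamma> \<Longrightarrow> ct A ** H ** A = H"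
    and X: "X \<in> sl" "\<tau> X = X"
  shows "\<exists>r::real. ct X ** H + H ** X = r *\<^sub>R H"
proof -
  define E where "E t = matrix_exp (t *\<^sub>R X)" for t :: real
  define W where "W t = ct (E t) ** H ** E t" for t
  have invE: "invertible (E t)" for t
    using matrix_exp_minus[of t X] by (metis E_def invertible_right_inverse)
  have "\<exists>\<mu>::real. W t = \<mu> *\<^sub>R H" for t
  proof -
    define a where "a = norm (det (E t))"
    have a: "a > 0" using invE[of t] by (simp add: a_def invertible_det_nz)
    define s where "s = a powr (- 1 / CARD('n))"
    have s: "s > 0" using a by (simp add: s_def)
    have "s ^ CARD('n) = s powr CARD('n)" using s by (simp add: powr_realpow)
    also have "\<dots> = inverse a" unfolding s_def powr_powr using a by (simp add: powr_minus)
    finally have sa: "s ^ CARD('n) * a = 1" using a by simp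
    define A where "A = s *\<^sub>R E t"
    have A: "A = mat (of_real s) ** E t" by (simp add: A_def scaleR_eq_mat)
    have "norm (det A) = 1"
      unfolding A det_mul det_mat norm_mult norm_power using s sa by (simp add: a_def)
    moreover have cbA: "cb A Z = cb (E t) Z" for Z
      unfolding A cb_def using conj_mat_mult[OF invE, of "of_real s"] s by simp
    ultimately have "A \<in> \<Gamma>"
      using exp_commutes_with_\<tau>[OF X] by (simp add: centralizer_grp_def E_def)
    from H(3)[OF this] have "(s * s) *\<^sub>R W t = H" by (simp add: A_def W_def scaleR_left_mult scaleR_right_mult)
    note e = this
    have "W t = (1 / (s * s)) *\<^sub>R ((s * s) *\<^sub>R W t)" using s by simp
    also have "\<dots> = (1 / (s * s)) *\<^sub>R H" by (simp only: e)
    finally have "W t = (1 / (s * s)) *\<^sub>R H" .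
    then show ?thesis by blast
  qed
  then obtain \<mu> where \<mu>: "\<And>t. W t = \<mu> t *\<^sub>R H" by metis
  obtain v0 :: "'k ^ 'n" where v0: "v0 \<noteq> 0" by (metis axis_eq_0_iff zero_neq_one)
  define \<phi> where "\<phi> M = repart (hprod (M *v v0) v0)" for M
  \<comment> \<open>\<open>\<Lambda>\<close> vanishes on the multiples of \<open>H\<close>, so \<open>\<mu>\<close> need not be differentiated\<close>
  define \<Lambda> where "\<Lambda> M = \<phi> H *\<^sub>R M - \<phi> M *\<^sub>R H" for M
  have \<phi>: "\<phi> (M + N) = \<phi> M + \<phi> N" "\<phi> (r *\<^sub>R M) = r * \<phi> M" for M N r
    by (simp_all add: \<phi>_def matrix_vector_mult_add_rdistrib) (simp add: scaleR_eq_mat mat_vec_mult)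
  have "linear \<Lambda>" by (simp add: linear_iff \<Lambda>_def \<phi> algebra_simps)
  then have bl: "bounded_linear \<Lambda>" using linear_conv_bounded_linear by blast
  have dE: "(E has_vector_derivative X ** E 0) (at 0)"
    unfolding E_def[abs_def] by (rule has_vector_derivative_matrix_exp)
  have E0: "E 0 = mat 1" by (simp add: E_def matrix_exp_0)
  note mult = bounded_bilinear.has_vector_derivative[OF bounded_bilinear_matrix_mult]
  have "((\<lambda>t. ct (E t)) has_vector_derivative ct (X ** E 0)) (at 0)"
    by (rule bounded_linear.has_vector_derivative[OF _ dE]) (use linear_ct linear_conv_bounded_linear in blast)
  then have "((\<lambda>t. ct (E t) ** H) has_vector_derivative ct (X ** E 0) ** H) (at 0)"
    by (rule bounded_linear.has_vector_derivative[OF bounded_bilinear.bounded_linear_left[OF bounded_bilinear_matrix_mult]])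
  from mult[OF this dE] have "(W has_vector_derivative ct X ** H + H ** X) (at 0)"
    unfolding W_def[abs_def] by (simp add: E0 add.commute)
  then have "((\<lambda>t. \<Lambda> (W t)) has_vector_derivative \<Lambda> (ct X ** H + H ** X)) (at 0)"
    by (rule bounded_linear.has_vector_derivative[OF bl])
  moreover have "\<Lambda> (W t) = 0" for t by (simp add: \<mu> \<Lambda>_def \<phi>)
  ultimately have "((\<lambda>t::real. 0) has_vector_derivative \<Lambda> (ct X ** H + H ** X)) (at 0)" by simp
  then have "\<Lambda> (ct X ** H + H ** X) = 0"
    using vector_derivative_unique_at has_vector_derivative_const by blast
  moreover have "\<phi> H > 0" unfolding \<phi>_def by (rule H(2)[OF v0])
  moreover have "M = (\<phi> M / \<phi> H) *\<^sub>R H" if "\<Lambda> M = 0" "\<phi> H > 0" for M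
  proof -
    have "\<phi> H *\<^sub>R M = \<phi> M *\<^sub>R H" using that by (simp add: \<Lambda>_def)
    then have "(1 / \<phi> H) *\<^sub>R (\<phi> H *\<^sub>R M) = (1 / \<phi> H) *\<^sub>R (\<phi> M *\<^sub>R H)" by (rule arg_cong)
    then show ?thesis using that(2) by simp
  qed
  ultimately have "ct X ** H + H ** X = (\<phi> (ct X ** H + H ** X) / \<phi> H) *\<^sub>R H" by blast
  then show ?thesis by blast
qed

text \<open>
  Hence the fixed algebra \<open>\<kk>\<close> of \<open>\<tau>\<close> consists of skew elements for the invariant inner product. Its
  Killing orthogonal \<open>\<pp>\<close> then contains all self-adjoint elements, and no nonzero skew element because
  the Killing form is positive on \<open>\<pp>\<close>: \<open>\<tau>\<close> is minus the adjoint.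
\<close>

lemma standard_form:
  obtains P where "invertible P" "\<And>X. X \<in> sl \<Longrightarrow> \<tau> X = - cb P (ct (cb (matrix_inv P) X))"
proof -
  obtain H where H: "ct H = H" "\<And>v. v \<noteq> 0 \<Longrightarrow> repart (hprod (H *v v) v) > 0"
    "\<And>A. A \<in> \<Gamma> \<Longrightarrow> ct A ** H ** A = H"
    using \<Gamma>_invariant_form by blast
  define h where "h u v = hprod (H *v u) v" for u v
  have sym: "h v u = kcnj (h u v)" for u v
    unfolding h_def using hprod_commute[of "H *v v" u] by (simp add: hprod_ct H(1))
  have "hermitian_form h"
    unfolding hermitian_form_def
  proof (intro conjI allI)
    show "h v u = kcnj (h u v)" for u v by (rule sym)
  qed (simp_all add: h_def matrix_vector_right_distrib matrix_vec_smult)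
  moreover have "repart (h v v) > 0" if "v \<noteq> 0" for v using H(2)[OF that] by (simp add: h_def)
  ultimately obtain P :: "'k ^ 'n ^ 'n" where P: "invertible P" "\<And>u v. h (P *v u) (P *v v) = hprod u v"
    by (rule positive_definite_orthonormal_basis) blast+
  have PHP: "ct P ** H ** P = mat 1"
  proof -
    have "hprod u ((ct P ** H ** P) *v v) = hprod u (mat 1 *v v)" for u v
    proof -
      have "hprod u ((ct P ** H ** P) *v v) = hprod (P *v u) (H *v (P *v v))"
        by (simp add: hprod_ct matrix_vector_mul_assoc matrix_mul_assoc)
      also have "\<dots> = h (P *v u) (P *v v)" by (simp add: h_def hprod_ct H(1))
      also have "\<dots> = hprod u v" by (rule P(2))
      finally show ?thesis by simp
    qed
    then show ?thesis unfolding matrix_eq using hprod_eq_iff by blast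
  qed
  define inP where "inP X = cb (matrix_inv P) X" for X
  have inP: "inP X = matrix_inv P ** X ** P" "cb P (inP X) = X" "inP (cb P X) = X"
    "inP (X + Y) = inP X + inP Y" "inP (X - Y) = inP X - inP Y" "inP (r *\<^sub>R X) = r *\<^sub>R inP X"
    "trace (inP X) = trace X" "inP (X ** Y) = inP X ** inP Y" "inP (- X) = - inP X" "inP X \<in> sl \<longleftrightarrow> X \<in> sl" for X Y r
    using P(1) by (auto simp: inP_def cb_simps cb_mult invertible_matrix_inv cb_in_sl) (simp add: cb_def)
  have skew: "ct (inP X) = - inP X" if X: "X \<in> sl" "\<tau> X = X" for X
  proof -
    obtain r where r: "ct X ** H + H ** X = r *\<^sub>R H" using fixed_points_skew[OF H X] by blast
    have XP: "X ** P = P ** inP X"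
      by (simp add: inP(1) matrix_mul_assoc matrix_inv_right[OF P(1)])
    have "ct P ** (ct X ** H + H ** X) ** P = ct (X ** P) ** H ** P + ct P ** H ** (X ** P)"
      by (simp add: matrix_add_ldistrib matrix_add_rdistrib ct_mult matrix_mul_assoc)
    also have "\<dots> = ct (inP X) ** (ct P ** H ** P) + (ct P ** H ** P) ** inP X"
      unfolding XP by (simp add: ct_mult matrix_mul_assoc)
    also have "\<dots> = ct (inP X) + inP X" by (simp add: PHP)
    finally have *: "ct (inP X) + inP X = r *\<^sub>R mat 1"
      unfolding r by (simp add: scaleR_left_mult scaleR_right_mult PHP)
    have "trace (ct (inP X) + inP X) = 0" using X(1) by (simp add: trace_add inP(7) sl_def)
    then have "r = 0" unfolding * by (simp add: trace_scaleR trace_mat)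
    then show ?thesis using * by (simp add: eq_neg_iff_add_eq_0)
  qed
  define \<kappa> where "\<kappa> = 2 * real CARD('n) * real DIM('k)"
  have \<kappa>: "\<kappa> > 0" by (simp add: \<kappa>_def)
  have kill: "killing X Y = \<kappa> * repart (trace (inP X ** inP Y))" if "X \<in> sl" for X Y
    unfolding killing_eq_trace[OF that] by (simp add: \<kappa>_def inP(7) flip: inP(8))
  define K where "K X = (1/2) *\<^sub>R (X + \<tau> X)" for X
  define R where "R X = (1/2) *\<^sub>R (X - \<tau> X)" for X
  have KR: "K X \<in> sl" "R X \<in> sl" "\<tau> (K X) = K X" "\<tau> (R X) = - R X" "X = K X + R X" "X - K X = R X" if "X \<in> sl" for X
    using that by (auto simp: K_def R_def sl_closed \<tau>_sl \<tau>_scaleR \<tau>_add \<tau>_diff \<tau>_\<tau> algebra_simps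
        simp flip: scaleR_add_left)
  have herm: "\<tau> X = - X" if X: "X \<in> sl" "ct (inP X) = inP X" for X
  proof -
    have sk: "ct (inP (K X)) = - inP (K X)" by (rule skew[OF KR(1,3)[OF X(1)]])
    have "repart (trace (inP X ** inP (K X))) = repart (trace (ct (inP X ** inP (K X))))" by simp
    also have "ct (inP X ** inP (K X)) = - (inP (K X) ** inP X)" by (simp add: ct_mult sk X(2) matrix_minus_left)
    also have "repart (trace \<dots>) = - repart (trace (inP X ** inP (K X)))"
      by (simp add: trace_minus trace_mul_sym[of "inP X"])
    finally have 1: "killing X (K X) = 0" by (simp add: kill[OF X(1)])
    have "killing (R X) (K X) = killing (\<tau> (R X)) (\<tau> (K X))"
      by (rule killing_\<tau>[OF KR(2)[OF X(1)] KR(1)[OF X(1)], symmetric])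
    also have "\<dots> = killing (- R X) (K X)" by (simp only: KR(3,4)[OF X(1)])
    also have "\<dots> = - killing (R X) (K X)"
      by (simp add: kill sl_closed KR(2)[OF X(1)] inP(9) matrix_minus_left trace_minus)
    finally have 2: "killing (R X) (K X) = 0" by simp
    have "killing (K X + R X) (K X) = killing (K X) (K X) + killing (R X) (K X)"
      by (simp add: kill KR(1,2)[OF X(1)] sl_closed inP(4) matrix_add_rdistrib trace_add distrib_left)
    then have "killing (K X) (\<tau> (K X)) = 0"
      unfolding KR(3)[OF X(1)] KR(5)[OF X(1), symmetric] using 1 2 by simp
    then have "K X = 0" using \<tau>_pos[of "K X"] KR(1)[OF X(1)] by fastforce
    then have "X + \<tau> X = 0" by (simp add: K_def)
    then show ?thesis by (simp add: eq_neg_iff_add_eq_0 add.commute)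
  qed
  have anti: "\<tau> X = X" if X: "X \<in> sl" "ct (inP X) = - inP X" for X
  proof -
    have "ct (inP (K X)) = - inP (K X)" by (rule skew[OF KR(1,3)[OF X(1)]])
    then have sk: "ct (inP (R X)) = - inP (R X)"
      unfolding KR(6)[OF X(1), symmetric] by (simp add: inP(5) X(2))
    have "R X = 0"
    proof (rule ccontr)
      assume "R X \<noteq> 0"
      then have "0 < killing (R X) (R X)"
        using \<tau>_pos[OF KR(2)[OF X(1)]] unfolding KR(4)[OF X(1)]
        by (simp add: kill[OF KR(2)[OF X(1)]] inP(9) matrix_minus_right trace_minus)
      also have "killing (R X) (R X) = - \<kappa> * repart (trace (inP (R X) ** ct (inP (R X))))"
        by (simp add: kill[OF KR(2)[OF X(1)]] sk matrix_minus_right trace_minus)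
      also have "trace (inP (R X) ** ct (inP (R X))) = of_real (\<Sum>i\<in>UNIV. \<Sum>j\<in>UNIV. (norm (inP (R X) $ i $ j))\<^sup>2)"
        by (simp add: trace_def matrix_matrix_mult_def ct_def mult_kcnj)
      also have "- \<kappa> * repart \<dots> \<le> 0"
        unfolding repart_of_real using \<kappa> by (simp add: sum_nonneg)
      finally show False by simp
    qed
    then show ?thesis by (simp add: R_def)
  qed
  have "\<tau> X = - cb P (ct (cb (matrix_inv P) X))" if X: "X \<in> sl" for X
  proof -
    define Y where "Y = cb P (ct (inP X))"
    have Y: "Y \<in> sl" using X P(1) by (simp add: Y_def cb_in_sl) (simp add: sl_def inP(7))
    have iY: "inP Y = ct (inP X)" by (simp add: Y_def inP(3))
    have "\<tau> (X + Y) = - (X + Y)" by (rule herm) (use X Y in \<open>auto simp: sl_closed inP(4,5) iY\<close>)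
    then have 1: "\<tau> X + \<tau> Y = - (X + Y)" by (simp only: \<tau>_add[OF X Y])
    have "\<tau> (X - Y) = X - Y" by (rule anti) (use X Y in \<open>auto simp: sl_closed inP(4,5) iY\<close>)
    then have 2: "\<tau> X - \<tau> Y = X - Y" by (simp only: \<tau>_diff[OF X Y])
    have "\<tau> X + \<tau> X = (\<tau> X + \<tau> Y) + (\<tau> X - \<tau> Y)" by simp
    also have "\<dots> = - Y - Y" unfolding 1 2 by simp
    finally have "\<tau> X + \<tau> X = - Y - Y" .
    then have "2 *\<^sub>R \<tau> X = 2 *\<^sub>R (- Y)" by (simp add: scaleR_2)
    then have "\<tau> X = - Y" by (metis scaleR_cancel_left zero_neq_numeral)
    then show ?thesis by (simp add: Y_def inP_def)
  qed
  then show ?thesis using that P(1) by blast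
qed

end

section \<open>A basis of lines adapted to the form and to the Cartan involution\<close>

lemma fadj_eq_cb: "fadj P e T = cb P (rdg e ** ct (cb (matrix_inv P) T) ** rdg e)" if "invertible P"
  using that by (simp add: fadj_def cb_def)

text \<open>
  Compare the entries of \<open>N E\<close> and \<open>E N\<close> for the matrix units \<open>E\<close> off the diagonal.
\<close>

lemma commutes_with_sl_scalar:
  fixes N :: "'k::real_or_complex ^ 'n ^ 'n"
  assumes d: "CARD('n) \<ge> 2" and N: "\<And>X. X \<in> sl \<Longrightarrow> N ** X = X ** N"
  obtains c where "N = mat c"
proof -
  define E :: "'n \<Rightarrow> 'n \<Rightarrow> 'k ^ 'n ^ 'n" where "E j k = axis j (axis k 1)" for j k
  have Enth: "E j k $ a $ b = (if a = j then if b = k then 1 else 0 else 0)" for j k a b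
    by (simp add: E_def axis_def)
  have NE: "(N ** E j k) $ a $ b = (if b = k then N $ a $ j else 0)" for j k a b
  proof -
    have "(N ** E j k) $ a $ b = (\<Sum>x\<in>UNIV. if x = j then if b = k then N $ a $ j else 0 else 0)"
      unfolding matrix_matrix_mult_def vec_lambda_beta by (intro sum.cong refl) (simp add: Enth)
    then show ?thesis by simp
  qed
  have EN: "(E j k ** N) $ a $ b = (if a = j then N $ k $ b else 0)" for j k a b
  proof -
    have "(E j k ** N) $ a $ b = (\<Sum>x\<in>UNIV. if x = k then if a = j then N $ k $ b else 0 else 0)"
      unfolding matrix_matrix_mult_def vec_lambda_beta by (intro sum.cong refl) (simp add: Enth)
    then show ?thesis by simp
  qed
  have *: "(if b = k then N $ a $ j else 0) = (if a = j then N $ k $ b else 0)" if "j \<noteq> k" for j k a b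
  proof -
    have "E j k \<in> sl" using that by (auto simp: sl_def trace_def Enth intro!: sum.neutral)
    then have "N ** E j k = E j k ** N" by (rule N)
    then have "(N ** E j k) $ a $ b = (E j k ** N) $ a $ b" by simp
    then show ?thesis unfolding NE EN .
  qed
  have diag: "N $ j $ j = N $ k $ k" for j k
    using *[of j k k j] by (cases "j = k") auto
  have off: "N $ i $ j = 0" if "i \<noteq> j" for i j
  proof -
    have "\<exists>k. k \<noteq> j"
    proof (rule ccontr)
      assume "\<not> ?thesis"
      then have "(UNIV :: 'n set) = {j}" by auto
      then have "CARD('n) = 1" by (metis card_1_singleton_iff One_nat_def)
      then show False using d by simp
    qed
    then obtain k where "k \<noteq> j" by blast
    then show ?thesis using *[of j k k i] that by simp
  qed
  obtain i0 :: 'n where True by blast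
  have "N $ i $ j = mat (N $ i0 $ i0) $ i $ j" for i j
    using diag[of i i0] off[of i j] by (cases "i = j") (auto simp: mat_def)
  then have "N = mat (N $ i0 $ i0)" unfolding vec_eq_iff by blast
  then show ?thesis using that by blast
qed

definition diag_alg :: "'k::real_or_complex ^ 'n ^ 'n \<Rightarrow> ('k ^ 'n ^ 'n) set" where
  "diag_alg P = {cb P (rdg a) | a. sum a UNIV = 0}"

lemma dg_add: "dg a + dg b = dg (\<lambda>i. a i + b i)"
  and dg_scaleR: "r *\<^sub>R dg a = dg (\<lambda>i. r *\<^sub>R a i)"
  by (auto simp: vec_eq_iff dg_nth)

lemma diag_alg_subalgebra:
  fixes P :: "'k::real_or_complex ^ 'n ^ 'n"
  assumes P: "invertible P"
  shows "lie_subalgebra (diag_alg P)"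
  unfolding lie_subalgebra_def
proof (intro conjI ballI)
  show "diag_alg P \<subseteq> sl"
    using P by (auto simp: diag_alg_def cb_in_sl) (auto simp: sl_def trace_dg simp flip: of_real_sum)
  show "subspace (diag_alg P)"
    unfolding subspace_def
  proof (intro conjI ballI allI)
    have "cb P (rdg (\<lambda>_. 0)) = 0" by (simp add: dg_eq_mat cb_simps)
    then show "0 \<in> diag_alg P" unfolding diag_alg_def by (intro CollectI exI[of _ "\<lambda>_. 0"]) auto
  next
    fix X Y assume "X \<in> diag_alg P" "Y \<in> diag_alg P"
    then obtain a b where "X = cb P (rdg a)" "sum a UNIV = 0" "Y = cb P (rdg b)" "sum b UNIV = 0"
      by (auto simp: diag_alg_def)
    then show "X + Y \<in> diag_alg P" unfolding diag_alg_def
      by (intro CollectI exI[of _ "\<lambda>i. a i + b i"]) (simp add: sum.distrib dg_add flip: cb_simps)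
  next
    fix r :: real and X assume "X \<in> diag_alg P"
    then obtain a where "X = cb P (rdg a)" "sum a UNIV = 0" by (auto simp: diag_alg_def)
    then show "r *\<^sub>R X \<in> diag_alg P" unfolding diag_alg_def
      by (intro CollectI exI[of _ "\<lambda>i. r * a i"])
        (simp add: dg_scaleR scaleR_conv_of_real[where 'a = 'k] flip: cb_simps sum_distrib_left)
  qed
  fix X Y assume X: "X \<in> diag_alg P" and "Y \<in> diag_alg P"
  then obtain a b where "X = cb P (rdg a)" "Y = cb P (rdg b)" by (auto simp: diag_alg_def)
  then have "lie X Y = 0" by (simp add: lie_def dg_mult mult.commute P flip: cb_mult)
  also have "0 \<in> diag_alg P" by (rule subspace_0) fact
  finally show "lie X Y \<in> diag_alg P" .
qed

text \<open>
  Write \<open>o = \<langle>\<cdot>, S \<cdot>\<rangle>\<close> for the inner product of \<open>\<tau>\<close>. Since \<open>\<tau>\<close> and \<open>d\<sigma>\<close> commute, \<open>S\<^sup>2\<close> commutes with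
  \<open>sl(V)\<close> and is a positive scalar, which a rescaling turns into 1. The elements of \<open>\<bb>\<close> are
  self-adjoint, commute with \<open>S\<close>, and commute with each other because their brackets are skew. Hence
  they and \<open>S\<close> have a common orthonormal eigenbasis, and \<open>\<bb>\<close> is everything diagonal by maximality.
\<close>

lemma adapted_basis:
  fixes f :: "('k::real_or_complex, 'n::finite) form"
  assumes d: "CARD('n) \<ge> 3" and f: "hermitian_form f" "adapted f P0 e0"
    and \<tau>: "\<tau> \<in> S_inv (pos_multiples f)"
    and b: "maximal_subalgebra_in (\<pp> \<tau> \<inter> \<qq> (pos_multiples f)) \<bb>"
  obtains P e where "adapted f P e" "\<And>X. X \<in> sl \<Longrightarrow> \<tau> X = - cb P (ct (cb (matrix_inv P) X))"
    "\<bb> = diag_alg P"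
proof -
  have cart: "cartan \<tau>" using \<tau> by unfold_locales (simp add: S_inv_def)
  interpret cartan \<tau> by (rule cart)
  obtain P1 where P1: "invertible P1" "\<And>X. X \<in> sl \<Longrightarrow> \<tau> X = - cb P1 (ct (cb (matrix_inv P1) X))"
    by (rule standard_form) blast
  define i1 where "i1 X = cb (matrix_inv P1) X" for X
  have i1: "cb P1 (i1 X) = X" "i1 (cb P1 X) = X" "i1 (- X) = - i1 X" "i1 (X ** Y) = i1 X ** i1 Y"
    "i1 X \<in> sl \<longleftrightarrow> X \<in> sl" "i1 (X - Y) = i1 X - i1 Y" for X Y
    using P1(1) by (auto simp: i1_def cb_simps cb_mult invertible_matrix_inv cb_in_sl)
  have P1i: "P1 *v (i1 X *v u) = X *v (P1 *v u)" for X u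
  proof -
    have "P1 ** i1 X = X ** P1"
      using P1(1) by (simp add: i1_def cb_def matrix_mul_assoc matrix_inv_right)
    then show ?thesis by (simp add: matrix_vector_mul_assoc)
  qed
  have e0: "\<forall>i. e0 i = 1 \<or> e0 i = - 1" and P0: "invertible P0" using f(2) by (auto simp: adapted_def)
  define G where "G = matrix_inv P0 ** P1"
  define S where "S = ct G ** rdg e0 ** G"
  have P0G: "P1 *v u = P0 *v (G *v u)" for u
    by (simp add: G_def matrix_vector_mul_assoc matrix_mul_assoc matrix_inv_right[OF P0])
  have fS: "f (P1 *v u) (P1 *v v) = hprod (S *v u) v" for u v
  proof -
    have "f (P1 *v u) (P1 *v v) = hprod (rdg e0 *v (G *v u)) (G *v v)"
      using f(2) by (simp add: P0G adapted_def)
    then show ?thesis by (simp add: S_def hprod_ct' matrix_vector_mul_assoc matrix_mul_assoc)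
  qed
  have S: "ct S = S" by (simp add: S_def ct_mult matrix_mul_assoc)
  have "invertible G" unfolding G_def using P0 P1(1) by (intro invertible_mult invertible_matrix_inv)
  moreover have "invertible (ct G)" using \<open>invertible G\<close> by (simp add: invertible_det_nz)
  moreover have "invertible (rdg e0 :: 'k ^ 'n ^ 'n)"
    using sign_mult_sign[OF e0] by (metis invertible_right_inverse)
  ultimately have invS: "invertible S" unfolding S_def by (intro invertible_mult)
  define Si where "Si = matrix_inv S"
  have SSi: "S ** Si = mat 1" "Si ** S = mat 1" unfolding Si_def by (simp_all add: matrix_inv_right matrix_inv_left invS)
  have ctSi: "ct Si = Si"
  proof -
    have "S ** ct Si = mat 1" using arg_cong[OF SSi(2), of ct] by (simp add: ct_mult S)
    then have "Si ** (S ** ct Si) = Si" by simp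
    then show ?thesis by (simp add: matrix_mul_assoc SSi)
  qed
  have d\<sigma>: "i1 (d\<sigma> (pos_multiples f) X) = - (Si ** ct (i1 X) ** S)" for X
  proof -
    define Z where "Z = i1 (fadj P0 e0 X)"
    have "hprod u (ct (i1 X) ** S *v v) = hprod u (S ** Z *v v)" for u v
    proof -
      have "hprod u (S ** Z *v v) = hprod (S *v u) (Z *v v)"
        by (simp add: hprod_ct S matrix_vector_mul_assoc)
      also have "\<dots> = f (P1 *v u) (fadj P0 e0 X *v (P1 *v v))" unfolding fS[symmetric] Z_def P1i ..
      also have "\<dots> = f (X *v (P1 *v u)) (P1 *v v)" by (rule fadj_adjoint[OF f(2), symmetric])
      also have "\<dots> = hprod (S *v (i1 X *v u)) v" unfolding P1i[symmetric] fS ..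
      also have "\<dots> = hprod u (ct (i1 X) ** S *v v)"
        by (simp add: hprod_ct S matrix_vector_mul_assoc ct_mult)
      finally show ?thesis by simp
    qed
    then have "ct (i1 X) ** S = S ** Z" unfolding matrix_eq using hprod_eq_iff by blast
    then have "Si ** (ct (i1 X) ** S) = Z" by (simp add: matrix_mul_assoc SSi)
    then show ?thesis by (simp add: d\<sigma>_eq[OF f] i1(3) Z_def matrix_mul_assoc)
  qed
  have i\<tau>: "i1 (\<tau> X) = - ct (i1 X)" if "X \<in> sl" for X
    unfolding P1(2)[OF that] i1_def[symmetric] by (simp add: i1)
  have d\<sigma>_sl: "d\<sigma> (pos_multiples f) X \<in> sl" if "X \<in> sl" for X
  proof -
    have "trace (Si ** ct (i1 X) ** S) = trace (S ** (Si ** ct (i1 X)))" by (rule trace_mul_sym)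
    also have "\<dots> = 0" using that i1(5)[of X] by (simp add: matrix_mul_assoc SSi sl_def)
    finally have "i1 (d\<sigma> (pos_multiples f) X) \<in> sl" by (simp add: d\<sigma> sl_def trace_minus)
    then show ?thesis by (simp add: i1)
  qed
  have "S ** S ** Y = Y ** (S ** S)" if Y: "Y \<in> sl" for Y
  proof -
    define X where "X = cb P1 Y"
    have X: "X \<in> sl" "i1 X = Y" using Y by (auto simp: X_def i1 cb_in_sl P1(1))
    have "i1 (\<tau> (d\<sigma> (pos_multiples f) X)) = i1 (d\<sigma> (pos_multiples f) (\<tau> X))"
      using \<tau> X(1) by (simp add: S_inv_def)
    then have "S ** Y ** Si = Si ** Y ** S"
      by (simp add: i\<tau> d\<sigma>_sl X d\<sigma> ct_mult S ctSi matrix_minus_left matrix_minus_right matrix_mul_assoc)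
    then have "S ** (S ** Y ** Si) ** S = S ** (Si ** Y ** S) ** S" by simp
    then have "S ** S ** Y ** (Si ** S) = (S ** Si) ** Y ** S ** S" by (simp add: matrix_mul_assoc)
    then show ?thesis by (simp add: SSi matrix_mul_assoc)
  qed
  then obtain c0 where c0: "S ** S = mat c0"
    using commutes_with_sl_scalar[of "S ** S"] d by (metis Suc_leD numeral_2_eq_2 numeral_3_eq_3)
  obtain i0 :: 'n where True by blast
  define c where "c = (\<Sum>k\<in>UNIV. (norm (S $ i0 $ k))\<^sup>2)"
  have "(S ** ct S) $ i0 $ i0 = of_real c"
    by (simp add: matrix_matrix_mult_def ct_def mult_kcnj c_def)
  then have c: "S ** S = mat (of_real c)" using c0 unfolding S by (simp add: mat_def)
  have "c \<noteq> 0"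
  proof
    assume "c = 0"
    then have "S ** S = 0" using c by simp
    then have "Si ** (S ** S) = 0" by simp
    then have "S = 0" by (simp add: matrix_mul_assoc SSi)
    then have "(mat 1 :: 'k ^ 'n ^ 'n) $ i0 $ i0 = 0" using SSi(1) by simp
    then show False by (simp add: mat_def)
  qed
  moreover have "c \<ge> 0" unfolding c_def by (intro sum_nonneg) auto
  ultimately have cpos: "c > 0" by simp
  have b_sub: "lie_subalgebra \<bb>" "\<bb> \<subseteq> \<pp> \<tau>" "\<bb> \<subseteq> \<qq> (pos_multiples f)"
    and b_max: "\<And>\<bb>'. lie_subalgebra \<bb>' \<Longrightarrow> \<bb>' \<subseteq> \<pp> \<tau> \<inter> \<qq> (pos_multiples f) \<Longrightarrow> \<bb> \<subseteq> \<bb>' \<Longrightarrow> \<bb>' = \<bb>"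
    using b unfolding maximal_subalgebra_in_def by blast+
  have b_sl: "X \<in> sl" if "X \<in> \<bb>" for X using b_sub(1) that by (auto simp: lie_subalgebra_def)
  have b_herm: "ct (i1 X) = i1 X" if "X \<in> \<bb>" for X
  proof -
    have "\<tau> X = - X" using b_sub(2) that by (auto simp: \<pp>_def)
    then have "- ct (i1 X) = - i1 X" using i\<tau>[OF b_sl[OF that]] by (simp add: i1)
    then show ?thesis by simp
  qed
  have b_S: "S ** i1 X = i1 X ** S" if "X \<in> \<bb>" for X
  proof -
    have "d\<sigma> (pos_multiples f) X = - X" using b_sub(3) that by (auto simp: \<qq>_def)
    then have "Si ** i1 X ** S = i1 X" using d\<sigma>[of X] by (simp add: i1 b_herm[OF that])
    then have "S ** (Si ** i1 X ** S) = S ** i1 X" by simp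
    then show ?thesis by (simp add: matrix_mul_assoc SSi)
  qed
  have b_comm: "X ** Y = Y ** X" if XY: "X \<in> \<bb>" "Y \<in> \<bb>" for X Y
  proof -
    have "lie X Y \<in> \<bb>" using b_sub(1) XY by (auto simp: lie_subalgebra_def)
    then have "\<tau> (lie X Y) = - lie X Y" using b_sub(2) by (auto simp: \<pp>_def)
    moreover have "\<tau> X = - X" "\<tau> Y = - Y" using b_sub(2) XY by (auto simp: \<pp>_def)
    then have "\<tau> (lie X Y) = lie (- X) (- Y)" by (simp add: \<tau>_lie b_sl XY)
    moreover have "lie (- X) (- Y) = lie X Y" by (simp add: lie_def matrix_minus_left matrix_minus_right)
    ultimately have "lie X Y = - lie X Y" by simp
    then have "2 *\<^sub>R lie X Y = 0" by (simp add: scaleR_2 eq_neg_iff_add_eq_0)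
    then show ?thesis by (simp add: lie_def)
  qed
  obtain U :: "'k ^ 'n ^ 'n" where U: "ct U ** U = mat 1" "\<And>M. M \<in> insert S (i1 ` \<bb>) \<Longrightarrow> \<exists>a. M ** U = U ** rdg a"
  proof (rule commuting_hermitian_diagonalization[of "insert S (i1 ` \<bb>)"])
    show "ct M = M" if "M \<in> insert S (i1 ` \<bb>)" for M using that S b_herm by auto
    show "M ** N = N ** M" if "M \<in> insert S (i1 ` \<bb>)" "N \<in> insert S (i1 ` \<bb>)" for M N
      using that b_S b_comm by (auto simp flip: i1(4))
  qed blast
  have U': "U ** ct U = mat 1" using U(1) by (rule matrix_left_right_inverse1)
  have invU: "invertible U" using U(1) U' by (auto simp: invertible_def)
  have iU: "matrix_inv U = ct U" by (rule matrix_inv_eqI[OF U'])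
  obtain s where s: "S ** U = U ** rdg s" using U(2)[of S] by blast
  have s2: "s i * s i = c" for i
  proof -
    have "rdg (\<lambda>i. s i * s i) = ct U ** (S ** U) ** rdg s"
      by (simp add: s matrix_mul_assoc U dg_mult)
    also have "\<dots> = ct U ** S ** (U ** rdg s)" by (simp add: matrix_mul_assoc)
    also have "\<dots> = ct U ** (S ** S ** U)" unfolding s[symmetric] by (simp add: matrix_mul_assoc)
    also have "\<dots> = ct U ** (mat (of_real c) ** U)" unfolding c ..
    also have "\<dots> = mat (of_real c)" unfolding mat_commute by (simp add: matrix_mul_assoc U)
    finally have "rdg (\<lambda>i. s i * s i) $ i $ i = (mat (of_real c) :: 'k ^ 'n ^ 'n) $ i $ i" by simp
    then show ?thesis by (simp add: dg_nth mat_def flip: of_real_mult)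
  qed
  \<comment> \<open>scaling the basis by \<open>r\<close> divides \<open>S\<close> by \<open>sqrt c\<close>, so that its eigenvalues become signs\<close>
  define r where "r = 1 / sqrt (sqrt c)"
  have r: "r > 0" "r * r = 1 / sqrt c" using cpos by (auto simp: r_def simp flip: real_sqrt_mult)
  define e where "e i = s i / sqrt c" for i
  have e: "e i = 1 \<or> e i = - 1" for i
  proof -
    have "e i * e i = 1" using s2[of i] cpos by (simp add: e_def)
    then show ?thesis by (metis square_eq_1_iff)
  qed
  define P where "P = mat (of_real r) ** (P1 ** U)"
  have invP: "invertible P" unfolding P_def
    using r invU P1(1) by (simp add: invertible_det_nz det_mul det_mat)
  have cbP: "cb P X = cb P1 (cb U X)" for X
  proof -
    have "cb P X = cb (P1 ** U) X"
      unfolding P_def cb_def by (rule conj_mat_mult) (use r invU P1(1) in \<open>auto intro: invertible_mult\<close>)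
    then show ?thesis by (simp add: cb_cb P1(1) invU)
  qed
  have cbPi: "cb (matrix_inv P) X = ct U ** i1 X ** U" for X
  proof -
    have "cb P (ct U ** i1 X ** U) = cb P1 (U ** ct U ** i1 X ** (U ** ct U))"
      unfolding cbP by (simp add: cb_def[of U] iU matrix_mul_assoc)
    then have "cb P (ct U ** i1 X ** U) = X" by (simp add: U' i1)
    then show ?thesis using invP by (metis cb_inv(2))
  qed
  have ad: "adapted f P e"
    unfolding adapted_def
  proof (intro conjI allI invP e)
    fix u v
    have Pu: "P *v u = P1 *v (of_real r *s (U *v u))" for u
      by (simp add: P_def mat_vec_mult matrix_vec_smult matrix_vector_mul_assoc)
    have "f (P *v u) (P *v v) = of_real (r * r) * hprod (S *v (U *v u)) (U *v v)"
      unfolding Pu fS by (simp add: matrix_vec_smult)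
    also have "hprod (S *v (U *v u)) (U *v v) = hprod ((ct U ** (S ** U)) *v u) v"
      by (simp add: hprod_ct' matrix_vector_mul_assoc matrix_mul_assoc)
    also have "ct U ** (S ** U) = rdg s" by (simp add: s matrix_mul_assoc U)
    also have "of_real (r * r) * hprod (rdg s *v u) v = hprod (of_real (r * r) *s (rdg s *v u)) v" by simp
    also have "of_real (r * r) *s (rdg s *v u) = rdg e *v u"
      by (simp add: vec_eq_iff r(2) e_def del: of_real_mult)
    finally show "f (P *v u) (P *v v) = hprod (rdg e *v u) v" .
  qed
  have ee: "\<forall>i. e i = 1 \<or> e i = - 1" using e by blast
  have \<tau>P: "\<tau> X = - cb P (ct (cb (matrix_inv P) X))" if "X \<in> sl" for X
  proof -
    have "cb P (ct (cb (matrix_inv P) X)) = cb P1 (U ** ct U ** ct (i1 X) ** (U ** ct U))"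
      unfolding cbPi cbP by (simp add: cb_def[of U] iU ct_mult matrix_mul_assoc)
    then show ?thesis unfolding P1(2)[OF that] i1_def[symmetric] by (simp add: U')
  qed
  have "\<bb> \<subseteq> diag_alg P"
  proof
    fix X assume X: "X \<in> \<bb>"
    obtain a where a: "i1 X ** U = U ** rdg a" using U(2)[of "i1 X"] X by blast
    have "cb (matrix_inv P) X = ct U ** (i1 X ** U)" by (simp add: cbPi matrix_mul_assoc)
    then have 1: "cb (matrix_inv P) X = rdg a" by (simp add: a matrix_mul_assoc U)
    then have 2: "X = cb P (rdg a)" using invP by (metis cb_inv(1))
    have "cb P (rdg a) \<in> sl" using b_sl[OF X] 2 by simp
    then have "trace (rdg a :: 'k ^ 'n ^ 'n) = 0" by (simp add: cb_in_sl invP) (simp add: sl_def)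
    then have "sum a UNIV = 0" by (simp add: trace_dg flip: of_real_sum)
    then show "X \<in> diag_alg P" using 2 by (auto simp: diag_alg_def)
  qed
  moreover have "diag_alg P \<subseteq> \<pp> \<tau> \<inter> \<qq> (pos_multiples f)"
  proof
    fix X assume X: "X \<in> diag_alg P"
    then obtain a where a: "X = cb P (rdg a)" by (auto simp: diag_alg_def)
    have sl: "X \<in> sl" using diag_alg_subalgebra[OF invP] X by (auto simp: lie_subalgebra_def)
    have "\<tau> X = - X" unfolding \<tau>P[OF sl] by (simp add: a invP)
    moreover have "rdg e ** rdg a ** rdg e = (rdg a :: 'k ^ 'n ^ 'n)"
    proof -
      have "rdg e ** rdg a ** rdg e = rdg e ** rdg e ** (rdg a :: 'k ^ 'n ^ 'n)"
        by (simp add: dg_mult mult_ac)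
      then show ?thesis by (simp add: sign_mult_sign[OF ee])
    qed
    then have "d\<sigma> (pos_multiples f) X = - X"
      by (simp add: d\<sigma>_eq[OF f(1) ad] fadj_eq_cb invP a)
    ultimately show "X \<in> \<pp> \<tau> \<inter> \<qq> (pos_multiples f)" using sl by (simp add: \<pp>_def \<qq>_def)
  qed
  ultimately have "diag_alg P = \<bb>" using b_max[OF diag_alg_subalgebra[OF invP]] by blast
  then show ?thesis using that[OF ad \<tau>P] by blast
qed

section \<open>The closed Weyl chamber\<close>

definition elem_mat :: "'n \<Rightarrow> 'n \<Rightarrow> 'k::real_or_complex ^ 'n ^ 'n" where
  "elem_mat i j = axis i (axis j 1)"

lemma elem_mat_nth: "elem_mat i j $ a $ b = (if a = i \<and> b = j then 1 else 0)"
  by (simp add: elem_mat_def axis_def)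

locale adapted_triple =
  fixes f :: "('k::real_or_complex, 'n::finite) form" and P :: "'k ^ 'n ^ 'n" and e :: "'n \<Rightarrow> real"
    and \<tau> :: "'k ^ 'n ^ 'n \<Rightarrow> 'k ^ 'n ^ 'n"
  assumes f: "hermitian_form f" and ad: "adapted f P e"
    and \<tau>: "\<And>X. X \<in> sl \<Longrightarrow> \<tau> X = - cb P (ct (cb (matrix_inv P) X))"
begin

abbreviation "\<omega> \<equiv> pos_multiples f"
abbreviation "Dg a \<equiv> cb P (rdg a)"
abbreviation "\<Sigma> \<equiv> restricted_roots (fixed_subalgebra \<tau> \<omega>) (diag_alg P)"

lemma invP: "invertible P" and e: "\<And>i. e i = 1 \<or> e i = - 1"
  and fP: "\<And>u v. f (P *v u) (P *v v) = hprod (rdg e *v u) v"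
  using ad by (auto simp: adapted_def)

lemma Dg_in: "sum a UNIV = 0 \<Longrightarrow> Dg a \<in> diag_alg P"
  by (auto simp: diag_alg_def)

lemma diag_algE:
  assumes "Y \<in> diag_alg P" obtains a where "Y = Dg a" "sum a UNIV = 0"
  using assms by (auto simp: diag_alg_def)

lemma in_fixed_subalgebra:
  "X \<in> fixed_subalgebra \<tau> \<omega> \<longleftrightarrow> X \<in> sl \<and> rdg e ** cb (matrix_inv P) X ** rdg e = cb (matrix_inv P) X"
proof -
  define X' where "X' = cb (matrix_inv P) X"
  have X: "X = cb P X'" using invP by (simp add: X'_def)
  have "\<tau> (d\<sigma> \<omega> X) = cb P (rdg e ** X' ** rdg e)" if "X \<in> sl"
  proof -
    have d: "d\<sigma> \<omega> X = - cb P (rdg e ** ct X' ** rdg e)"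
      by (simp add: d\<sigma>_eq[OF f ad] fadj_eq_cb invP X'_def)
    have ee: "\<forall>i. e i = 1 \<or> e i = - 1" using e by blast
    have "trace (rdg e ** ct X' ** rdg e) = trace (rdg e ** (rdg e ** ct X'))" by (rule trace_mul_sym)
    also have "\<dots> = trace (rdg e ** rdg e ** ct X')" by (simp add: matrix_mul_assoc)
    also have "\<dots> = 0" using that by (simp add: sign_mult_sign[OF ee] X cb_in_sl invP) (simp add: sl_def)
    finally have "d\<sigma> \<omega> X \<in> sl" unfolding d by (simp add: sl_def trace_minus invP)
    from \<tau>[OF this] show ?thesis by (simp add: d cb_simps invP ct_mult matrix_mul_assoc)
  qed
  moreover have "cb P (rdg e ** X' ** rdg e) = X \<longleftrightarrow> rdg e ** X' ** rdg e = X'"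
    unfolding X using invP by (metis cb_inv(2))
  ultimately show ?thesis unfolding fixed_subalgebra_def X'_def[symmetric] by auto
qed

lemma lie_Dg: "cb (matrix_inv P) (lie (Dg a) X) $ i $ j = of_real (a i - a j) * cb (matrix_inv P) X $ i $ j"
proof -
  define X' where "X' = cb (matrix_inv P) X"
  have X: "X = cb P X'" using invP by (simp add: X'_def)
  have "lie (Dg a) X = cb P (rdg a ** X' - X' ** rdg a)"
    by (simp add: lie_def X cb_simps cb_mult invP)
  then show ?thesis by (simp add: invP X'_def[symmetric] algebra_simps)
qed

text \<open>
  The fixed algebra of \<open>\<tau> d\<sigma>\<close> is block diagonal, with blocks given by the signs of the basis vectors;
  so its roots are the differences of two coordinates of the same sign.
\<close>

lemma root_is_difference:
  assumes "\<alpha> \<in> \<Sigma>"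
  obtains i j where "i \<noteq> j" "e i = e j" "\<And>a. sum a UNIV = 0 \<Longrightarrow> \<alpha> (Dg a) = a i - a j"
proof -
  obtain X Y0 where X: "X \<in> fixed_subalgebra \<tau> \<omega>" "X \<noteq> 0"
    and l: "\<And>Y. Y \<in> diag_alg P \<Longrightarrow> lie Y X = \<alpha> Y *\<^sub>R X"
    and Y0: "Y0 \<in> diag_alg P" "\<alpha> Y0 \<noteq> 0"
    using assms by (auto simp: restricted_roots_def)
  define X' where "X' = cb (matrix_inv P) X"
  have "X' \<noteq> 0" using X(2) invP by (metis X'_def cb_inv(1) cb_simps(5))
  then obtain i j where ij: "X' $ i $ j \<noteq> 0" by (auto simp: vec_eq_iff)
  have \<alpha>: "\<alpha> (Dg a) = a i - a j" if "sum a UNIV = 0" for a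
  proof -
    have "of_real (a i - a j) * X' $ i $ j = cb (matrix_inv P) (lie (Dg a) X) $ i $ j"
      by (simp add: lie_Dg X'_def)
    also have "\<dots> = of_real (\<alpha> (Dg a)) * X' $ i $ j"
      by (simp add: l[OF Dg_in[OF that]] cb_simps X'_def) (simp add: scaleR_conv_of_real)
    finally show ?thesis using ij by (metis mult_cancel_right of_real_eq_iff)
  qed
  have "i \<noteq> j" using Y0 \<alpha> by (auto elim: diag_algE)
  moreover have "e i = e j"
  proof -
    have "(rdg e ** X' ** rdg e) $ i $ j = X' $ i $ j" using X(1) by (simp add: in_fixed_subalgebra X'_def)
    then have "of_real (e i * e j) * X' $ i $ j = 1 * X' $ i $ j" by (simp add: mult_ac)
    then have "of_real (e i * e j) = (1 :: 'k)" using ij by (metis mult_cancel_right)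
    then have "e i * e j = 1" by (metis of_real_eq_1_iff)
    then show ?thesis using e[of i] e[of j] by auto
  qed
  ultimately show ?thesis using that \<alpha> by blast
qed

lemma difference_is_root:
  assumes ij: "i \<noteq> j" "e i = e j"
  obtains \<alpha> where "\<alpha> \<in> \<Sigma>" "\<And>a. sum a UNIV = 0 \<Longrightarrow> \<alpha> (Dg a) = a i - a j"
proof -
  define \<alpha> where "\<alpha> = restrict (\<lambda>Y. repart (cb (matrix_inv P) Y $ i $ i) - repart (cb (matrix_inv P) Y $ j $ j)) (diag_alg P)"
  have \<alpha>: "\<alpha> (Dg a) = a i - a j" if "sum a UNIV = 0" for a
    using Dg_in[OF that] by (simp add: \<alpha>_def invP dg_nth)
  have sub: "subspace (diag_alg P)" using diag_alg_subalgebra[OF invP] by (simp add: lie_subalgebra_def)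
  have "\<alpha> \<in> \<Sigma>"
    unfolding restricted_roots_def
  proof (intro CollectI conjI ballI allI)
    show "\<alpha> \<in> extensional (diag_alg P)" by (simp add: \<alpha>_def)
    show "\<alpha> (Y + Z) = \<alpha> Y + \<alpha> Z" if "Y \<in> diag_alg P" "Z \<in> diag_alg P" for Y Z
      using that subspace_add[OF sub that] by (simp add: \<alpha>_def cb_simps)
    show "\<alpha> (c *\<^sub>R Y) = c * \<alpha> Y" if "Y \<in> diag_alg P" for c Y
      using that subspace_scale[OF sub that, of c] by (simp add: \<alpha>_def cb_simps right_diff_distrib)
    define a where "a k = (if k = i then 1 else if k = j then - 1 else 0 :: real)" for k
    have "sum a UNIV = sum a {i, j}" by (rule sum.mono_neutral_right) (auto simp: a_def)
    then have "sum a UNIV = 0" using ij(1) by (simp add: a_def)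
    then show "\<exists>Y\<in>diag_alg P. \<alpha> Y \<noteq> 0"
      using \<alpha>[of a] Dg_in[of a] ij(1) by (intro bexI[of _ "Dg a"]) (auto simp: a_def)
    define X :: "'k ^ 'n ^ 'n" where "X = cb P (elem_mat i j)"
    have X': "cb (matrix_inv P) X = elem_mat i j" by (simp add: X_def invP)
    have "trace (elem_mat i j :: 'k ^ 'n ^ 'n) = 0"
      using ij(1) by (simp add: trace_def elem_mat_nth) (intro sum.neutral, auto)
    then have "X \<in> sl" by (simp add: X_def cb_in_sl invP) (simp add: sl_def)
    moreover have "rdg e ** elem_mat i j ** rdg e = (elem_mat i j :: 'k ^ 'n ^ 'n)"
      using ij(2) e[of j] by (auto simp: vec_eq_iff elem_mat_nth)
    ultimately have "X \<in> fixed_subalgebra \<tau> \<omega>" by (simp add: in_fixed_subalgebra X')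
    moreover have "X \<noteq> 0"
    proof
      assume "X = 0"
      then have "elem_mat i j $ i $ j = (0 :: 'k ^ 'n ^ 'n) $ i $ j" using X' by (simp add: cb_simps)
      then show False by (simp add: elem_mat_nth)
    qed
    moreover have "lie Y X = \<alpha> Y *\<^sub>R X" if Y: "Y \<in> diag_alg P" for Y
    proof -
      obtain a where a: "Y = Dg a" "sum a UNIV = 0" using Y by (rule diag_algE)
      have "cb (matrix_inv P) (lie Y X) = cb (matrix_inv P) (\<alpha> Y *\<^sub>R X)"
        unfolding cb_simps X' vec_eq_iff
        by (auto simp: a(1) lie_Dg X' elem_mat_nth \<alpha>[OF a(2)] scaleR_conv_of_real[where 'a = 'k])
      then show ?thesis using invP by (metis cb_inv(1))
    qed
    ultimately show "\<exists>X\<in>fixed_subalgebra \<tau> \<omega>. X \<noteq> 0 \<and> (\<forall>Y\<in>diag_alg P. lie Y X = \<alpha> Y *\<^sub>R X)" by blast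
  qed
  then show ?thesis using that \<alpha> by blast
qed

lemma regular_elements:
  "diag_alg P - (\<Union>\<alpha>\<in>\<Sigma>. {Y\<in>diag_alg P. \<alpha> Y = 0}) =
    {Dg a | a. sum a UNIV = 0 \<and> (\<forall>i j. i \<noteq> j \<and> e i = e j \<longrightarrow> a i \<noteq> a j)}" (is "?L = ?R")
proof
  show "?L \<subseteq> ?R"
  proof
    fix Y assume Y: "Y \<in> ?L"
    then obtain a where a: "Y = Dg a" "sum a UNIV = 0" by (auto elim: diag_algE)
    have "a i \<noteq> a j" if ij: "i \<noteq> j" "e i = e j" for i j
    proof -
      obtain \<alpha> where "\<alpha> \<in> \<Sigma>" "\<And>a. sum a UNIV = 0 \<Longrightarrow> \<alpha> (Dg a) = a i - a j"
        using difference_is_root[OF ij] by blast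
      then show ?thesis using Y a by auto
    qed
    then show "Y \<in> ?R" using a by blast
  qed
  show "?R \<subseteq> ?L"
  proof
    fix Y assume "Y \<in> ?R"
    then obtain a where a: "Y = Dg a" "sum a UNIV = 0" "\<And>i j. i \<noteq> j \<Longrightarrow> e i = e j \<Longrightarrow> a i \<noteq> a j" by blast
    have "\<alpha> Y \<noteq> 0" if \<alpha>: "\<alpha> \<in> \<Sigma>" for \<alpha>
    proof -
      obtain i j where "i \<noteq> j" "e i = e j" "\<And>a. sum a UNIV = 0 \<Longrightarrow> \<alpha> (Dg a) = a i - a j"
        using root_is_difference[OF \<alpha>] by blast
      then show ?thesis using a by auto
    qed
    then show "Y \<in> ?L" using a Dg_in by auto
  qed
qed

text \<open>
  Among the sign-preserving permutations \<open>\<pi>\<close>, one that maximizes \<open>\<Sum>\<^sub>i c\<^sub>i a\<^sub>\<pi>\<^sub>i\<close> sorts \<open>a\<close> in the same order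
  as \<open>c\<close> within each sign class, by the rearrangement inequality.
\<close>

lemma sorting_permutation:
  fixes a c :: "'n \<Rightarrow> real"
  obtains \<pi> where "bij \<pi>" "\<And>i. e (\<pi> i) = e i"
    "\<And>i j. e i = e j \<Longrightarrow> c i < c j \<Longrightarrow> a (\<pi> i) \<le> a (\<pi> j)"
proof -
  define S where "S = {\<pi> :: 'n \<Rightarrow> 'n. bij \<pi> \<and> (\<forall>i. e (\<pi> i) = e i)}"
  define F where "F \<rho> = (\<Sum>i\<in>UNIV. c i * a (\<rho> i))" for \<rho> :: "'n \<Rightarrow> 'n"
  have fin: "finite (F ` S)" by simp
  have "id \<in> S" by (simp add: S_def)
  then have "Max (F ` S) \<in> F ` S" using fin by (intro Max_in) auto
  then obtain \<pi> where "\<pi> \<in> S" "F \<pi> = Max (F ` S)" by (metis imageE)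
  then have \<pi>: "\<pi> \<in> S" "\<And>\<rho>. \<rho> \<in> S \<Longrightarrow> (\<Sum>i\<in>UNIV. c i * a (\<rho> i)) \<le> (\<Sum>i\<in>UNIV. c i * a (\<pi> i))"
    using Max_ge[OF fin] by (auto simp: F_def)
  have "a (\<pi> i) \<le> a (\<pi> j)" if ij: "e i = e j" "c i < c j" for i j
  proof (rule ccontr)
    assume "\<not> ?thesis"
    then have lt: "a (\<pi> j) < a (\<pi> i)" by simp
    have ne: "i \<noteq> j" using ij(2) by auto
    define \<rho> where "\<rho> = \<pi> \<circ> Transposition.transpose i j"
    have "\<rho> \<in> S" using \<pi>(1) ij(1)
      by (auto simp: S_def \<rho>_def intro!: bij_comp) (metis transpose_apply_first transpose_apply_other transpose_apply_second)
    have split: "(\<Sum>k\<in>UNIV. F k) = F i + F j + (\<Sum>k\<in>UNIV - {i, j}. F k)" for F :: "'n \<Rightarrow> real"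
    proof -
      have "(\<Sum>k\<in>UNIV. F k) = (\<Sum>k\<in>{i, j}. F k) + (\<Sum>k\<in>UNIV - {i, j}. F k)"
        by (metis finite_code sum.subset_diff add.commute subset_UNIV)
      then show ?thesis using ne by simp
    qed
    have "(\<Sum>k\<in>UNIV - {i, j}. c k * a (\<rho> k)) = (\<Sum>k\<in>UNIV - {i, j}. c k * a (\<pi> k))"
      by (intro sum.cong refl) (auto simp: \<rho>_def)
    then have "(\<Sum>k\<in>UNIV. c k * a (\<rho> k)) - (\<Sum>k\<in>UNIV. c k * a (\<pi> k)) = (c j - c i) * (a (\<pi> i) - a (\<pi> j))"
      unfolding split[of "\<lambda>k. c k * a (\<rho> k)"] split[of "\<lambda>k. c k * a (\<pi> k)"] by (simp add: \<rho>_def algebra_simps)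
    also have "\<dots> > 0" using ij(2) lt by simp
    finally show False using \<pi>(2)[OF \<open>\<rho> \<in> S\<close>] by simp
  qed
  then show ?thesis using that \<pi>(1) by (auto simp: S_def)
qed

text \<open>
  If \<open>a\<close> is sorted like a point \<open>c\<close> of the open chamber, the half-open segment from \<open>c\<close> to \<open>a\<close> avoids
  the root hyperplanes, so it stays in the chamber and \<open>a\<close> lies in the closure.
\<close>

lemma chamber_meets_orbits:
  assumes "closed_weyl_chamber \<Sigma> (diag_alg P) \<bb>p"
  shows "\<bb>p \<subseteq> diag_alg P"
    and "sum a UNIV = 0 \<Longrightarrow> \<exists>\<pi>. bij \<pi> \<and> (\<forall>i. e (\<pi> i) = e i) \<and> Dg (\<lambda>i. a (\<pi> i)) \<in> \<bb>p"
proof -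
  define \<Omega> where "\<Omega> = {Dg a | a. sum a UNIV = 0 \<and> (\<forall>i j. i \<noteq> j \<and> e i = e j \<longrightarrow> a i \<noteq> a j)}"
  obtain C where C: "C \<in> components \<Omega>" "\<bb>p = closure C"
    using assms unfolding closed_weyl_chamber_def regular_elements \<Omega>_def by blast
  have "subspace (diag_alg P)" using diag_alg_subalgebra[OF invP] by (simp add: lie_subalgebra_def)
  then have "closed (diag_alg P)" by (rule closed_subspace)
  moreover have "C \<subseteq> \<Omega>" by (rule in_components_subset[OF C(1)])
  moreover have "\<Omega> \<subseteq> diag_alg P" by (auto simp: \<Omega>_def diag_alg_def)
  ultimately show "\<bb>p \<subseteq> diag_alg P" unfolding C(2) by (intro closure_minimal) auto
  assume a: "sum a UNIV = 0"
  have "C \<noteq> {}" using C(1) by (rule in_components_nonempty)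
  then obtain Y where "Y \<in> C" by blast
  moreover from this have "Y \<in> \<Omega>" using \<open>C \<subseteq> \<Omega>\<close> by blast
  then obtain c where "Y = Dg c" and c': "sum c UNIV = 0" "\<And>i j. i \<noteq> j \<Longrightarrow> e i = e j \<Longrightarrow> c i \<noteq> c j"
    unfolding \<Omega>_def by blast
  ultimately have c: "Dg c \<in> C" "sum c UNIV = 0" "\<And>i j. i \<noteq> j \<Longrightarrow> e i = e j \<Longrightarrow> c i \<noteq> c j"
    by simp_all
  obtain \<pi> where \<pi>: "bij \<pi>" "\<And>i. e (\<pi> i) = e i" "\<And>i j. e i = e j \<Longrightarrow> c i < c j \<Longrightarrow> a (\<pi> i) \<le> a (\<pi> j)"
    using sorting_permutation[where a = a and c = c] by metis
  define b where "b i = a (\<pi> i)" for i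
  have b: "sum b UNIV = 0" unfolding b_def using sum.reindex_bij_betw[OF \<pi>(1), of a] a by simp
  define \<gamma> where "\<gamma> t = Dg (\<lambda>i. (1 - t) * c i + t * b i)" for t
  have \<gamma>: "\<gamma> t = (1 - t) *\<^sub>R Dg c + t *\<^sub>R Dg b" for t
    by (simp add: \<gamma>_def dg_add dg_scaleR scaleR_conv_of_real[where 'a = 'k] flip: cb_simps)
  have cont: "continuous_on A \<gamma>" for A unfolding \<gamma>[abs_def] by (intro continuous_intros)
  have "\<gamma> ` {0..<1} \<subseteq> \<Omega>"
  proof
    fix Y assume "Y \<in> \<gamma> ` {0..<1}"
    then obtain t where t: "0 \<le> t" "t < 1" "Y = \<gamma> t" by auto
    have lt: "(1 - t) * c i + t * b i < (1 - t) * c j + t * b j" if "e i = e j" "c i < c j" for i j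
    proof -
      have "t * b i \<le> t * b j" using \<pi>(3)[OF that] t(1) by (simp add: b_def mult_left_mono)
      moreover have "(1 - t) * c i < (1 - t) * c j" using that t(2) by simp
      ultimately show ?thesis by simp
    qed
    have "(1 - t) * c i + t * b i \<noteq> (1 - t) * c j + t * b j" if "i \<noteq> j" "e i = e j" for i j
      using lt[of i j] lt[of j i] c(3)[OF that] that(2) by (metis less_irrefl linorder_neqE_linordered_idom)
    moreover have "(\<Sum>i\<in>UNIV. (1 - t) * c i + t * b i) = 0"
      by (simp add: sum.distrib b c(2) flip: sum_distrib_left)
    ultimately show "Y \<in> \<Omega>" unfolding \<Omega>_def t(3) \<gamma>_def
      by (intro CollectI exI conjI refl) auto
  qed
  moreover have "connected (\<gamma> ` {0..<1})"
    by (intro connected_continuous_image cont convex_connected convex_real_interval)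
  moreover have "C \<inter> \<gamma> ` {0..<1} \<noteq> {}"
  proof -
    have "\<gamma> 0 = Dg c" by (simp add: \<gamma>_def)
    then show ?thesis using c(1) by (metis IntI atLeastLessThan_iff empty_iff imageI order_refl zero_less_one)
  qed
  ultimately have sub: "\<gamma> ` {0..<1} \<subseteq> C" using components_maximal[OF C(1)] by blast
  have "\<gamma> ` closure {0..<1} \<subseteq> closure (\<gamma> ` {0..<1})"
    by (rule image_closure_subset[OF cont]) (auto intro: closure_subset[THEN subsetD])
  moreover have "(1::real) \<in> closure {0..<1}" by simp
  ultimately have "\<gamma> 1 \<in> closure (\<gamma> ` {0..<1})" by blast
  then have "\<gamma> 1 \<in> \<bb>p" unfolding C(2) using closure_mono[OF sub] by blast
  then show "\<exists>\<pi>. bij \<pi> \<and> (\<forall>i. e (\<pi> i) = e i) \<and> Dg (\<lambda>i. a (\<pi> i)) \<in> \<bb>p"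
    using \<pi>(1,2) by (intro exI[of _ \<pi>]) (simp add: \<gamma>_def b_def)
qed

end

section \<open>Monomial matrices and exponentials of diagonal matrices\<close>

definition mono_mat :: "('n \<Rightarrow> 'n) \<Rightarrow> ('n \<Rightarrow> 'k) \<Rightarrow> 'k::real_or_complex ^ 'n ^ 'n" where
  "mono_mat \<pi> u = (\<chi> i j. if i = \<pi> j then u j else 0)"

lemma mono_mat_nth: "mono_mat \<pi> u $ i $ j = (if i = \<pi> j then u j else 0)"
  by (simp add: mono_mat_def)

lemma mult_mono_mat_nth: "(A ** mono_mat \<pi> u) $ i $ j = A $ i $ \<pi> j * u j"
proof -
  have "(A ** mono_mat \<pi> u) $ i $ j = (\<Sum>k\<in>UNIV. if k = \<pi> j then A $ i $ \<pi> j * u j else 0)"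
    unfolding matrix_matrix_mult_def vec_lambda_beta by (intro sum.cong refl) (simp add: mono_mat_nth)
  then show ?thesis by simp
qed

lemma column_mult_mono_mat: "column j (A ** mono_mat \<pi> u) = u j *s column (\<pi> j) A"
  by (simp add: vec_eq_iff column_def mult_mono_mat_nth mult.commute)

lemma mono_mat_mult: "mono_mat \<pi> u ** mono_mat \<rho> v = mono_mat (\<pi> \<circ> \<rho>) (\<lambda>j. u (\<rho> j) * v j)"
  by (simp add: vec_eq_iff mult_mono_mat_nth mono_mat_nth)

lemma mono_mat_mult_dg: "mono_mat \<pi> u ** dg a = mono_mat \<pi> (\<lambda>j. u j * a j)"
  by (simp add: vec_eq_iff mono_mat_nth)

lemma dg_mult_mono_mat: "dg a ** mono_mat \<pi> u = mono_mat \<pi> (\<lambda>j. a (\<pi> j) * u j)"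
  by (simp add: vec_eq_iff mono_mat_nth)

lemma ct_mono_mat_mult: "inj \<pi> \<Longrightarrow> ct (mono_mat \<pi> u) ** mono_mat \<pi> u = rdg (\<lambda>j. (norm (u j))\<^sup>2)"
  by (auto simp: vec_eq_iff mult_mono_mat_nth ct_def mono_mat_nth dg_nth inj_eq mult.commute[of "kcnj _"] mult_kcnj
      simp del: of_real_power)

lemma norm_det_mono_mat:
  fixes u :: "'n::finite \<Rightarrow> 'k::real_or_complex"
  assumes "inj \<pi>"
  shows "norm (det (mono_mat \<pi> u)) = (\<Prod>j\<in>UNIV. norm (u j))"
proof -
  have "det (ct (mono_mat \<pi> u) ** mono_mat \<pi> u) = of_real (\<Prod>j\<in>UNIV. (norm (u j))\<^sup>2)"
    unfolding ct_mono_mat_mult[OF assms] det_dg by simp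
  then have "of_real ((norm (det (mono_mat \<pi> u)))\<^sup>2) = (of_real (\<Prod>j\<in>UNIV. (norm (u j))\<^sup>2) :: 'k)"
    by (simp add: det_mul mult.commute[of "kcnj _"] mult_kcnj del: of_real_power of_real_prod)
  then have "(norm (det (mono_mat \<pi> u)))\<^sup>2 = (\<Prod>j\<in>UNIV. norm (u j))\<^sup>2"
    unfolding of_real_eq_iff by (simp add: prod_power_distrib)
  then show ?thesis by (simp add: prod_nonneg)
qed

lemma det_mono_mat: "det (mono_mat \<pi> u) = det (mono_mat \<pi> (\<lambda>_. 1)) * (\<Prod>j\<in>UNIV. u j)"
  for u :: "'n::finite \<Rightarrow> 'k::real_or_complex"
proof -
  have "mono_mat \<pi> u = mono_mat \<pi> (\<lambda>_. 1) ** dg u" by (simp add: mono_mat_mult_dg)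
  then show ?thesis by (simp add: det_mul det_dg)
qed

lemma invertible_mono_mat:
  fixes u :: "'n::finite \<Rightarrow> 'k::real_or_complex"
  assumes "inj \<pi>" "\<And>j. u j \<noteq> 0"
  shows "invertible (mono_mat \<pi> u)"
proof -
  have "(\<Prod>j\<in>UNIV. norm (u j)) \<noteq> 0" using assms(2) by simp
  then show ?thesis using norm_det_mono_mat[OF assms(1), of u] by (auto simp: invertible_det_nz)
qed

lemma mpow_cb: "invertible P \<Longrightarrow> mpow (cb P X) k = cb P (mpow X k)"
  by (induction k) (auto simp: mpow_Suc cb_mult)

lemma matrix_exp_cb:
  assumes "invertible P"
  shows "matrix_exp (cb P X) = cb P (matrix_exp X)"
proof -
  have "bounded_linear (cb P)" using linear_cb linear_conv_bounded_linear by blast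
  from bounded_linear.suminf[OF this summable_matrix_exp_entry(2)[of X]]
  show ?thesis by (simp add: matrix_exp_eq mpow_cb assms cb_simps)
qed

lemma matrix_exp_rdg: "matrix_exp (rdg a) = (rdg (\<lambda>i. exp (a i)) :: 'k::real_or_complex ^ 'n ^ 'n)"
proof -
  have p: "mpow (rdg a) k = (rdg (\<lambda>i. a i ^ k) :: 'k ^ 'n ^ 'n)" for k
    by (induction k) (auto simp: mpow_Suc dg_mult dg_eq_mat)
  have "matrix_exp (rdg a) $ i $ j = (rdg (\<lambda>i. exp (a i)) :: 'k ^ 'n ^ 'n) $ i $ j" for i j
  proof (cases "i = j")
    case True
    have "(\<Sum>k. (1 / fact k) *\<^sub>R (of_real (a j) ^ k)) = exp (of_real (a j) :: 'k)"
      by (simp add: exp_def inverse_eq_divide)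
    then show ?thesis using True by (simp add: matrix_exp_nth p dg_nth exp_of_real)
  next
    case False
    then show ?thesis by (simp add: matrix_exp_nth p dg_nth)
  qed
  then show ?thesis unfolding vec_eq_iff by blast
qed

definition orth_columns :: "('k::real_or_complex, 'n::finite) form \<Rightarrow> 'k ^ 'n ^ 'n \<Rightarrow> bool" where
  "orth_columns f Q \<longleftrightarrow> (\<forall>i j. i \<noteq> j \<longrightarrow> f (column i Q) (column j Q) = 0)"

context adapted_triple
begin

section \<open>Orthogonal bases of lines and the self-adjoint element \<open>A\<^sup>\<star> A\<close>\<close>

abbreviation "orthc \<equiv> orth_columns f"
abbreviation "adj \<equiv> fadj P e"

lemmas fs = hermitian_form_simps[OF f]

lemma lines_in_orth_line_bases:
  assumes Q: "invertible (Q :: 'k ^ 'n ^ 'n)"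
  shows "lines Q \<in> orth_line_bases \<omega> \<longleftrightarrow> orthc Q"
proof
  assume L: "lines Q \<in> orth_line_bases \<omega>"
  show "orthc Q"
    unfolding orth_columns_def
  proof (intro allI impI)
    fix i j :: 'n assume "i \<noteq> j"
    then have "vec.span {column i Q} \<noteq> vec.span {column j Q}" using injD[OF inj_lines[OF Q], of i j] by auto
    moreover have "vec.span {column i Q} \<in> lines Q" "vec.span {column j Q} \<in> lines Q" by (auto simp: lines_def)
    moreover have "column i Q \<in> vec.span {column i Q}" for i by (rule vec.span_base) simp
    ultimately show "f (column i Q) (column j Q) = 0"
      using L unfolding orth_line_bases_def orthogonal_for_eq by blast
  qed
next
  assume o: "orthc Q"
  have "f u v = 0" if LM: "L \<in> lines Q" "M \<in> lines Q" "L \<noteq> M" "u \<in> L" "v \<in> M" for L M u v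
  proof -
    obtain i j where ij: "L = vec.span {column i Q}" "M = vec.span {column j Q}"
      using LM(1,2) by (auto simp: lines_def)
    obtain c d where "u = c *s column i Q" "v = d *s column j Q"
      using LM(4,5) unfolding ij vec.span_singleton by blast
    moreover have "i \<noteq> j" using LM(3) ij by auto
    ultimately show ?thesis using o by (simp add: fs orth_columns_def)
  qed
  then show "lines Q \<in> orth_line_bases \<omega>"
    using line_basis_lines[OF Q] by (simp add: orth_line_bases_def orthogonal_for_eq)
qed

lemma orthogonal_columns_anisotropic:
  assumes Q: "invertible (Q :: 'k ^ 'n ^ 'n)" and o: "orthc Q"
  shows "f (column j Q) (column j Q) \<noteq> 0"
proof
  assume z: "f (column j Q) (column j Q) = 0"
  have "f u (column j Q) = 0" for u
  proof -
    have u: "u = Q *v (matrix_inv Q *v u)" by (simp add: matrix_vector_mul_assoc matrix_inv_right[OF Q])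
    have "f u (column j Q) = (\<Sum>i\<in>UNIV. f (column i Q) (column i Q) * (matrix_inv Q *v u) $ i * kcnj (axis j 1 $ i))"
      unfolding column_eq_axis[of j] by (subst u) (rule form_diagonal_columns[OF f], use o in \<open>auto simp: orth_columns_def\<close>)
    also have "\<dots> = 0" by (intro sum.neutral) (auto simp: axis_def z)
    finally show ?thesis .
  qed
  then have "column j Q = 0" by (rule adapted_nondegenerate[OF ad])
  then show False using column_nonzero[OF Q] by blast
qed

lemma form_image: "f (A *v u) (A *v v) = f u ((adj A ** A) *v v)"
  by (simp add: fadj_adjoint[OF ad] flip: matrix_vector_mul_assoc)

lemma adj_mult_self_adjoint: "f ((adj A ** A) *v u) v = f u ((adj A ** A) *v v)"
proof -
  have "f ((adj A ** A) *v u) v = kcnj (f v ((adj A ** A) *v u))" by (rule hermitian_form_commute[OF f])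
  also have "\<dots> = kcnj (f (A *v v) (A *v u))" by (simp only: form_image)
  also have "\<dots> = f (A *v u) (A *v v)" by (rule hermitian_form_commute[OF f, symmetric])
  finally show ?thesis by (simp only: form_image)
qed

text \<open>
  As \<open>o(Au, Av) = o(u, A\<^sup>\<star> A v)\<close>, the image of an orthogonal basis is orthogonal if and only if \<open>A\<^sup>\<star> A\<close>
  maps each basis vector into the orthogonal of the others, that is, into its own line.
\<close>

lemma orthogonal_image_iff_eigenvectors:
  assumes Q: "invertible (Q :: 'k ^ 'n ^ 'n)" and o: "orthc Q"
  shows "orthc (A ** Q) \<longleftrightarrow> (\<forall>j. \<exists>c. (adj A ** A) *v column j Q = c *s column j Q)"
proof
  assume oA: "orthc (A ** Q)"
  show "\<forall>j. \<exists>c. (adj A ** A) *v column j Q = c *s column j Q"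
  proof
    fix j
    define M where "M = adj A ** A"
    define c where "c = kcnj (f (column j Q) (M *v column j Q) / f (column j Q) (column j Q))"
    define x where "x = M *v column j Q - c *s column j Q"
    have "f (column i Q) x = 0" for i
    proof (cases "i = j")
      case True
      then show ?thesis using orthogonal_columns_anisotropic[OF Q o, of j] by (simp add: x_def fs c_def)
    next
      case False
      then have "f (A *v column i Q) (A *v column j Q) = 0" using oA by (simp add: column_mult orth_columns_def)
      then show ?thesis using o False unfolding form_image by (simp add: x_def fs M_def orth_columns_def)
    qed
    then have "f (Q *v y) x = 0" for y
      by (simp add: matrix_mult_sum hermitian_form_sum[OF f] fs)
    then have "f u x = 0" for u
      using matrix_inv_right[OF Q] by (metis matrix_vector_mul_assoc matrix_vector_mul_lid)
    then have "x = 0" by (rule adapted_nondegenerate[OF ad])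
    then show "\<exists>c. (adj A ** A) *v column j Q = c *s column j Q" by (auto simp: x_def M_def)
  qed
next
  assume "\<forall>j. \<exists>c. (adj A ** A) *v column j Q = c *s column j Q"
  then obtain c where c: "\<And>j. (adj A ** A) *v column j Q = c j *s column j Q" by metis
  show "orthc (A ** Q)" using o unfolding orth_columns_def column_mult form_image c by (simp add: fs)
qed

lemma self_adjoint_eigenvalue_real:
  assumes "(adj A ** A) *v v = c *s v" "f v v \<noteq> 0"
  shows "c \<in> \<real>"
proof -
  have "c * f v v = kcnj c * f v v" using adj_mult_self_adjoint[of A v v] by (simp add: assms(1) fs)
  then show ?thesis using assms(2) by (simp add: real_iff_kcnj_eq)
qed

lemma adj_mat: "adj (mat c) = mat (kcnj c)"
proof -
  have ee: "\<forall>i. e i = 1 \<or> e i = - 1" using e by blast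
  have "rdg e ** mat (kcnj c) ** rdg e = mat (kcnj c) ** (rdg e ** rdg e :: 'k ^ 'n ^ 'n)"
    by (simp add: mat_commute matrix_mul_assoc)
  then show ?thesis by (simp add: fadj_eq_cb invP invertible_matrix_inv sign_mult_sign[OF ee])
qed

lemma det_adj: "det (adj A) = kcnj (det A)"
  using det_fadj[OF invP, of e A] e by blast

text \<open>
  \<open>\<sigma>(A\<^sup>-\<^sup>1) = ((A\<^sup>-\<^sup>1)\<^sup>\<star>)\<^sup>-\<^sup>1 = A\<^sup>\<star>\<close>, and \<open>c \<mapsto> 1 / kcnj c\<close> permutes the roots of unity by which lifts differ.
\<close>

lemma \<sigma>_grp_inv_mult:
  fixes A :: "'k ^ 'n ^ 'n"
  assumes A: "det A = 1"
  shows "\<sigma>_grp \<omega> (inv\<^bsub>PSL\<^esub> cls A) \<otimes>\<^bsub>PSL\<^esub> cls A = cls (adj A ** A)" and "det (adj A ** A) = 1"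
proof -
  define B where "B = matrix_inv A"
  have invA: "invertible A" using A by (rule det_1_invertible)
  have dB: "det B = 1" unfolding B_def by (rule det_matrix_inv[OF A])
  have dA: "det (adj A) = 1" by (simp add: det_adj A)
  have AB: "matrix_inv (adj B) = adj A"
  proof (rule matrix_inv_eqI)
    have "adj B ** adj A = adj (A ** B)" by (rule fadj_mult[OF f ad, symmetric])
    also have "\<dots> = mat 1" unfolding B_def matrix_inv_right[OF invA] by (simp add: adj_mat)
    finally show "adj B ** adj A = mat 1" .
  qed
  have l: "\<sigma>_lift \<omega> (mat c ** B) = mat (inverse (kcnj c)) ** adj A" if "c \<noteq> 0" for c
  proof -
    have "adj (mat c ** B) = mat (kcnj c) ** adj B" by (simp add: fadj_mult[OF f ad] adj_mat mat_commute)
    moreover have "invertible (adj B)" by (rule det_1_invertible) (simp add: det_adj dB)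
    ultimately show ?thesis
      using that by (simp add: \<sigma>_lift_def adjoint_for_eq[OF f ad] matrix_inv_mat_mult AB)
  qed
  have "\<sigma>_grp \<omega> (cls B) = cls (adj A)"
  proof
    show "\<sigma>_grp \<omega> (cls B) \<subseteq> cls (adj A)"
    proof
      fix X assume "X \<in> \<sigma>_grp \<omega> (cls B)"
      then obtain c where c: "c ^ CARD('n) = 1" "X = \<sigma>_lift \<omega> (mat c ** B)" by (auto simp: \<sigma>_grp_def cls_eq dB)
      have "kcnj c ^ CARD('n) = 1"
      proof -
        have "kcnj c ^ k = kcnj (c ^ k)" for k by (induction k) auto
        then show ?thesis using c(1) by simp
      qed
      then have "inverse (kcnj c) ^ CARD('n) = 1" by (simp add: power_inverse)
      then show "X \<in> cls (adj A)"
        using c l[OF root_of_unity_nonzero[OF c(1)]] by (auto simp: cls_eq dA)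
    qed
    show "cls (adj A) \<subseteq> \<sigma>_grp \<omega> (cls B)"
    proof
      fix X assume "X \<in> cls (adj A)"
      then obtain c where c: "c ^ CARD('n) = 1" "X = mat c ** adj A" by (auto simp: cls_eq dA)
      define c' where "c' = inverse (kcnj c)"
      have "kcnj c ^ k = kcnj (c ^ k)" for k by (induction k) auto
      then have c': "c' ^ CARD('n) = 1" using c(1) by (simp add: c'_def power_inverse)
      have "inverse (kcnj c') = c" by (simp add: c'_def)
      then have "X = \<sigma>_lift \<omega> (mat c' ** B)" using l[OF root_of_unity_nonzero[OF c']] c(2) by simp
      then show "X \<in> \<sigma>_grp \<omega> (cls B)" using c' by (auto simp: \<sigma>_grp_def cls_eq dB)
    qed
  qed
  then show "\<sigma>_grp \<omega> (inv\<^bsub>PSL\<^esub> cls A) \<otimes>\<^bsub>PSL\<^esub> cls A = cls (adj A ** A)"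
    by (simp add: inv_PSL[OF A] mult_PSL dA A flip: B_def)
  show "det (adj A ** A) = 1" by (simp add: det_mul dA A)
qed

lemma orth_line_bases_PSL_iff:
  fixes A :: "'k ^ 'n ^ 'n"
  assumes A: "det A = 1"
  shows "cls A \<in> orth_line_bases_PSL \<omega> \<longleftrightarrow> (\<exists>Q :: 'k ^ 'n ^ 'n. invertible Q \<and> orthc Q \<and> orthc (A ** Q))"
proof -
  have inv: "invertible (A ** Q)" if "invertible Q" for Q :: "'k ^ 'n ^ 'n"
    using that A by (simp add: invertible_det_nz det_mul)
  have carr: "cls A \<in> carrier PSL" using A by (simp add: carrier_PSL)
  show ?thesis
  proof
    assume "cls A \<in> orth_line_bases_PSL \<omega>"
    then obtain \<C> where C: "\<C> \<in> orth_line_bases \<omega>" "act_lines (cls A) \<C> \<in> orth_line_bases \<omega>"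
      by (auto simp: orth_line_bases_PSL_def)
    then have "line_basis \<C>" by (simp add: orth_line_bases_def)
    then obtain Q where Q: "invertible Q" "\<C> = lines Q" by (rule line_basis_obtain)
    have "orthc Q" using C(1) lines_in_orth_line_bases[OF Q(1)] Q(2) by simp
    moreover have "orthc (A ** Q)"
      using C(2) lines_in_orth_line_bases[OF inv[OF Q(1)]] Q(2) by (simp add: act_lines_lines[OF A])
    ultimately show "\<exists>Q :: 'k ^ 'n ^ 'n. invertible Q \<and> orthc Q \<and> orthc (A ** Q)"
      using Q(1) by blast
  next
    assume "\<exists>Q :: 'k ^ 'n ^ 'n. invertible Q \<and> orthc Q \<and> orthc (A ** Q)"
    then obtain Q :: "'k ^ 'n ^ 'n" where Q: "invertible Q" "orthc Q" "orthc (A ** Q)" by blast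
    have "lines Q \<in> orth_line_bases \<omega>" using lines_in_orth_line_bases[OF Q(1)] Q(2) by simp
    moreover have "act_lines (cls A) (lines Q) \<in> orth_line_bases \<omega>"
      using lines_in_orth_line_bases[OF inv[OF Q(1)]] Q(3) by (simp add: act_lines_lines[OF A])
    ultimately show "cls A \<in> orth_line_bases_PSL \<omega>" using carr unfolding orth_line_bases_PSL_def by blast
  qed
qed

lemma image_orthogonal_iff_diagonalizes:
  fixes A :: "'k ^ 'n ^ 'n"
  assumes A: "det A = 1" and C: "\<C> \<in> orth_line_bases \<omega>"
  shows "act_lines (cls A) \<C> \<in> orth_line_bases \<omega> \<longleftrightarrow> diagonalizes \<C> (cls (adj A ** A))"
proof -
  have "line_basis \<C>" using C by (simp add: orth_line_bases_def)
  then obtain Q where Q: "invertible Q" "\<C> = lines Q" by (rule line_basis_obtain)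
  have o: "orthc Q" using C lines_in_orth_line_bases[OF Q(1)] Q(2) by simp
  have "invertible (A ** Q)" using Q(1) A by (simp add: invertible_det_nz det_mul)
  from lines_in_orth_line_bases[OF this] show ?thesis
    unfolding Q(2) act_lines_lines[OF A] diagonalizes_lines[OF \<sigma>_grp_inv_mult(2)[OF A] Q(1)]
    by (simp add: orthogonal_image_iff_eigenvectors[OF Q(1) o])
qed

lemma orth_line_bases_PSL_iff_real_diagonalizable:
  fixes A :: "'k ^ 'n ^ 'n"
  assumes A: "det A = 1"
  shows "cls A \<in> orth_line_bases_PSL \<omega> \<longleftrightarrow> diagonalizable (cls (adj A ** A)) \<and>
    (\<forall>B\<in>cls A. \<forall>c. eigenvalue (adjoint_for \<omega> B ** B) c \<longrightarrow> c \<in> \<real>)"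
proof
  assume g: "cls A \<in> orth_line_bases_PSL \<omega>"
  then obtain Q :: "'k ^ 'n ^ 'n" where Q: "invertible Q" "orthc Q" "orthc (A ** Q)" unfolding orth_line_bases_PSL_iff[OF A] by blast
  have "diagonalizes (lines Q) (cls (adj A ** A))"
    unfolding diagonalizes_lines[OF \<sigma>_grp_inv_mult(2)[OF A] Q(1)]
    using orthogonal_image_iff_eigenvectors[OF Q(1,2)] Q(3) by blast
  then have "diagonalizable (cls (adj A ** A))" by (auto simp: diagonalizable_def)
  moreover have "c \<in> \<real>" if B: "B \<in> cls A" and ev: "eigenvalue (adjoint_for \<omega> B ** B) c" for B c
  proof -
    have dB: "det B = 1" and cB: "cls B = cls A" using det_in_cls[OF A B] cls_eqI[OF A B] by auto
    obtain Q :: "'k ^ 'n ^ 'n" where Q: "invertible Q" "orthc Q" "orthc (B ** Q)"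
      using g unfolding cB[symmetric] orth_line_bases_PSL_iff[OF dB] by blast
    define M where "M = adj B ** B"
    obtain d where d: "\<And>j. M *v column j Q = d j *s column j Q"
      using orthogonal_image_iff_eigenvectors[OF Q(1,2), of B] Q(3) unfolding M_def by metis
    obtain v where v: "v \<noteq> 0" "M *v v = c *s v"
      using ev unfolding eigenvalue_def adjoint_for_eq[OF f ad] M_def by blast
    define x where "x = matrix_inv Q *v v"
    have vx: "v = Q *v x" by (simp add: x_def matrix_vector_mul_assoc matrix_inv_right[OF Q(1)])
    then have "x \<noteq> 0" using v(1) by auto
    then obtain j where j: "x $ j \<noteq> 0" by (auto simp: vec_eq_iff)
    have "M ** Q = Q ** dg d"
    proof -
      have "column j (M ** Q) = d j *s column j Q" for j by (simp only: column_mult d)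
      moreover have "column j (Q ** dg d) = d j *s column j Q" for j
        by (simp add: vec_eq_iff column_def mult.commute)
      ultimately have "column j (M ** Q) = column j (Q ** dg d)" for j by simp
      then show ?thesis by (simp add: vec_eq_iff column_def)
    qed
    then have "Q *v (dg d *v x) = Q *v (c *s x)"
      using v(2) unfolding vx by (simp add: matrix_vector_mul_assoc matrix_vec_smult)
    then have "matrix_inv Q *v (Q *v (dg d *v x)) = matrix_inv Q *v (Q *v (c *s x))" by simp
    then have "dg d *v x = c *s x"
      by (simp add: matrix_vector_mul_assoc matrix_mul_assoc matrix_inv_left[OF Q(1)])
    then have "(dg d *v x) $ j = (c *s x) $ j" by simp
    then have "c = d j" using j by simp
    moreover have "d j \<in> \<real>"
      using self_adjoint_eigenvalue_real[OF d[unfolded M_def] orthogonal_columns_anisotropic[OF Q(1,2)]] .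
    ultimately show ?thesis by simp
  qed
  ultimately show "diagonalizable (cls (adj A ** A)) \<and>
    (\<forall>B\<in>cls A. \<forall>c. eigenvalue (adjoint_for \<omega> B ** B) c \<longrightarrow> c \<in> \<real>)" by blast
next
  assume R: "diagonalizable (cls (adj A ** A)) \<and>
    (\<forall>B\<in>cls A. \<forall>c. eigenvalue (adjoint_for \<omega> B ** B) c \<longrightarrow> c \<in> \<real>)"
  then obtain \<C> where C: "diagonalizes \<C> (cls (adj A ** A))" by (auto simp: diagonalizable_def)
  then have "line_basis \<C>" by (simp add: diagonalizes_def)
  then obtain Q where Q: "invertible Q" "\<C> = lines Q" by (rule line_basis_obtain)
  obtain d where d: "\<And>j. (adj A ** A) *v column j Q = d j *s column j Q"
    using C unfolding Q(2) diagonalizes_lines[OF \<sigma>_grp_inv_mult(2)[OF A] Q(1)] by metis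
  have "d j \<in> \<real>" for j
  proof -
    have "eigenvalue (adjoint_for \<omega> A ** A) (d j)"
      unfolding eigenvalue_def adjoint_for_eq[OF f ad] using d column_nonzero[OF Q(1)] by blast
    then show ?thesis using R in_cls by blast
  qed
  then have "\<forall>j. \<exists>r. d j = of_real r" by (metis Reals_cases)
  then obtain r where r: "\<And>j. d j = of_real (r j)" by metis
  obtain R :: "'k ^ 'n ^ 'n" where R: "invertible R"
    "\<And>j. \<exists>c::real. (adj A ** A) *v column j R = of_real c *s column j R"
    "\<And>i j. i \<noteq> j \<Longrightarrow> f (column i R) (column j R) = 0"
    by (rule self_adjoint_orthogonal_eigenbasis[OF f ad adj_mult_self_adjoint Q(1) d[unfolded r]]) blast
  then have oR: "orthc R" by (simp add: orth_columns_def)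
  have "orthc (A ** R)" using orthogonal_image_iff_eigenvectors[OF R(1) oR, of A] R(2) by blast
  then show "cls A \<in> orth_line_bases_PSL \<omega>" unfolding orth_line_bases_PSL_iff[OF A] using R(1) oR by blast
qed

section \<open>The decomposition \<open>H W exp(b) H\<close>\<close>

abbreviation "isom N \<equiv> \<forall>u v. f (N *v u) (N *v v) = f u v"

lemma isometry_norm_det:
  assumes "isom N"
  shows "norm (det N) = 1"
proof -
  have "adj N ** N = mat 1"
    by (rule adapted_eqI[OF f ad]) (use assms in \<open>simp add: form_image[symmetric]\<close>)
  then have "det (adj N) * det N = 1" by (rule inverse_pair_det)
  then have "of_real ((norm (det N))\<^sup>2) = (1 :: 'k)"
    by (simp add: det_adj mult.commute[of "kcnj _"] mult_kcnj del: of_real_power)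
  then have "(norm (det N))\<^sup>2 = 1" by (metis of_real_eq_1_iff)
  then show ?thesis using abs_square_eq_1[of "norm (det N)"] by simp
qed

lemma isometry_change_of_basis:
  assumes R: "adapted f R e" and S: "adapted f S e"
  shows "isom (S ** matrix_inv R)"
proof (intro allI)
  fix u v
  have inv: "invertible R" using R by (simp add: adapted_def)
  have "f (S ** matrix_inv R *v u) (S ** matrix_inv R *v v) = hprod (rdg e *v (matrix_inv R *v u)) (matrix_inv R *v v)"
    using S by (simp add: adapted_def flip: matrix_vector_mul_assoc)
  also have "\<dots> = f (R *v (matrix_inv R *v u)) (R *v (matrix_inv R *v v))" using R by (simp add: adapted_def)
  also have "\<dots> = f u v" by (simp add: matrix_vector_mul_assoc matrix_inv_right[OF inv])
  finally show "f (S ** matrix_inv R *v u) (S ** matrix_inv R *v v) = f u v" .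
qed

text \<open>
  By the law of inertia, an orthogonal basis of lines is the image of the standard one under an
  isometry; multiplying one basis vector by a scalar of modulus 1 gives it determinant 1.
\<close>

lemma orthogonal_basis_normalize:
  fixes Q :: "'k ^ 'n ^ 'n"
  assumes Q: "invertible Q" and o: "orthc Q"
  obtains \<pi> u where "bij \<pi>" "\<And>j. u j \<noteq> 0" "adapted f (Q ** mono_mat \<pi> u) e"
    "det (Q ** mono_mat \<pi> u) = det P"
proof -
  define r where "r j = repart (f (column j Q) (column j Q))" for j
  have fr: "f (column j Q) (column j Q) = of_real (r j)" for j
    unfolding r_def by (rule hermitian_form_self[OF f])
  have r0: "r j \<noteq> 0" for j using orthogonal_columns_anisotropic[OF Q o, of j] fr[of j] by auto
  define v where "v j = 1 / sqrt \<bar>r j\<bar>" for j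
  have v: "v j * v j * r j = sgn (r j)" "v j \<noteq> 0" for j
    using r0[of j] by (auto simp: v_def sgn_if)
  have sgn: "sgn (r j) = 1 \<or> sgn (r j) = - 1" for j using r0[of j] by (auto simp: sgn_if)
  define R where "R \<pi> s = Q ** mono_mat \<pi> (\<lambda>j. s j * of_real (v (\<pi> j)))" for \<pi> and s :: "'n \<Rightarrow> 'k"
  have adI: "adapted f (R \<pi> s) (\<lambda>j. sgn (r (\<pi> j)))"
    if \<pi>: "bij \<pi>" and s: "\<And>j. norm (s j) = 1" for \<pi> and s :: "'n \<Rightarrow> 'k"
  proof (rule adaptedI[OF f])
    have "s j \<noteq> 0" for j using s[of j] by auto
    then show "invertible (R \<pi> s)"
      unfolding R_def using \<pi> v(2) by (intro invertible_mult Q invertible_mono_mat) (auto simp: bij_is_inj)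
    show "sgn (r (\<pi> i)) = 1 \<or> sgn (r (\<pi> i)) = - 1" for i by (rule sgn)
    show "f (column i (R \<pi> s)) (column j (R \<pi> s)) = 0" if "i \<noteq> j" for i j
    proof -
      have "\<pi> i \<noteq> \<pi> j" using that bij_is_inj[OF \<pi>] by (auto dest: injD)
      then show ?thesis unfolding R_def column_mult_mono_mat using o by (simp add: fs orth_columns_def)
    qed
    show "f (column i (R \<pi> s)) (column i (R \<pi> s)) = of_real (sgn (r (\<pi> i)))" for i
    proof -
      have "f (column i (R \<pi> s)) (column i (R \<pi> s)) = (s i * kcnj (s i)) * of_real (v (\<pi> i) * v (\<pi> i) * r (\<pi> i))"
        unfolding R_def column_mult_mono_mat by (simp add: fs fr)
      then show ?thesis unfolding mult_kcnj v by (simp add: s)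
    qed
  qed
  have "adapted f (R id (\<lambda>_. 1)) (\<lambda>j. sgn (r (id j)))"
    by (rule adI) auto
  from adapted_permutation[OF ad this] obtain \<pi> where \<pi>: "bij \<pi>" "\<And>i. sgn (r (\<pi> i)) = e i" by auto
  have ad': "adapted f (R \<pi> s) e"
    if "\<And>j. norm (s j) = 1" for s :: "'n \<Rightarrow> 'k"
    using adI[OF \<pi>(1) that] unfolding \<pi>(2) .
  have adR: "adapted f (R \<pi> (\<lambda>_. 1)) e" by (rule ad') simp
  then have invR: "invertible (R \<pi> (\<lambda>_. 1))" by (simp add: adapted_def)
  then have dR: "det (R \<pi> (\<lambda>_. 1)) \<noteq> 0" by (simp add: invertible_det_nz)
  define t where "t = det P / det (R \<pi> (\<lambda>_. 1))"
  have "norm (det (P ** matrix_inv (R \<pi> (\<lambda>_. 1)))) = 1"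
    by (rule isometry_norm_det[OF isometry_change_of_basis[OF adR ad]])
  moreover have "det (P ** matrix_inv (R \<pi> (\<lambda>_. 1))) = t"
    using inverse_pair_det[OF matrix_inv_right[OF invR]] dR by (simp add: det_mul t_def field_simps)
  ultimately have t: "norm t = 1" by simp
  obtain j0 :: 'n where True by blast
  \<comment> \<open>one basis vector is multiplied by \<open>t\<close> to correct the determinant\<close>
  define s where "s j = (if j = j0 then t else 1)" for j
  have s: "norm (s j) = 1" for j by (simp add: s_def t)
  have "det (R \<pi> s) = (\<Prod>j\<in>UNIV. s j) * det (R \<pi> (\<lambda>_. 1))"
    unfolding R_def det_mul by (subst (1 2) det_mono_mat) (simp add: prod.distrib)
  also have "(\<Prod>j\<in>UNIV. s j) = t" by (simp add: s_def)
  finally have "det (R \<pi> s) = det P" using dR by (simp add: t_def)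
  moreover have "s j * of_real (v (\<pi> j)) \<noteq> 0" for j using s[of j] v(2) by auto
  ultimately show ?thesis
    using that[of \<pi> "\<lambda>j. s j * of_real (v (\<pi> j))"] \<pi>(1) ad'[of s, OF s] unfolding R_def by blast
qed

lemma isometry_in_H_grp:
  assumes "det N = 1" "isom N"
  shows "cls N \<in> H_grp \<omega>"
proof -
  have "isometry_of \<omega> (mat 1 ** N)" using assms(2) by (simp add: isometry_of_eq)
  then show ?thesis
    unfolding H_grp_def using assms(1) in_cls
    by (auto simp: carrier_PSL intro!: bexI[of _ N] exI[of _ "1 :: 'k"])
qed

lemma H_grpE:
  assumes "h \<in> H_grp \<omega>"
  obtains N and k :: 'k where "h = cls N" "det N = 1" "k \<noteq> 0" "\<And>u v. f (N *v u) (N *v v) = k * f u v"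
proof -
  obtain N c where N: "N \<in> h" "c \<noteq> 0" "isometry_of \<omega> (mat c ** N)" and h: "h \<in> carrier PSL"
    using assms by (auto simp: H_grp_def)
  obtain B where B: "h = cls B" "det B = 1" using h by (auto simp: carrier_PSL)
  have "c * kcnj c * f (N *v u) (N *v v) = f u v" for u v
    using N(3) by (simp add: isometry_of_eq mat_vec_mult fs mult_ac)
  then have "f (N *v u) (N *v v) = (1 / (c * kcnj c)) * f u v" for u v
    using N(2) by (simp add: field_simps)
  moreover have "det N = 1" "cls N = h" using det_in_cls[OF B(2)] cls_eqI[OF B(2)] N(1) B(1) by auto
  moreover have "1 / (c * kcnj c) \<noteq> 0" using N(2) by simp
  ultimately show ?thesis using that by metis
qed

text \<open>
  Conjugation by a unitary matrix commutes with \<open>X \<mapsto> ct X\<close>, which is \<open>- \<tau>\<close> in the basis \<open>P\<close>, and conjugation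
  by a monomial matrix permutes the entries of a diagonal matrix.
\<close>

lemma unitary_monomial_in_W_hat:
  assumes \<pi>: "bij \<pi>" and u: "\<And>j. norm (u j) = 1" and d: "det (mono_mat \<pi> u) = 1"
  shows "cls (cb P (mono_mat \<pi> u)) \<in> W_hat \<tau> (diag_alg P)"
proof -
  define U where "U = mono_mat \<pi> u"
  have "ct U ** U = mat 1" unfolding U_def ct_mono_mat_mult[OF bij_is_inj[OF \<pi>]] by (simp add: u dg_eq_mat)
  then have UU: "U ** ct U = mat 1" by (rule matrix_left_right_inverse1)
  have iU: "matrix_inv U = ct U" by (rule matrix_inv_eqI[OF UU])
  have invU: "invertible U" using d by (simp add: U_def det_1_invertible)
  define B where "B = cb P U"
  have B: "B = P ** U ** matrix_inv P" by (simp add: B_def cb_def)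
  have dB: "det B = 1"
  proof -
    have "det B = det U * (det P * det (matrix_inv P))" by (simp add: B det_mul)
    then show ?thesis using inverse_pair_det[OF matrix_inv_right[OF invP]] d by (simp add: U_def)
  qed
  have invB: "invertible B" by (rule det_1_invertible[OF dB])
  have BP: "cb B (cb P X) = cb P (cb U X)" for X
  proof -
    have "B ** P = P ** U" by (simp add: B matrix_mul_assoc[symmetric] matrix_inv_left[OF invP])
    then show ?thesis by (simp add: cb_cb invB invP invU)
  qed
  have ctU: "ct (cb (matrix_inv U) X) = cb (matrix_inv U) (ct X)" for X
  proof -
    have i: "matrix_inv (ct U) = U" unfolding iU[symmetric] by (simp add: invU)
    show ?thesis by (simp add: iU cb_def i ct_mult matrix_mul_assoc)
  qed
  have AdB: "Ad (cls B) X = cb B X" for X by (simp add: Ad_cls[OF dB] cb_def)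
  have AdBi: "Ad (inv\<^bsub>PSL\<^esub> cls B) X = cb (matrix_inv B) X" for X
    by (simp add: inv_PSL[OF dB] Ad_cls det_matrix_inv[OF dB] cb_def)
  have "Ad (cls B) (\<tau> (Ad (inv\<^bsub>PSL\<^esub> cls B) X)) = \<tau> X" if X: "X \<in> sl" for X
  proof -
    define Y where "Y = cb (matrix_inv P) X"
    have XY: "X = cb P Y" by (simp add: Y_def invP)
    have "cb B (cb P (cb (matrix_inv U) Y)) = X" by (simp add: BP invU XY)
    then have "cb (matrix_inv B) X = cb P (cb (matrix_inv U) Y)" using invB by (metis cb_inv(2))
    moreover have "cb P (cb (matrix_inv U) Y) \<in> sl"
      using X by (simp add: cb_in_sl invP invU invertible_matrix_inv Y_def)
    ultimately have "\<tau> (cb (matrix_inv B) X) = - cb P (cb (matrix_inv U) (ct Y))"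
      by (simp add: \<tau> invP ctU)
    then have "cb B (\<tau> (cb (matrix_inv B) X)) = - cb P (ct Y)" by (simp add: cb_simps BP invU)
    then show ?thesis by (simp add: AdB AdBi \<tau>[OF X] Y_def)
  qed
  moreover have "cls B \<in> carrier PSL" using dB by (auto simp: carrier_PSL)
  moreover have "Ad (cls B) ` diag_alg P = diag_alg P"
  proof -
    have "inv_into UNIV \<pi> (\<pi> i) = i" for i using \<pi> by (simp add: bij_is_inj)
    then have mv: "cb U (rdg a) = rdg (\<lambda>i. a (inv_into UNIV \<pi> i))" for a
    proof -
      have "rdg (\<lambda>i. a (inv_into UNIV \<pi> i)) ** U = U ** rdg a"
        unfolding U_def dg_mult_mono_mat mono_mat_mult_dg using \<pi> by (simp add: bij_is_inj mult.commute)
      then have "cb U (rdg a) = rdg (\<lambda>i. a (inv_into UNIV \<pi> i)) ** U ** matrix_inv U" by (simp add: cb_def)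
      then show ?thesis by (simp add: matrix_mul_assoc[symmetric] matrix_inv_right[OF invU])
    qed
    have "cb B (cb P (rdg a)) = Dg (\<lambda>i. a (inv_into UNIV \<pi> i))" for a by (simp add: BP mv)
    moreover have "(\<Sum>i\<in>UNIV. a (inv_into UNIV \<pi> i)) = sum a UNIV" for a :: "'n \<Rightarrow> real"
      using sum.reindex_bij_betw[OF bij_imp_bij_inv[OF \<pi>], of a] by simp
    moreover have "(\<lambda>i. (a \<circ> \<pi>) (inv_into UNIV \<pi> i)) = a" for a :: "'n \<Rightarrow> real"
      using \<pi> by (simp add: bij_is_surj surj_f_inv_f)
    moreover have "sum (a \<circ> \<pi>) UNIV = sum a UNIV" for a :: "'n \<Rightarrow> real"
      using sum.reindex_bij_betw[OF \<pi>, of a] by (simp add: o_def)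
    ultimately show ?thesis
      unfolding AdB[abs_def] diag_alg_def image_def
      by (auto; metis)
  qed
  ultimately show ?thesis by (simp add: W_hat_def K_grp_def B_def U_def)
qed

lemma monomial_isometry:
  assumes \<pi>: "bij \<pi>" "\<And>i. e (\<pi> i) = e i" and u: "\<And>j. norm (u j) = 1"
  shows "isom (cb P (mono_mat \<pi> u))"
proof (intro allI)
  fix x y
  define U where "U = mono_mat \<pi> u"
  have UU: "ct U ** U = mat 1" unfolding U_def ct_mono_mat_mult[OF bij_is_inj[OF \<pi>(1)]] by (simp add: u dg_eq_mat)
  have eU: "rdg e ** U = U ** rdg e" unfolding U_def dg_mult_mono_mat mono_mat_mult_dg \<pi>(2) by (simp add: mult.commute)
  define x' y' where "x' = matrix_inv P *v x" and "y' = matrix_inv P *v y"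
  have "f (cb P U *v x) (cb P U *v y) = f (P *v (U *v x')) (P *v (U *v y'))"
    by (simp add: cb_def x'_def y'_def matrix_vector_mul_assoc matrix_mul_assoc)
  also have "\<dots> = hprod (rdg e *v (U *v x')) (U *v y')" by (rule fP)
  also have "\<dots> = hprod ((rdg e ** U) *v x') (U *v y')" by (simp only: matrix_vector_mul_assoc)
  also have "\<dots> = hprod (rdg e *v x') ((ct U ** U) *v y')"
    unfolding eU by (simp add: hprod_ct flip: matrix_vector_mul_assoc)
  also have "\<dots> = f (P *v x') (P *v y')" by (simp add: UU fP)
  also have "\<dots> = f x y" by (simp add: x'_def y'_def matrix_vector_mul_assoc matrix_inv_right[OF invP])
  finally show "f (cb P (mono_mat \<pi> u) *v x) (cb P (mono_mat \<pi> u) *v y) = f x y" by (simp add: U_def)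
qed

lemma isom_mult: "isom A \<Longrightarrow> isom B \<Longrightarrow> isom (A ** B)"
  by (simp flip: matrix_vector_mul_assoc)

lemma isom_inv:
  assumes "isom A" "invertible A" shows "isom (matrix_inv A)"
proof (intro allI)
  fix u v
  have "f (matrix_inv A *v u) (matrix_inv A *v v) = f (A *v (matrix_inv A *v u)) (A *v (matrix_inv A *v v))"
    using assms(1) by simp
  then show "f (matrix_inv A *v u) (matrix_inv A *v v) = f u v"
    by (simp add: matrix_vector_mul_assoc matrix_inv_right[OF assms(2)])
qed

lemma det_cb: "invertible S \<Longrightarrow> det (cb S X) = det (X :: 'k ^ 'n ^ 'n)"
  using inverse_pair_det[OF matrix_inv_right[of S]] by (simp add: cb_def det_mul mult_ac)

abbreviation "HWAH \<bb>p \<equiv> H_grp \<omega> <#>\<^bsub>PSL\<^esub> W_hat \<tau> (diag_alg P) <#>\<^bsub>PSL\<^esub> exp_PSL ` \<bb>p <#>\<^bsub>PSL\<^esub> H_grp \<omega>"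

text \<open>
  Isometries carry the standard basis to the orthogonal basis \<open>Q\<close> and its image \<open>A Q\<close> to the standard
  basis. Between them, \<open>A\<close> becomes a monomial matrix: a unitary one times a positive diagonal one.
  The latter is moved into \<open>exp(\<bb>p)\<close> by a permutation that preserves signs, which is an isometry.
\<close>

lemma orth_line_bases_PSL_decompose:
  fixes A :: "'k ^ 'n ^ 'n"
  assumes bp: "closed_weyl_chamber \<Sigma> (diag_alg P) \<bb>p" and A: "det A = 1"
    and g: "cls A \<in> orth_line_bases_PSL \<omega>"
  shows "cls A \<in> HWAH \<bb>p"
proof -
  obtain Q :: "'k ^ 'n ^ 'n" where Q: "invertible Q" "orthc Q" "orthc (A ** Q)"
    using g unfolding orth_line_bases_PSL_iff[OF A] by blast
  have invAQ: "invertible (A ** Q)" using Q(1) A by (simp add: invertible_det_nz det_mul)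
  obtain \<pi>1 u1 where 1: "bij \<pi>1" "\<And>j. u1 j \<noteq> 0" "adapted f (Q ** mono_mat \<pi>1 u1) e"
    "det (Q ** mono_mat \<pi>1 u1) = det P" using orthogonal_basis_normalize[OF Q(1,2)] by metis
  obtain \<pi>2 u2 where 2: "bij \<pi>2" "\<And>j. u2 j \<noteq> 0" "adapted f (A ** Q ** mono_mat \<pi>2 u2) e"
    "det (A ** Q ** mono_mat \<pi>2 u2) = det P" using orthogonal_basis_normalize[OF invAQ Q(3)] by metis
  define R1 R2 where "R1 = Q ** mono_mat \<pi>1 u1" and "R2 = A ** Q ** mono_mat \<pi>2 u2"
  have ad1: "adapted f R1 e" and ad2: "adapted f R2 e" using 1(3) 2(3) by (auto simp: R1_def R2_def)
  have inv1: "invertible R1" and inv2: "invertible R2" using ad1 ad2 by (auto simp: adapted_def)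
  have dP: "det P \<noteq> 0" using invP by (simp add: invertible_det_nz)
  define h h' where "h = R2 ** matrix_inv P" and "h' = P ** matrix_inv R1"
  have isoh: "isom h" "isom h'" unfolding h_def h'_def
    using isometry_change_of_basis[OF ad ad2] isometry_change_of_basis[OF ad1 ad] by auto
  have dh: "det h = 1" "det h' = 1"
    using inverse_pair_det[OF matrix_inv_right[OF invP]] inverse_pair_det[OF matrix_inv_right[OF inv1]] 1(4) 2(4)
    by (auto simp: h_def h'_def det_mul R1_def[symmetric] R2_def[symmetric])
  define \<pi> where "\<pi> = inv_into UNIV \<pi>2 \<circ> \<pi>1"
  have \<pi>: "bij \<pi>" unfolding \<pi>_def using 1(1) 2(1) by (intro bij_comp bij_imp_bij_inv)
  define u where "u j = u1 j / u2 (\<pi> j)" for j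
  have u: "u j \<noteq> 0" for j by (simp add: u_def 1(2) 2(2))
  define M where "M = mono_mat \<pi> u"
  have "mono_mat \<pi>2 u2 ** M = mono_mat \<pi>1 u1"
  proof -
    have "\<pi>2 \<circ> \<pi> = \<pi>1" using 2(1) by (auto simp: \<pi>_def fun_eq_iff bij_is_surj surj_f_inv_f)
    then show ?thesis unfolding M_def mono_mat_mult by (simp add: u_def 2(2))
  qed
  then have R: "R2 ** M = A ** R1" by (simp add: R1_def R2_def flip: matrix_mul_assoc)
  have A_eq: "A = h ** cb P M ** h'"
  proof -
    have "h ** cb P M ** h' = R2 ** (matrix_inv P ** P) ** M ** (matrix_inv P ** P) ** matrix_inv R1"
      by (simp add: h_def h'_def cb_def matrix_mul_assoc)
    also have "\<dots> = A ** (R1 ** matrix_inv R1)" by (simp add: matrix_inv_left[OF invP] R matrix_mul_assoc)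
    finally show ?thesis by (simp add: matrix_inv_right[OF inv1])
  qed
  have dM: "det M = 1" using A by (simp add: A_eq det_mul dh det_cb invP)
  define a where "a j = ln (norm (u j))" for j
  have exa: "exp (a j) = norm (u j)" for j using u by (simp add: a_def)
  define U where "U = mono_mat \<pi> (\<lambda>j. u j / of_real (norm (u j)))"
  have MU: "M = U ** rdg (\<lambda>j. exp (a j))"
    unfolding U_def mono_mat_mult_dg M_def exa using u by simp
  have "exp (sum a UNIV) = (\<Prod>j\<in>UNIV. norm (u j))" by (simp add: exp_sum exa)
  also have "\<dots> = 1" using dM norm_det_mono_mat[OF bij_is_inj[OF \<pi>], of u] by (simp add: M_def)
  finally have a: "sum a UNIV = 0" by simp
  have dU: "det U = 1"
  proof -
    have "(\<Prod>j\<in>UNIV. of_real (exp (a j))) = (of_real (exp (sum a UNIV)) :: 'k)" by (simp add: exp_sum)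
    then show ?thesis using dM by (simp add: MU det_mul det_dg a)
  qed
  obtain \<rho> where \<rho>: "bij \<rho>" "\<And>i. e (\<rho> i) = e i" "Dg (\<lambda>i. a (\<rho> i)) \<in> \<bb>p"
    using chamber_meets_orbits(2)[OF bp a] by blast
  obtain j0 :: 'n where True by blast
  \<comment> \<open>one entry corrects the determinant of the permutation matrix\<close>
  define w where "w j = (if j = j0 then 1 / det (mono_mat \<rho> (\<lambda>_. 1 :: 'k)) else 1)" for j
  have nd: "norm (det (mono_mat \<rho> (\<lambda>_. 1 :: 'k))) = 1"
    by (simp add: norm_det_mono_mat bij_is_inj[OF \<rho>(1)])
  have w: "norm (w j) = 1" for j by (simp add: w_def norm_divide nd)
  define W where "W = mono_mat \<rho> w"
  have dW: "det W = 1"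
  proof -
    have "det W = det (mono_mat \<rho> (\<lambda>_. 1)) * (\<Prod>j\<in>UNIV. w j)" unfolding W_def by (rule det_mono_mat)
    also have "(\<Prod>j\<in>UNIV. w j) = 1 / det (mono_mat \<rho> (\<lambda>_. 1 :: 'k))" by (simp add: w_def)
    finally show ?thesis using nd by auto
  qed
  have invW: "invertible W" by (rule det_1_invertible[OF dW])
  define D where "D = (rdg (\<lambda>i. exp (a (\<rho> i))) :: 'k ^ 'n ^ 'n)"
  have "rdg (\<lambda>j. exp (a j)) ** W = W ** D"
    unfolding W_def D_def dg_mult_mono_mat mono_mat_mult_dg by (simp add: mult.commute)
  then have "rdg (\<lambda>j. exp (a j)) = W ** D ** matrix_inv W"
    by (metis invW matrix_inv_right matrix_mul_assoc matrix_mul_rid)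
  then have "M = U ** W ** D ** matrix_inv W" by (simp add: MU matrix_mul_assoc)
  then have "cb P M = cb P (U ** W) ** cb P D ** cb P (matrix_inv W)" by (simp add: cb_mult invP)
  then have A_eq': "A = h ** cb P (U ** W) ** cb P D ** (cb P (matrix_inv W) ** h')"
    by (simp add: A_eq matrix_mul_assoc)
  have UW: "U ** W = mono_mat (\<pi> \<circ> \<rho>) (\<lambda>j. u (\<rho> j) / of_real (norm (u (\<rho> j))) * w j)"
    by (simp add: U_def W_def mono_mat_mult)
  have dUW: "det (U ** W) = 1" by (simp add: det_mul dU dW)
  have k: "cls (cb P (U ** W)) \<in> W_hat \<tau> (diag_alg P)"
    unfolding UW
  proof (rule unitary_monomial_in_W_hat)
    show "bij (\<pi> \<circ> \<rho>)" by (rule bij_comp[OF \<rho>(1) \<pi>])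
    show "norm (u (\<rho> j) / of_real (norm (u (\<rho> j))) * w j) = 1" for j using u by (simp add: norm_mult norm_divide w)
    show "det (mono_mat (\<pi> \<circ> \<rho>) (\<lambda>j. u (\<rho> j) / of_real (norm (u (\<rho> j))) * w j)) = 1" using dUW unfolding UW .
  qed
  have ex: "exp_PSL (Dg (\<lambda>i. a (\<rho> i))) = cls (cb P D)"
    by (simp add: exp_PSL_def cls_def matrix_exp_cb invP matrix_exp_rdg D_def)
  have "cb P (matrix_inv W) = matrix_inv (cb P W)"
  proof (rule matrix_inv_eqI[symmetric])
    show "cb P W ** cb P (matrix_inv W) = mat 1" by (simp add: invP matrix_inv_right[OF invW] flip: cb_mult)
  qed
  moreover have "invertible (cb P W)" by (rule det_1_invertible) (simp add: det_cb invP dW)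
  ultimately have "isom (cb P (matrix_inv W))"
    using isom_inv[OF monomial_isometry[OF \<rho>(1,2) w]] by (simp add: W_def)
  then have "isom (cb P (matrix_inv W) ** h')" by (rule isom_mult[OF _ isoh(2)])
  moreover have dWh: "det (cb P (matrix_inv W) ** h') = 1"
    by (simp add: det_mul det_cb invP det_matrix_inv[OF dW] dh)
  ultimately have h2: "cls (cb P (matrix_inv W) ** h') \<in> H_grp \<omega>" by (intro isometry_in_H_grp)
  have h1: "cls h \<in> H_grp \<omega>" by (rule isometry_in_H_grp[OF dh(1) isoh(1)])
  have "det D = of_real (exp (sum (\<lambda>i. a (\<rho> i)) UNIV))" by (simp add: D_def det_dg exp_sum)
  also have "sum (\<lambda>i. a (\<rho> i)) UNIV = 0" using sum.reindex_bij_betw[OF \<rho>(1), of a] a by simp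
  finally have dD: "det D = 1" by simp
  have "cls A = cls h \<otimes>\<^bsub>PSL\<^esub> cls (cb P (U ** W)) \<otimes>\<^bsub>PSL\<^esub> cls (cb P D) \<otimes>\<^bsub>PSL\<^esub> cls (cb P (matrix_inv W) ** h')"
    unfolding A_eq' by (simp add: mult_PSL det_mul[of "_ ** _"] det_mul det_cb invP dh dU dW dD det_matrix_inv)
  then show ?thesis
    unfolding set_mult_def ex[symmetric] using h1 h2 k \<rho>(3) by blast
qed

text \<open>
  Conversely, an element that normalizes \<open>\<bb>\<close> is monomial: if the entries \<open>(k, i)\<close> and \<open>(k, j)\<close> of its
  matrix were nonzero, then no diagonal matrix in \<open>\<bb>\<close> could separate \<open>i\<close> from \<open>j\<close>.
\<close>

lemma decompose_orth_line_bases_PSL: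
  fixes A :: "'k ^ 'n ^ 'n"
  assumes bp: "closed_weyl_chamber \<Sigma> (diag_alg P) \<bb>p" and A: "det A = 1"
    and g: "cls A \<in> HWAH \<bb>p"
  shows "cls A \<in> orth_line_bases_PSL \<omega>"
proof -
  obtain h k X h' where h: "h \<in> H_grp \<omega>" and k: "k \<in> W_hat \<tau> (diag_alg P)" and X: "X \<in> \<bb>p"
    and h': "h' \<in> H_grp \<omega>" and gA: "cls A = h \<otimes>\<^bsub>PSL\<^esub> k \<otimes>\<^bsub>PSL\<^esub> exp_PSL X \<otimes>\<^bsub>PSL\<^esub> h'"
    using g unfolding set_mult_def by blast
  obtain N and c :: 'k where N: "h = cls N" "det N = 1" "c \<noteq> 0" "\<And>u v. f (N *v u) (N *v v) = c * f u v"
    using H_grpE[OF h] by metis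
  obtain N' and c' :: 'k where N': "h' = cls N'" "det N' = 1" "c' \<noteq> 0" "\<And>u v. f (N' *v u) (N' *v v) = c' * f u v"
    using H_grpE[OF h'] by metis
  obtain B where B: "k = cls B" "det B = 1" using k by (auto simp: W_hat_def K_grp_def carrier_PSL)
  have "X \<in> diag_alg P" using chamber_meets_orbits(1)[OF bp] X by blast
  then obtain a where a: "X = Dg a" "sum a UNIV = 0" by (rule diag_algE)
  define D where "D = (rdg (\<lambda>i. exp (a i)) :: 'k ^ 'n ^ 'n)"
  have ex: "exp_PSL X = cls (cb P D)"
    by (simp add: exp_PSL_def cls_def matrix_exp_cb invP matrix_exp_rdg D_def a(1))
  have "det D = of_real (exp (sum a UNIV))" by (simp add: D_def det_dg exp_sum)
  then have dD: "det (cb P D) = 1" by (simp add: det_cb invP a(2))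
  define A' where "A' = N ** B ** cb P D ** N'"
  have dA': "det A' = 1" by (simp add: A'_def det_mul N N' B dD)
  have cA: "cls A = cls A'"
    unfolding gA N(1) N'(1) B(1) ex A'_def by (simp add: mult_PSL det_mul N(2) N'(2) B(2) dD)
  have invN': "invertible N'" by (rule det_1_invertible[OF N'(2)])
  define Q where "Q = matrix_inv N' ** P"
  have invQ: "invertible Q" unfolding Q_def using invN' invP by (intro invertible_mult invertible_matrix_inv)
  have P_orth: "f (column i P) (column j P) = 0" if "i \<noteq> j" for i j
    unfolding column_eq_axis fP hprod_axis dg_vec_nth using that by (simp add: axis_def)
  have "orthc Q"
    unfolding orth_columns_def
  proof (intro allI impI)
    fix i j :: 'n assume "i \<noteq> j"
    have "N' *v column i Q = column i P" for i
      by (simp add: Q_def matrix_mul_assoc matrix_inv_right[OF invN'] flip: column_mult)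
    then have "c' * f (column i Q) (column j Q) = f (column i P) (column j P)" by (metis N'(4))
    then show "f (column i Q) (column j Q) = 0" using P_orth[OF \<open>i \<noteq> j\<close>] N'(3) by simp
  qed
  moreover have "orthc (A' ** Q)"
    unfolding orth_columns_def
  proof (intro allI impI)
    fix i j :: 'n assume ij: "i \<noteq> j"
    define M where "M = cb (matrix_inv P) B"
    have BM: "B = cb P M" by (simp add: M_def invP)
    have invB: "invertible B" by (rule det_1_invertible[OF B(2)])
    have disj: "M $ k $ i * kcnj (M $ k $ j) = 0" for k
    proof (rule ccontr)
      assume "M $ k $ i * kcnj (M $ k $ j) \<noteq> 0"
      then have nz: "M $ k $ i \<noteq> 0" "M $ k $ j \<noteq> 0" by auto
      \<comment> \<open>a diagonal matrix of trace 0 with different entries at \<open>i\<close> and \<open>j\<close>\<close>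
      define b where "b l = (if l = i then 1 else if l = j then - 1 else 0 :: real)" for l
      have "sum b UNIV = sum b {i, j}" by (rule sum.mono_neutral_right) (auto simp: b_def)
      then have "sum b UNIV = 0" using ij by (simp add: b_def)
      then have "Ad (cls B) (Dg b) \<in> diag_alg P" using k Dg_in unfolding W_hat_def B(1) by blast
      then obtain b' where b': "cb B (Dg b) = Dg b'" by (auto simp: Ad_cls[OF B(2)] cb_def[of B] elim: diag_algE)
      have "B ** Dg b = cb B (Dg b) ** B"
        by (simp add: cb_def[of B] matrix_mul_assoc[symmetric] matrix_inv_left[OF invB])
      then have "B ** Dg b = Dg b' ** B" by (simp only: b')
      then have "cb P (M ** rdg b) = cb P (rdg b' ** M)" unfolding BM by (simp add: cb_mult invP)
      then have "M ** rdg b = rdg b' ** M" using invP by (metis cb_inv(2))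
      then have "(M ** rdg b) $ k $ l = (rdg b' ** M) $ k $ l" for l by simp
      then have "M $ k $ l * of_real (b l) = of_real (b' k) * M $ k $ l" for l by simp
      then have "(of_real (b l) :: 'k) = of_real (b' k)" if "M $ k $ l \<noteq> 0" for l
        using that by (metis mult.commute mult_cancel_right)
      then have "b i = b j" using nz by (metis of_real_eq_iff)
      then show False using ij by (simp add: b_def)
    qed
    have col: "column l (A' ** Q) = N *v (P *v (M *v (of_real (exp (a l)) *s axis l 1)))" for l
    proof -
      have "A' ** Q = N ** cb P M ** cb P D ** (N' ** matrix_inv N') ** P"
        by (simp add: A'_def Q_def BM matrix_mul_assoc)
      also have "\<dots> = N ** cb P (M ** D) ** P" by (simp add: matrix_inv_right[OF invN'] cb_mult invP matrix_mul_assoc)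
      also have "\<dots> = N ** (P ** (M ** D))"
        by (simp add: cb_def matrix_mul_assoc[symmetric] matrix_inv_left[OF invP])
      finally have "column l (A' ** Q) = N *v (P *v (M *v (D *v axis l 1)))"
        by (simp add: column_eq_axis matrix_vector_mul_assoc)
      moreover have "D *v axis l 1 = of_real (exp (a l)) *s axis l 1" by (simp add: D_def vec_eq_iff axis_def)
      ultimately show ?thesis by simp
    qed
    have "f (column i (A' ** Q)) (column j (A' ** Q)) =
      c * (of_real (exp (a i)) * of_real (exp (a j)) * hprod (rdg e *v column i M) (column j M))"
      unfolding col N(4) by (simp add: matrix_vec_smult fP fs flip: column_eq_axis)
    moreover have "hprod (rdg e *v column i M) (column j M) = 0"
      unfolding hprod_def by (intro sum.neutral ballI) (use disj in \<open>simp add: column_def\<close>)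
    ultimately show "f (column i (A' ** Q)) (column j (A' ** Q)) = 0" by simp
  qed
  ultimately show ?thesis unfolding cA orth_line_bases_PSL_iff[OF dA'] using invQ by blast
qed

end

theorem proposition4p2:
  fixes \<omega> :: "('k::real_or_complex, 'n::finite) form set"
    and g :: "('k ^ 'n ^ 'n) set"
    and \<tau> :: "'k ^ 'n ^ 'n \<Rightarrow> 'k ^ 'n ^ 'n"
    and \<bb> \<bb>p :: "('k ^ 'n ^ 'n) set"
    and p q :: nat
  assumes "p \<ge> 1" and "q \<ge> 1" and "CARD('n) = p + q" and "CARD('n) \<ge> 3"
    and "\<omega> \<in> form_classes p q"
    and "\<tau> \<in> S_inv \<omega>"
    and "maximal_subalgebra_in (\<pp> \<tau> \<inter> \<qq> \<omega>) \<bb>"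
    and "closed_weyl_chamber (restricted_roots (fixed_subalgebra \<tau> \<omega>) \<bb>) \<bb> \<bb>p"
    and "g \<in> carrier PSL"
  defines "s \<equiv> \<sigma>_grp \<omega> (inv\<^bsub>PSL\<^esub> g) \<otimes>\<^bsub>PSL\<^esub> g"
  shows "(g \<in> orth_line_bases_PSL \<omega> \<longleftrightarrow>
            g \<in> H_grp \<omega> <#>\<^bsub>PSL\<^esub> W_hat \<tau> \<bb> <#>\<^bsub>PSL\<^esub> exp_PSL ` \<bb>p <#>\<^bsub>PSL\<^esub> H_grp \<omega>) \<and>
         (g \<in> orth_line_bases_PSL \<omega> \<longleftrightarrow>
            diagonalizable s \<and>
            (\<forall>A\<in>g. \<forall>c. eigenvalue (adjoint_for \<omega> A ** A) c \<longrightarrow> c \<in> \<real>)) \<and>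
         (g \<in> orth_line_bases_PSL \<omega> \<longrightarrow>
            (\<forall>\<C>\<in>orth_line_bases \<omega>. act_lines g \<C> \<in> orth_line_bases \<omega> \<longleftrightarrow> diagonalizes \<C> s))"
  proof -
  obtain f where f: "hermitian_form f" "has_signature f p q" and \<omega>: "\<omega> = pos_multiples f"
    using form_classes_obtain[OF assms(5)] by blast
  obtain P0 e0 where "adapted f P0 e0" using has_signature_adapted[OF f] by blast
  then obtain P e where P: "adapted f P e" "\<And>X. X \<in> sl \<Longrightarrow> \<tau> X = - cb P (ct (cb (matrix_inv P) X))"
    and b: "\<bb> = diag_alg P"
    using adapted_basis[OF assms(4) f(1)] assms(6,7) unfolding \<omega> by metis
  interpret adapted_triple f P e \<tau> by unfold_locales (use f P in auto)
  obtain A where A: "det A = 1" and g: "g = cls A" using assms(9) by (auto simp: carrier_PSL)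
  have chamber: "closed_weyl_chamber \<Sigma> (diag_alg P) \<bb>p" using assms(8) unfolding b \<omega> .
  have s: "s = cls (adj A ** A)" unfolding s_def g \<omega> by (rule \<sigma>_grp_inv_mult(1)[OF A])
  show ?thesis
    unfolding s unfolding g \<omega> b
    using orth_line_bases_PSL_decompose[OF chamber A] decompose_orth_line_bases_PSL[OF chamber A]
      orth_line_bases_PSL_iff_real_diagonalizable[OF A] image_orthogonal_iff_diagonalizes[OF A]
    by blast
qed


end
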